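(* Let $R$ be a ring with $1$, let $\mathcal{H}$ be a hyperplane arrangement in a finite-dimensional real vector space $U^*$ with intersection lattice $L$ and dual zonotope $\mathcal{Z}\subset U$, and let $\mathcal{D}=(M_0,(M_a)_{a\in\mathbb{A}(L)})$ be an atomic datum of $R$-modules with respect to $L$. Let $N=\mathcal{O}(\mathcal{D},L)$, with differential $\partial$, be the minimal complex associated to $\mathcal{D}$, and suppose that for every $x\in L$ the complex $(N_{\le x},\partial)$ is exact (i.e. $\mathrm{Ker}\,\partial_i=\mathrm{Im}\,\partial_{i+1}$ on $N_{\le x}$ for all $i\ge1$). Then the modified Euler-Poincaré complex $M_{\mathcal{D}}^{\mathcal{Z}}$ is exact (at all places).
   Context: Intersection lattice. The intersection lattice $L$ of $\mathcal{H}$ is the set of all intersections of hyperplanes of $\mathcal{H}$ (with $U^*$ itself as minimal element $0$), ordered by reverse inclusion; it is a geometric lattice with rank = codimension and atoms $\mathbb{A}(L)=\mathcal{H}$. Write $y\prec x$ if $x$ covers $y$, $L_{\le x}=\{y\in L:y\le x\}$. Minimal complex. An atomic datum $\mathcal{D}=(M_0,(M_a)_{a\in\mathbb{A}(L)})$ consists of an $R$-module $M_0$ together with submodules $M_a\subset M_0$, one for each atom. Its minimal complex $\mathcal{O}(\mathcal{D},L)$ is the unique chain complex $N$, $N_i=\bigoplus_{\mathrm{rk}(x)=i}N_x$, $0\le i\le\mathrm{rk}\,L$ (and $N_{\mathrm{rk} L+1}=0$), with $\partial(N_x)\subset\bigoplus_{y\prec x}N_y$ for $x\neq 0$, such that $N_0=M_0$;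 $N_a=M_a$ for each atom, with $\partial|_{N_a}$ the inclusion into $M_0$; and for $\mathrm{rk}(x)=i>1$, $N_x=\mathrm{Ker}(\partial_{i-1}|_{\bigoplus_{y\prec x}N_y})$ with $\partial|_{N_x}$ the inclusion into $\bigoplus_{y\prec x}N_y$. For $x\in L$, $N_{\le x}=\bigoplus_{y\le x}N_y$ is a subcomplex. (Surjectivity of $\partial_1$ onto degree $0$ is not part of exactness.) Dual zonotope. A zonotope dual to $\mathcal{H}$ is a Minkowski sum $\mathcal{Z}=\sum_{H\in\mathcal{H}}[-1,1]u_H\subset U$ with $u_H$ an arbitrary non-zero vector in the line $H^\perp\subset U$ annihilating $H$. Put $n=\dim\mathcal{Z}=\mathrm{rk}\,L$. Let $\mathfrak{E}_i$ be the set of $i$-dimensional faces of $\mathcal{Z}$ ($\mathfrak{E}_{-1}=\{\emptyset\}$). The type of a non-empty face $F$ is $x(F)\in L$, the annihilator in $U^*$ of the linear span of the differences of points of $F$; types of edges are atoms of $L$. Graphical module. $\mathfrak{M}=\mathfrak{M}(\mathcal{Z},\mathcal{D})=\{m:\mathfrak{E}_0\to M_0:\ m(v)-m(v')\in M_{x(e)}\text{ whenever }v,v'\text{ are the endpoints of }e\in\mathfrak{E}_1\}$. Modified Euler-Poincaré complex. For a face $F$ put $M_F=\sum_{a\in\mathbb{A}(L),\,a\le x(F)}M_a\subset M_0$. The Euler-Poincaré complex of $\mathcal{Z}$ with coefficients in $M_0$ is $0\to M_0^{\mathfrak{E}_{-1}}\xrightarrow{\delta_0}M_0^{\mathfrak{E}_0}\xrightarrow{\delta_1}\cdots\xrightarrow{\delta_n}M_0^{\mathfrak{E}_n}\to0$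 with $\delta_j(m)_F=\sum_{F'\prec F}\mathrm{sign}(F',F)m_{F'}$, where $F'$ runs over the facets of $F$ and $\mathrm{sign}(F',F)\in\{\pm1\}$ are the usual incidence signs with respect to fixed orientations of the faces (so $\delta_{j+1}\delta_j=0$). The modified Euler-Poincaré complex $M_{\mathcal{D}}^{\mathcal{Z}}$ is its subcomplex $$0\to M_0\xrightarrow{\delta_0}\mathfrak{M}\xrightarrow{\delta_1}\bigoplus_{F\in\mathfrak{E}_1}M_F\xrightarrow{\delta_2}\bigoplus_{F\in\mathfrak{E}_2}M_F\to\dots\xrightarrow{\delta_n}M_{\mathcal{Z}}\to0$$ (for $n=0$: $0\to M_0\to\mathfrak{M}\to0$). *)

theory Defs
  imports
    "HOL-Analysis.Analysis"
    "HOL-Library.Set_Algebras"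
    "HOL-Library.Function_Algebras"
    "Jordan_Normal_Form.Determinant"
begin

section \<open>Modules over a ring with one\<close>

text \<open>
  The library's module locales require a commutative ring of scalars. The sort used here also
  admits the zero ring, which the class \<open>ring_1\<close> excludes.
\<close>

locale left_module =
  fixes scale :: "'r::{ring,monoid_mult} \<Rightarrow> 'm::ab_group_add \<Rightarrow> 'm"
  assumes scale_right_distrib: "scale r (m + m') = scale r m + scale r m'"
    and scale_left_distrib: "scale (r + s) m = scale r m + scale s m"
    and scale_scale: "scale r (scale s m) = scale (r * s) m"
    and scale_one: "scale 1 m = m"
begin

definition submodule :: "'m set \<Rightarrow> bool" where
  "submodule N \<longleftrightarrow>
     0 \<in> N \<and> (\<forall>m\<in>N. \<forall>m'\<in>N. m + m' \<in> N) \<and> (\<forall>r. \<forall>m\<in>N. scale r m \<in> N)"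

end

text \<open>
  Families indexed by \<open>S\<close> and extended by zero. All index sets below are finite, so that the
  direct sum is the direct product.
\<close>

definition direct_sum :: "'i set \<Rightarrow> ('i \<Rightarrow> 'b::zero set) \<Rightarrow> ('i \<Rightarrow> 'b) set" where
  "direct_sum S N = {c. (\<forall>i\<in>S. c i \<in> N i) \<and> (\<forall>i. i \<notin> S \<longrightarrow> c i = 0)}"

definition exact_at :: "('a \<Rightarrow> 'b) \<Rightarrow> 'a set \<Rightarrow> 'b set \<Rightarrow> ('b \<Rightarrow> 'c::zero) \<Rightarrow> bool" where
  "exact_at f A B g \<longleftrightarrow> {b \<in> B. g b = 0} = f ` A"


section \<open>The intersection lattice\<close>

text \<open>
  The arrangement lies in the dual space of \<open>'u\<close>; in finite dimension every linear form is
  bounded.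
\<close>

type_synonym 'u dual = "'u \<Rightarrow>\<^sub>L real"

definition linear_hyperplane :: "'u::euclidean_space dual set \<Rightarrow> bool" where
  "linear_hyperplane H \<longleftrightarrow> subspace H \<and> dim H + 1 = dim (UNIV :: 'u dual set)"

text \<open>The choice \<open>S = {}\<close> gives the whole dual space.\<close>

definition intersection_lattice :: "'u::euclidean_space dual set set \<Rightarrow> 'u dual set set" where
  "intersection_lattice \<H> = {\<Inter>S | S. S \<subseteq> \<H>}"

text \<open>The order is reverse inclusion: \<open>y \<le> x\<close> in the lattice means \<open>x \<subseteq> y\<close>.\<close>

definition covered_by ::
    "'u::euclidean_space dual set set \<Rightarrow> 'u dual set \<Rightarrow> 'u dual set \<Rightarrow> bool" where
  "covered_by \<H> y x \<longleftrightarrow>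
     y \<in> intersection_lattice \<H> \<and> x \<in> intersection_lattice \<H> \<and> x \<subset> y \<and>
     \<not> (\<exists>z\<in>intersection_lattice \<H>. x \<subset> z \<and> z \<subset> y)"

definition rk :: "'u::euclidean_space dual set \<Rightarrow> nat" where
  "rk x = dim (UNIV :: 'u dual set) - dim x"


section \<open>The minimal complex of an atomic datum\<close>

text \<open>The module \<open>M\<^sub>0\<close> is the whole type \<open>'m\<close>.\<close>

locale atomic_datum = left_module scale
  for scale :: "'r::{ring,monoid_mult} \<Rightarrow> 'm::ab_group_add \<Rightarrow> 'm" +
  fixes \<H> :: "'u::euclidean_space dual set set"
    and M :: "'u dual set \<Rightarrow> 'm set"
  assumes submodule_atom: "a \<in> \<H> \<Longrightarrow> submodule (M a)"

text \<open>
  Unfolding the recursion, \<open>N\<^sub>x\<close> is contained in a direct sum of copies of \<open>M\<^sub>0\<close> indexed by the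
  saturated chains descending from \<open>x\<close> to the minimal element. An element of \<open>N\<^sub>x\<close> is therefore
  encoded as a function \<open>n\<close> on lists \<open>[x\<^sub>1, \<dots>, x\<^sub>r]\<close> with \<open>x\<^sub>1\<close> covered by \<open>x\<close>, \<open>x\<^sub>2\<close> covered by
  \<open>x\<^sub>1\<close>, and so on, and \<open>x\<^sub>r = UNIV\<close>; the empty list is used for \<open>N\<^sub>0 = M\<^sub>0\<close>. The component at \<open>y\<close>
  of the image of \<open>n\<close> under the inclusion into the direct sum of the \<open>N\<^sub>y\<close>, for \<open>y\<close> covered by
  \<open>x\<close>, is \<open>\<lambda>l. n (y # l)\<close>.
\<close>

definition minimal_inclusion :: "('l list \<Rightarrow> 'm) \<Rightarrow> 'l \<Rightarrow> 'l list \<Rightarrow> 'm" where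
  "minimal_inclusion n y = (\<lambda>l. n (y # l))"

definition minimal_boundary ::
    "'u::euclidean_space dual set set \<Rightarrow> ('u dual set \<Rightarrow> 'u dual set list \<Rightarrow> 'm::ab_group_add) \<Rightarrow>
     'u dual set \<Rightarrow> 'u dual set list \<Rightarrow> 'm" where
  "minimal_boundary \<H> c y = (\<Sum>x | covered_by \<H> y x. minimal_inclusion (c x) y)"

text \<open>
  The first numerical argument is the rank of \<open>x\<close>. The condition \<open>n [] = 0\<close> says that \<open>n\<close> is
  determined by its image under the inclusion. For an atom \<open>x\<close> the only element covered by \<open>x\<close> is
  \<open>UNIV\<close>, and \<open>n [UNIV]\<close> is the element of \<open>M x\<close> encoded by \<open>n\<close>.
\<close>

primrec minimal_module_rk ::
    "'u::euclidean_space dual set set \<Rightarrow> ('u dual set \<Rightarrow> 'm::ab_group_add set) \<Rightarrow> nat \<Rightarrow>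
     'u dual set \<Rightarrow> ('u dual set list \<Rightarrow> 'm) set" where
  "minimal_module_rk \<H> M 0 x = {n. \<forall>l. l \<noteq> [] \<longrightarrow> n l = 0}"
| "minimal_module_rk \<H> M (Suc i) x =
     {n. n [] = 0 \<and>
         minimal_inclusion n \<in> direct_sum {y. covered_by \<H> y x} (minimal_module_rk \<H> M i) \<and>
         (if i = 0 then n [UNIV] \<in> M x
          else minimal_boundary \<H> (minimal_inclusion n) = 0)}"

definition minimal_module ::
    "'u::euclidean_space dual set set \<Rightarrow> ('u dual set \<Rightarrow> 'm::ab_group_add set) \<Rightarrow>
     'u dual set \<Rightarrow> ('u dual set list \<Rightarrow> 'm) set" where
  "minimal_module \<H> M x = minimal_module_rk \<H> M (rk x) x"

text \<open>The degree \<open>i\<close> part of the subcomplex \<open>N\<^sub>\<le>\<^sub>x\<close>.\<close>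

definition minimal_complex_below ::
    "'u::euclidean_space dual set set \<Rightarrow> ('u dual set \<Rightarrow> 'm::ab_group_add set) \<Rightarrow>
     'u dual set \<Rightarrow> nat \<Rightarrow> ('u dual set \<Rightarrow> 'u dual set list \<Rightarrow> 'm) set" where
  "minimal_complex_below \<H> M x i =
     direct_sum {y \<in> intersection_lattice \<H>. x \<subseteq> y \<and> rk y = i} (minimal_module \<H> M)"


section \<open>Dual zonotopes and their faces\<close>

definition annihilator :: "'u::euclidean_space dual set \<Rightarrow> 'u set" where
  "annihilator H = {v. \<forall>f\<in>H. blinfun_apply f v = 0}"

definition dual_zonotope :: "'u::euclidean_space dual set set \<Rightarrow> 'u set \<Rightarrow> bool" where
  "dual_zonotope \<H> Z \<longleftrightarrow>
     (\<exists>u. (\<forall>H\<in>\<H>. u H \<in> annihilator H \<and> u H \<noteq> 0) \<and>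
          Z = (\<Sum>H\<in>\<H>. (\<lambda>t. t *\<^sub>R u H) ` {-1..1}))"

text \<open>Since \<open>aff_dim {} = -1\<close>, the empty face is the only face of dimension \<open>-1\<close>.\<close>

definition faces :: "'u::euclidean_space set \<Rightarrow> int \<Rightarrow> 'u set set" where
  "faces Z i = {F. F face_of Z \<and> aff_dim F = i}"

definition direction_space :: "'u::euclidean_space set \<Rightarrow> 'u set" where
  "direction_space F = span {p - q | p q. p \<in> F \<and> q \<in> F}"

definition face_type :: "'u::euclidean_space set \<Rightarrow> 'u dual set" where
  "face_type F = {f. \<forall>v\<in>direction_space F. blinfun_apply f v = 0}"


section \<open>Orientations and incidence signs\<close>

text \<open>
  An orientation of a non-empty face is given by an ordered basis of its direction space. For a
  vertex this is the empty list, so vertices carry the positive orientation. This is the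
  convention under which the first map of the Euler-Poincare complex is the diagonal map and the
  constant functions lie in the graphical module.
\<close>

definition face_orientations :: "'u::euclidean_space set \<Rightarrow> ('u set \<Rightarrow> 'u list) \<Rightarrow> bool" where
  "face_orientations Z ori \<longleftrightarrow>
     (\<forall>F. F face_of Z \<and> F \<noteq> {} \<longrightarrow>
        distinct (ori F) \<and> independent (set (ori F)) \<and>
        span (set (ori F)) = direction_space F)"

definition same_orientation :: "'u::euclidean_space list \<Rightarrow> 'u list \<Rightarrow> bool" where
  "same_orientation bs cs \<longleftrightarrow>
     length bs = length cs \<and>
     (\<exists>A \<in> carrier_mat (length cs) (length cs).
        (\<forall>j<length cs. bs ! j = (\<Sum>i<length cs. (A $$ (i, j)) *\<^sub>R cs ! i)) \<and>
        Determinant.det A > 0)"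

text \<open>
  The outward-normal-first convention. For a facet \<open>F'\<close> of \<open>F\<close>, every vector \<open>p - q\<close> with
  \<open>p \<in> F'\<close> and \<open>q \<in> F - F'\<close> points out of \<open>F\<close> along \<open>F'\<close>, and the orientation obtained from it
  depends neither on \<open>p\<close> nor on \<open>q\<close>.
\<close>

definition incidence_sign ::
    "('u::euclidean_space set \<Rightarrow> 'u list) \<Rightarrow> 'u set \<Rightarrow> 'u set \<Rightarrow> int" where
  "incidence_sign ori F' F =
     (if F' = {} \<or> (\<exists>p\<in>F'. \<exists>q\<in>F - F'. same_orientation ((p - q) # ori F') (ori F))
      then 1 else -1)"


section \<open>The modified Euler-Poincare complex\<close>

text \<open>The sum is the sum of submodules, computed elementwise.\<close>

definition face_module ::
    "'u::euclidean_space dual set set \<Rightarrow> ('u dual set \<Rightarrow> 'm::ab_group_add set) \<Rightarrow>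
     'u set \<Rightarrow> 'm set" where
  "face_module \<H> M F = (\<Sum>a \<in> {a \<in> \<H>. face_type F \<subseteq> a}. M a)"

text \<open>A vertex \<open>v\<close> is represented by the face \<open>{v}\<close>.\<close>

definition graphical_module ::
    "('u::euclidean_space dual set \<Rightarrow> 'm::ab_group_add set) \<Rightarrow> 'u set \<Rightarrow> ('u set \<Rightarrow> 'm) set" where
  "graphical_module M Z =
     {m \<in> direct_sum (faces Z 0) (\<lambda>_. UNIV).
        \<forall>e\<in>faces Z 1. \<forall>v\<in>faces e 0. \<forall>v'\<in>faces e 0. m v - m v' \<in> M (face_type e)}"

text \<open>
  Degrees are dimensions of faces. The modules vanish below degree \<open>-1\<close> and above the dimension
  of \<open>Z\<close>, where there are no faces.
\<close>

definition modified_EP ::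
    "'u::euclidean_space dual set set \<Rightarrow> ('u dual set \<Rightarrow> 'm::ab_group_add set) \<Rightarrow> 'u set \<Rightarrow>
     int \<Rightarrow> ('u set \<Rightarrow> 'm) set" where
  "modified_EP \<H> M Z j =
     (if j = -1 then direct_sum (faces Z (-1)) (\<lambda>_. UNIV)
      else if j = 0 then graphical_module M Z
      else direct_sum (faces Z j) (face_module \<H> M))"

text \<open>
  The differential is defined on all functions on faces at once; it raises the degree by one.
  The index set is not written with \<open>facet_of\<close>, which excludes the empty facet of a vertex.
\<close>

definition EP_differential ::
    "('u::euclidean_space set \<Rightarrow> 'u list) \<Rightarrow> 'u set \<Rightarrow> ('u set \<Rightarrow> 'm::ab_group_add) \<Rightarrow>
     'u set \<Rightarrow> 'm" where
  "EP_differential ori Z m F =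
     (if F face_of Z
      then (\<Sum>F' \<in> faces F (aff_dim F - 1).
              if incidence_sign ori F' F = 1 then m F' else - m F')
      else 0)"

end

theory Submission
  imports Defs
begin

text \<open>
  Every face of \<open>Z\<close> is the set of maximisers \<open>max_face g\<close> of a linear form \<open>g\<close>, and it is
  determined by the signs of \<open>g\<close> on the vectors \<open>u H\<close>; its direction space is spanned by the
  \<open>u H\<close> on which \<open>g\<close> vanishes. Dually, faces are the cells of the arrangement, and the
  Euler-Poincare differential is the boundary map of the cells.

  Resolving each \<open>M\<^sub>F\<close> by the exact complex \<open>N\<close> below the type of \<open>F\<close> produces a double complex.
  Its row for \<open>y\<close> in the lattice consists of the cells contained in the subspace \<open>y\<close>, with
  constant coefficients \<open>N\<^sub>y\<close>, and such a cell complex only has homology in top dimension, that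
  is, for faces of dimension \<open>rk y\<close>. Chasing through the double complex gives exactness in
  degrees at least 2; in degrees 0 and 1 the row of the minimal element suffices, because an edge
  imposes exactly the condition defining the graphical module.

  Homology is computed for the cells in an arbitrary region cut out by sign conditions, by
  induction on the number of hyperplanes without a condition. A further hyperplane either does not
  cut the region or splits it into two open parts of the same dimension and a wall of
  codimension 1. After solving on the two parts, a cocycle is supported on the wall, where it is a
  coboundary by induction unless it is a multiple of the fundamental class; that class bounds one
  of the two parts.
\<close>

section \<open>Determinants of frames\<close>

text \<open>Faces and cells reverse inclusion: a smaller face is a larger cell, so the differential,
  which raises face dimension, lowers cell dimension. The rows only involve subspaces, but cutting a
  subspace leaves half-spaces; this forces arbitrary sign conditions in the induction.

  Coefficients are taken in an arbitrary additive subgroup, because a solution of a row equation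
  must again have values in the module \<open>N\<close> at \<open>y\<close>.

  The orientations of different faces are unrelated, so a fundamental class is constant only up to
  change of frame, and two cells with the same direction space may carry opposite orientations.
  Signs are therefore kept as determinants, which multiply along chains of frames, and are reduced
  to plus or minus only when they act on coefficients.

  The row of \<open>y\<close> has no homology in face dimensions \<open>k > rk y\<close>. The chase
  moves from \<open>(i, k)\<close> to \<open>(i + 1, k + 1)\<close>, so it keeps
  \<open>k > i\<close>, and it stops because there are no faces above the ambient dimension.\<close>

no_notation scalar_prod (infix "\<bullet>" 70)

lemma sum_nth_frame: "distinct cs \<Longrightarrow> (\<Sum>i<length cs. f (cs ! i)) = (\<Sum>b\<in>set cs. f b)"
  by (rule sum.reindex_bij_betw[OF bij_betw_nth]) auto

definition frame :: "'u::euclidean_space list \<Rightarrow> bool" where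
  "frame bs \<longleftrightarrow> distinct bs \<and> independent (set bs)"

definition coord :: "'u::euclidean_space list \<Rightarrow> 'u \<Rightarrow> nat \<Rightarrow> real" where
  "coord cs v i = representation (set cs) v (cs ! i)"

text \<open>Meaningful when the lists have equal length and \<open>bs\<close> lies in the span of
  \<open>cs\<close>. It replaces the existentially quantified matrix in
  \<open>same_orientation\<close> by a number that is multiplicative along chains of frames.\<close>

definition frame_det :: "'u::euclidean_space list \<Rightarrow> 'u list \<Rightarrow> real" where
  "frame_det bs cs = Determinant.det
     (mat (length cs) (length cs) (\<lambda>(i, j). coord cs (bs ! j) i))"

lemma coord_sum:
  assumes "frame cs" "v \<in> span (set cs)"
  shows "(\<Sum>i<length cs. coord cs v i *\<^sub>R cs ! i) = v"
  using assms sum_nth_frame[of cs "\<lambda>b. representation (set cs) v b *\<^sub>R b"]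
  by (simp add: frame_def coord_def real_vector.sum_representation_eq)

lemma coord_unique:
  assumes "frame cs" "v = (\<Sum>i<length cs. a i *\<^sub>R cs ! i)" "k < length cs"
  shows "coord cs v k = a k"
proof -
  define g where "g b = a (THE i. i < length cs \<and> cs ! i = b)" for b
  have g: "g (cs ! i) = a i" if "i < length cs" for i
  proof -
    have "(THE i'. i' < length cs \<and> cs ! i' = cs ! i) = i"
      using that assms(1) by (auto simp: frame_def nth_eq_iff_index_eq intro!: the_equality)
    then show ?thesis by (simp add: g_def)
  qed
  have "v = (\<Sum>i<length cs. g (cs ! i) *\<^sub>R cs ! i)" using g assms(2) by simp
  also have "\<dots> = (\<Sum>b\<in>set cs. g b *\<^sub>R b)"
    using sum_nth_frame[of cs "\<lambda>b. g b *\<^sub>R b"] assms(1) by (simp add: frame_def)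
  finally have v: "v = (\<Sum>b\<in>set cs. g b *\<^sub>R b)" .
  have vs: "v \<in> span (set cs)" unfolding v by (intro span_sum span_scale span_base)
  have "(\<Sum>b\<in>set cs. (representation (set cs) v b - g b) *\<^sub>R b) = 0"
    using real_vector.sum_representation_eq[of "set cs" v "set cs"] assms(1) vs v
    by (simp add: frame_def scaleR_diff_left sum_subtractf)
  moreover have "cs ! k \<in> set cs" using assms(3) by simp
  moreover have "independent (set cs)" using assms(1) by (simp add: frame_def)
  ultimately have "representation (set cs) v (cs ! k) - g (cs ! k) = 0"
    using independentD[of "set cs" "set cs" "\<lambda>b. representation (set cs) v b - g b" "cs ! k"] by simp
  then show ?thesis using g[OF assms(3)] by (simp add: coord_def)
qed

text \<open>Coordinates in a frame are unique, so any matrix expressing \<open>bs\<close> through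
  \<open>cs\<close> is the one in the definition. Later computations only have to exhibit a
  convenient matrix.\<close>

lemma frame_det_eq:
  assumes "frame cs" "A \<in> carrier_mat (length cs) (length cs)"
    and "\<And>j. j < length cs \<Longrightarrow> bs ! j = (\<Sum>i<length cs. A $$ (i, j) *\<^sub>R cs ! i)"
  shows "frame_det bs cs = Determinant.det A"
proof -
  have "mat (length cs) (length cs) (\<lambda>(i, j). coord cs (bs ! j) i) = A"
    using assms(2) coord_unique[OF assms(1) assms(3)] by (intro eq_matI) auto
  then show ?thesis by (simp add: frame_det_def)
qed

lemma same_orientation_iff:
  assumes "frame cs" "length bs = length cs" "set bs \<subseteq> span (set cs)"
  shows "same_orientation bs cs \<longleftrightarrow> frame_det bs cs > 0"
proof
  assume "same_orientation bs cs"
  then obtain A where "A \<in> carrier_mat (length cs) (length cs)" "Determinant.det A > 0"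
    "\<forall>j<length cs. bs ! j = (\<Sum>i<length cs. (A $$ (i, j)) *\<^sub>R cs ! i)"
    unfolding same_orientation_def by auto
  then show "frame_det bs cs > 0" using frame_det_eq[OF assms(1)] by simp
next
  assume p: "frame_det bs cs > 0"
  let ?A = "mat (length cs) (length cs) (\<lambda>(i, j). coord cs (bs ! j) i)"
  have "\<forall>j<length cs. bs ! j = (\<Sum>i<length cs. (?A $$ (i, j)) *\<^sub>R cs ! i)"
  proof (intro allI impI)
    fix j assume j: "j < length cs"
    then have "bs ! j \<in> span (set cs)" using assms(2,3) by auto
    from coord_sum[OF assms(1) this]
    show "bs ! j = (\<Sum>i<length cs. (?A $$ (i, j)) *\<^sub>R cs ! i)" using j by simp
  qed
  then show "same_orientation bs cs" unfolding same_orientation_def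
    using p assms(2) by (auto simp: frame_det_def intro!: bexI[of _ ?A])
qed

lemma frame_det_trans:
  assumes "frame cs" "frame ds" "length bs = length cs" "length cs = length ds"
    and "set bs \<subseteq> span (set cs)" "set cs \<subseteq> span (set ds)"
  shows "frame_det bs ds = frame_det bs cs * frame_det cs ds"
proof -
  let ?n = "length ds"
  let ?A = "mat ?n ?n (\<lambda>(i, j). coord ds (cs ! j) i)"
  let ?B = "mat ?n ?n (\<lambda>(i, j). coord cs (bs ! j) i)"
  have "bs ! j = (\<Sum>i<?n. (?A * ?B) $$ (i, j) *\<^sub>R ds ! i)" if j: "j < ?n" for j
  proof -
    have "bs ! j = (\<Sum>k<?n. coord cs (bs ! j) k *\<^sub>R cs ! k)"
    proof -
      have "bs ! j \<in> span (set cs)" using assms j by auto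
      then show ?thesis using coord_sum[OF assms(1)] assms(4) by simp
    qed
    also have "\<dots> = (\<Sum>k<?n. coord cs (bs ! j) k *\<^sub>R (\<Sum>i<?n. coord ds (cs ! k) i *\<^sub>R ds ! i))"
    proof (intro sum.cong refl)
      fix k assume "k \<in> {..<?n}"
      then have "cs ! k \<in> span (set ds)" using assms by auto
      then show "coord cs (bs ! j) k *\<^sub>R cs ! k
          = coord cs (bs ! j) k *\<^sub>R (\<Sum>i<?n. coord ds (cs ! k) i *\<^sub>R ds ! i)"
        using coord_sum[OF assms(2)] by simp
    qed
    also have "\<dots> = (\<Sum>i<?n. (\<Sum>k<?n. coord ds (cs ! k) i * coord cs (bs ! j) k) *\<^sub>R ds ! i)"
      by (simp add: scaleR_sum_right scaleR_sum_left mult.commute)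
        (rule sum.swap)
    also have "\<dots> = (\<Sum>i<?n. (?A * ?B) $$ (i, j) *\<^sub>R ds ! i)"
      using j by (intro sum.cong refl) (simp add: scalar_prod_def atLeast0LessThan)
    finally show ?thesis .
  qed
  then have "frame_det bs ds = Determinant.det (?A * ?B)"
    by (intro frame_det_eq assms(2)) auto
  also have "\<dots> = Determinant.det ?A * Determinant.det ?B"
    by (rule det_mult[of _ ?n]) auto
  finally show ?thesis using assms(4) by (simp add: frame_det_def)
qed

lemma frame_det_self: "frame bs \<Longrightarrow> frame_det bs bs = 1"
proof -
  assume "frame bs"
  then have "frame_det bs bs = Determinant.det (1\<^sub>m (length bs) :: real mat)"
    by (rule frame_det_eq) (auto simp: if_distrib[of "\<lambda>x. x *\<^sub>R _"] sum.delta cong: if_cong)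
  then show ?thesis by simp
qed

lemma frame_det_nonzero:
  assumes "frame bs" "frame cs" "length bs = length cs" "span (set bs) = span (set cs)"
  shows "frame_det bs cs \<noteq> 0"
proof -
  have "frame_det bs cs * frame_det cs bs = frame_det bs bs"
    using frame_det_trans[of cs bs bs] assms span_superset by metis
  then show ?thesis using frame_det_self[OF assms(1)] by auto
qed

lemma frame_Cons: "frame (v # bs) \<longleftrightarrow> frame bs \<and> v \<notin> span (set bs)"
proof
  assume "frame (v # bs)"
  then have "v \<notin> set bs" "distinct bs" "independent (insert v (set bs))" by (auto simp: frame_def)
  then show "frame bs \<and> v \<notin> span (set bs)"
    by (auto simp: frame_def real_vector.independent_insert)
next
  assume "frame bs \<and> v \<notin> span (set bs)"
  then show "frame (v # bs)"
    using span_base[of v "set bs"] by (auto simp: frame_def real_vector.independent_insert)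
qed

text \<open>Modulo the span of \<open>cs\<close> the vector \<open>v\<close> is \<open>c\<close>
  times \<open>w\<close>, so the matrix is block triangular with corner entry
  \<open>c\<close>.\<close>

lemma frame_det_Cons:
  assumes "frame (w # cs)" "length bs = length cs" "set bs \<subseteq> span (set cs)"
    and v: "v - c *\<^sub>R w \<in> span (set cs)"
  shows "frame_det (v # bs) (w # cs) = c * frame_det bs cs"
proof -
  let ?n = "length cs"
  have f: "frame cs" using assms(1) by (simp add: frame_Cons)
  let ?d = "v - c *\<^sub>R w"
  let ?A1 = "mat 1 1 (\<lambda>_. c)"
  let ?A2 = "0\<^sub>m 1 ?n :: real mat"
  let ?A3 = "mat ?n 1 (\<lambda>(i, j). coord cs ?d i)"
  let ?A4 = "mat ?n ?n (\<lambda>(i, j). coord cs (bs ! j) i)"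
  let ?A = "four_block_mat ?A1 ?A2 ?A3 ?A4"
  have "(v # bs) ! j = (\<Sum>i<length (w # cs). ?A $$ (i, j) *\<^sub>R (w # cs) ! i)"
    if "j < length (w # cs)" for j
  proof (cases j)
    case 0
    have "(\<Sum>i<length (w # cs). ?A $$ (i, 0) *\<^sub>R (w # cs) ! i)
        = c *\<^sub>R w + (\<Sum>i<?n. coord cs ?d i *\<^sub>R cs ! i)"
      by (simp add: sum.lessThan_Suc_shift del: sum.lessThan_Suc)
    also have "\<dots> = v" using coord_sum[OF f v] by simp
    finally show ?thesis using 0 by simp
  next
    case (Suc k)
    then have k: "k < ?n" using that by simp
    have "bs ! k \<in> span (set cs)" using assms k by auto
    then have "(\<Sum>i<?n. coord cs (bs ! k) i *\<^sub>R cs ! i) = bs ! k" using coord_sum[OF f] by simp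
    then show ?thesis using Suc k by (simp add: sum.lessThan_Suc_shift del: sum.lessThan_Suc)
  qed
  moreover have "?A \<in> carrier_mat (length (w # cs)) (length (w # cs))" by auto
  ultimately have "frame_det (v # bs) (w # cs) = Determinant.det ?A"
    using frame_det_eq[OF assms(1)] by blast
  also have "\<dots> = Determinant.det ?A1 * Determinant.det ?A4"
    by (rule det_four_block_mat_upper_right_zero) auto
  finally show ?thesis by (simp add: frame_det_def det_single)
qed

text \<open>This transposition is the source of the sign that makes the differential square to
  zero.\<close>

lemma frame_det_swap:
  assumes "frame (v # w # bs)"
  shows "frame_det (w # v # bs) (v # w # bs) = -1"
proof -
  let ?n = "Suc (Suc (length bs))"
  have "length (v # w # bs) = ?n" by simp
  let ?A = "swaprows_mat ?n 0 1 :: real mat"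
  have s: "(\<Sum>i<?n. f i) = f 0 + (f 1 + (\<Sum>i<length bs. f (Suc (Suc i))))" for f :: "nat \<Rightarrow> 'a"
    by (simp add: sum.lessThan_Suc_shift del: sum.lessThan_Suc)
  have "(w # v # bs) ! j = (\<Sum>i<length (v # w # bs). ?A $$ (i, j) *\<^sub>R (v # w # bs) ! i)"
    if "j < length (v # w # bs)" for j
  proof -
    consider "j = 0" | "j = 1" | k where "j = Suc (Suc k)"
      by (metis One_nat_def not0_implies_Suc)
    then show ?thesis
    proof cases
      case 3
      then show ?thesis using that
        by (simp add: s if_distrib[of "\<lambda>x. x *\<^sub>R _"] del: sum.lessThan_Suc cong: if_cong)
    qed (simp_all add: s del: sum.lessThan_Suc)
  qed
  then have "frame_det (w # v # bs) (v # w # bs) = Determinant.det ?A"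
    by (intro frame_det_eq assms) auto
  then show ?thesis by (simp add: det_swaprows_mat)
qed

section \<open>Faces of a zonotope\<close>

lemma mult_le_abs:
  fixes t x :: real
  assumes "\<bar>t\<bar> \<le> 1"
  shows "t * x \<le> \<bar>x\<bar>"
proof -
  have "\<bar>t * x\<bar> \<le> 1 * \<bar>x\<bar>" unfolding abs_mult using assms by (intro mult_right_mono) auto
  then show ?thesis by linarith
qed

text \<open>This is the direction space of the face on which \<open>g\<close> is maximal, see
  \<open>direction_space_max_face\<close>.\<close>

definition flat :: "'i set \<Rightarrow> ('i \<Rightarrow> 'u::euclidean_space) \<Rightarrow> 'u \<Rightarrow> 'u set" where
  "flat I u g = span (u ` {i \<in> I. g \<bullet> u i = 0})"

locale zonotope =
  fixes I :: "'i set" and u :: "'i \<Rightarrow> 'u::euclidean_space" and Z :: "'u set"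
  assumes finite_index: "finite I"
    and Z_eq: "Z = (\<Sum>i\<in>I. (\<lambda>t. t *\<^sub>R u i) ` {-1..1})"
begin

definition max_face :: "'u \<Rightarrow> 'u set" where
  "max_face g = {v \<in> Z. \<forall>w\<in>Z. g \<bullet> w \<le> g \<bullet> v}"

lemma mem_Z: "v \<in> Z \<longleftrightarrow> (\<exists>t. (\<forall>i\<in>I. \<bar>t i\<bar> \<le> 1) \<and> v = (\<Sum>i\<in>I. t i *\<^sub>R u i))"
proof
  assume "v \<in> Z"
  then obtain s where s: "v = sum s I" "\<forall>i\<in>I. s i \<in> (\<lambda>t. t *\<^sub>R u i) ` {-1..1}"
    unfolding Z_eq set_sum_alt[OF finite_index] by blast
  then have "\<forall>i\<in>I. \<exists>t. s i = t *\<^sub>R u i \<and> \<bar>t\<bar> \<le> 1" by (fastforce simp: abs_le_iff)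
  then obtain t where "\<forall>i\<in>I. s i = t i *\<^sub>R u i \<and> \<bar>t i\<bar> \<le> 1" by metis
  then show "\<exists>t. (\<forall>i\<in>I. \<bar>t i\<bar> \<le> 1) \<and> v = (\<Sum>i\<in>I. t i *\<^sub>R u i)" using s(1) by auto
next
  assume "\<exists>t. (\<forall>i\<in>I. \<bar>t i\<bar> \<le> 1) \<and> v = (\<Sum>i\<in>I. t i *\<^sub>R u i)"
  then obtain t where "\<forall>i\<in>I. \<bar>t i\<bar> \<le> 1" "v = (\<Sum>i\<in>I. t i *\<^sub>R u i)" by blast
  then show "v \<in> Z" unfolding Z_eq set_sum_alt[OF finite_index]
    by (intro CollectI exI[of _ "\<lambda>i. t i *\<^sub>R u i"]) (auto simp: abs_le_iff)
qed

lemma polytope_Z: "polytope Z"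
proof -
  have "(\<lambda>t. t *\<^sub>R x) ` {-1..1} = convex hull {- x, x}" for x :: 'u
  proof -
    have "(\<lambda>t. t *\<^sub>R x) ` {-1..1} = closed_segment (- x) x"
    proof (intro Set.set_eqI iffI)
      fix y assume "y \<in> (\<lambda>t. t *\<^sub>R x) ` {-1..1}"
      then obtain t where "t \<in> {-1..1}" "y = t *\<^sub>R x" by blast
      then have t: "y = t *\<^sub>R x" "-1 \<le> t" "t \<le> 1" by auto
      then have "y = (1 - (t + 1) / 2) *\<^sub>R (- x) + ((t + 1) / 2) *\<^sub>R x"
        using scaleR_left_diff_distrib[of "(t + 1) / 2" "1 - (t + 1) / 2" x] by (simp add: field_simps)
      then show "y \<in> closed_segment (- x) x" unfolding closed_segment_def
        by (intro CollectI exI[of _ "(t + 1) / 2"] conjI) (use t(2,3) in auto)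
    next
      fix y assume "y \<in> closed_segment (- x) x"
      then obtain s where s: "y = (1 - s) *\<^sub>R (- x) + s *\<^sub>R x" "0 \<le> s" "s \<le> 1"
        by (auto simp: closed_segment_def)
      then have "y = (s - (1 - s)) *\<^sub>R x" using scaleR_left_diff_distrib[of s "1 - s" x] by (simp del: scaleR_left_diff_distrib)
      moreover have "s - (1 - s) \<in> {-1..1}" using s(2,3) by simp
      ultimately show "y \<in> (\<lambda>t. t *\<^sub>R x) ` {-1..1}" by (rule image_eqI)
    qed
    then show ?thesis by (simp add: segment_convex_hull)
  qed
  then have "Z = convex hull (\<Sum>i\<in>I. {- u i, u i})" by (simp add: Z_eq convex_hull_set_sum)
  moreover have "finite (\<Sum>i\<in>I. {- u i, u i})"
    using finite_index by (induction I rule: finite_induct) (auto intro: finite_set_plus)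
  ultimately show ?thesis using polytope_def by blast
qed

lemma polyhedron_Z: "polyhedron Z"
  by (simp add: polytope_Z polytope_imp_polyhedron)

lemma convex_Z: "convex Z"
  by (simp add: polytope_Z polytope_imp_convex)

lemma inner_Z_le:
  assumes "\<forall>i\<in>I. \<bar>t i\<bar> \<le> 1"
  shows "g \<bullet> (\<Sum>i\<in>I. t i *\<^sub>R u i) \<le> (\<Sum>i\<in>I. \<bar>g \<bullet> u i\<bar>)"
  unfolding inner_sum_right inner_scaleR_right by (rule sum_mono, rule mult_le_abs) (use assms in auto)

text \<open>The right-hand sum is the value of the support function of \<open>Z\<close> at
  \<open>g\<close>. Each summand on the left is bounded by the corresponding absolute value, so
  equality of the sums forces equality term by term.\<close>

lemma inner_Z_eq_iff:
  assumes "\<forall>i\<in>I. \<bar>t i\<bar> \<le> 1"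
  shows "g \<bullet> (\<Sum>i\<in>I. t i *\<^sub>R u i) = (\<Sum>i\<in>I. \<bar>g \<bullet> u i\<bar>)
    \<longleftrightarrow> (\<forall>i\<in>I. g \<bullet> u i \<noteq> 0 \<longrightarrow> t i = sgn (g \<bullet> u i))"
proof -
  have le: "t i * (g \<bullet> u i) \<le> \<bar>g \<bullet> u i\<bar>" if "i \<in> I" for i
    using assms that by (intro mult_le_abs) auto
  have "g \<bullet> (\<Sum>i\<in>I. t i *\<^sub>R u i) = (\<Sum>i\<in>I. \<bar>g \<bullet> u i\<bar>)
    \<longleftrightarrow> (\<Sum>i\<in>I. \<bar>g \<bullet> u i\<bar> - t i * (g \<bullet> u i)) = 0"
    by (auto simp: inner_sum_right sum_subtractf)
  also have "\<dots> \<longleftrightarrow> (\<forall>i\<in>I. \<bar>g \<bullet> u i\<bar> - t i * (g \<bullet> u i) = 0)"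
    using le by (intro sum_nonneg_eq_0_iff finite_index) auto
  also have "\<dots> \<longleftrightarrow> (\<forall>i\<in>I. g \<bullet> u i \<noteq> 0 \<longrightarrow> t i = sgn (g \<bullet> u i))"
  proof (intro ball_cong refl)
    fix i
    have "\<bar>a\<bar> - b * a = 0 \<longleftrightarrow> (a \<noteq> 0 \<longrightarrow> b = sgn a)" for a b :: real
    proof -
      have "\<bar>a\<bar> - b * a = (sgn a - b) * a" by (simp add: abs_sgn algebra_simps)
      then show ?thesis by auto
    qed
    then show "(\<bar>g \<bullet> u i\<bar> - t i * (g \<bullet> u i) = 0) = (g \<bullet> u i \<noteq> 0 \<longrightarrow> t i = sgn (g \<bullet> u i))" .
  qed
  finally show ?thesis .
qed

text \<open>Generators orthogonal to \<open>g\<close> get coefficient 0, so this is the centre of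
  \<open>max_face g\<close>; it is a vertex only if \<open>g\<close> vanishes on no non-zero
  generator. Its coefficients record the sign vector of \<open>g\<close>.\<close>

definition vertex_towards :: "'u \<Rightarrow> 'u" where
  "vertex_towards g = (\<Sum>i\<in>I. sgn (g \<bullet> u i) *\<^sub>R u i)"

lemma inner_vertex_towards: "g \<bullet> vertex_towards g = (\<Sum>i\<in>I. \<bar>g \<bullet> u i\<bar>)"
  unfolding vertex_towards_def by (subst inner_Z_eq_iff) (auto simp: sgn_if)

lemma vertex_towards_in: "vertex_towards g \<in> Z"
  unfolding vertex_towards_def mem_Z by (intro exI[of _ "\<lambda>i. sgn (g \<bullet> u i)"]) (auto simp: sgn_if)

lemma max_face_eq: "max_face g = Z \<inter> {v. g \<bullet> v = (\<Sum>i\<in>I. \<bar>g \<bullet> u i\<bar>)}"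
proof -
  have le: "g \<bullet> w \<le> (\<Sum>i\<in>I. \<bar>g \<bullet> u i\<bar>)" if "w \<in> Z" for w using that inner_Z_le unfolding mem_Z by blast
  show ?thesis
  proof (intro Set.set_eqI iffI)
    fix v assume "v \<in> max_face g"
    then show "v \<in> Z \<inter> {v. g \<bullet> v = (\<Sum>i\<in>I. \<bar>g \<bullet> u i\<bar>)}"
      using le[of v] vertex_towards_in[of g] inner_vertex_towards[of g] unfolding max_face_def by force
  qed (use le in \<open>auto simp: max_face_def\<close>)
qed

lemma vertex_towards_in_max_face: "vertex_towards g \<in> max_face g"
  by (simp add: max_face_eq vertex_towards_in inner_vertex_towards)

lemma max_face_nonempty: "max_face g \<noteq> {}"
  using vertex_towards_in_max_face by blast

text \<open>A point of \<open>Z\<close> may have many coefficient families; the criterion is valid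
  for each of them, so any one may be tested.\<close>

lemma sum_in_max_face:
  assumes "\<forall>i\<in>I. \<bar>t i\<bar> \<le> 1"
  shows "(\<Sum>i\<in>I. t i *\<^sub>R u i) \<in> max_face g \<longleftrightarrow> (\<forall>i\<in>I. g \<bullet> u i \<noteq> 0 \<longrightarrow> t i = sgn (g \<bullet> u i))"
  using inner_Z_eq_iff[OF assms, of g] assms by (auto simp: max_face_eq mem_Z)

text \<open>It suffices to test the centre of \<open>max_face f\<close>, whose coefficients are the
  signs of \<open>f\<close>. Passing to a smaller face keeps all non-zero signs and may only turn
  zeros into signs.\<close>

lemma max_face_subset:
  "max_face f \<subseteq> max_face g \<longleftrightarrow> (\<forall>i\<in>I. g \<bullet> u i \<noteq> 0 \<longrightarrow> sgn (f \<bullet> u i) = sgn (g \<bullet> u i))"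
proof
  assume "max_face f \<subseteq> max_face g"
  then have "vertex_towards f \<in> max_face g" using vertex_towards_in_max_face by blast
  then show "\<forall>i\<in>I. g \<bullet> u i \<noteq> 0 \<longrightarrow> sgn (f \<bullet> u i) = sgn (g \<bullet> u i)"
    unfolding vertex_towards_def by (subst (asm) sum_in_max_face) (auto simp: sgn_if)
next
  assume r: "\<forall>i\<in>I. g \<bullet> u i \<noteq> 0 \<longrightarrow> sgn (f \<bullet> u i) = sgn (g \<bullet> u i)"
  show "max_face f \<subseteq> max_face g"
  proof
    fix v assume v: "v \<in> max_face f"
    then obtain t where t: "\<forall>i\<in>I. \<bar>t i\<bar> \<le> 1" "v = (\<Sum>i\<in>I. t i *\<^sub>R u i)"
      by (auto simp: max_face_eq mem_Z)
    then have "\<forall>i\<in>I. f \<bullet> u i \<noteq> 0 \<longrightarrow> t i = sgn (f \<bullet> u i)" using v sum_in_max_face by blast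
    then show "v \<in> max_face g" unfolding t(2) sum_in_max_face[OF t(1)] using r
      by (metis sgn_zero_iff)
  qed
qed

lemma max_face_eq_iff: "max_face f = max_face g \<longleftrightarrow> (\<forall>i\<in>I. sgn (f \<bullet> u i) = sgn (g \<bullet> u i))"
  unfolding set_eq_subset max_face_subset by (metis sgn_zero_iff)

text \<open>Faces of a polyhedron are exposed, and the supporting form of the exposed face is the
  required \<open>g\<close>; \<open>Z\<close> itself comes from \<open>g = 0\<close>.\<close>

lemma face_of_Z_iff: "F face_of Z \<and> F \<noteq> {} \<longleftrightarrow> (\<exists>g. F = max_face g)"
proof
  assume F: "F face_of Z \<and> F \<noteq> {}"
  then have "F exposed_face_of Z" using exposed_face_of_polyhedron polyhedron_Z by blast
  then obtain a b where ab: "Z \<subseteq> {x. a \<bullet> x \<le> b}" "F = Z \<inter> {x. a \<bullet> x = b}"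
    unfolding exposed_face_of_def by blast
  moreover obtain p where "p \<in> F" using F by blast
  ultimately have "F = max_face a" unfolding max_face_def by force
  then show "\<exists>g. F = max_face g" ..
next
  assume "\<exists>g. F = max_face g"
  then obtain g where g: "F = max_face g" ..
  have "F face_of Z" unfolding g max_face_eq
  proof (rule face_of_Int_supporting_hyperplane_le[OF convex_Z])
    show "\<And>x. x \<in> Z \<Longrightarrow> g \<bullet> x \<le> (\<Sum>i\<in>I. \<bar>g \<bullet> u i\<bar>)" using inner_Z_le unfolding mem_Z by blast
  qed
  then show "F face_of Z \<and> F \<noteq> {}" using g max_face_nonempty by simp
qed

lemma max_face_face_of: "max_face g face_of Z"
  using face_of_Z_iff by blast

lemma direction_space_max_face: "direction_space (max_face g) = flat I u g"
proof
  show "direction_space (max_face g) \<subseteq> flat I u g" unfolding direction_space_def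
  proof (rule span_minimal)
    show "{p - q |p q. p \<in> max_face g \<and> q \<in> max_face g} \<subseteq> flat I u g"
    proof clarify
      fix p q assume p: "p \<in> max_face g" and q: "q \<in> max_face g"
      from p obtain s where s: "\<forall>i\<in>I. \<bar>s i\<bar> \<le> 1" "p = (\<Sum>i\<in>I. s i *\<^sub>R u i)"
        by (auto simp: max_face_eq mem_Z)
      from q obtain t where t: "\<forall>i\<in>I. \<bar>t i\<bar> \<le> 1" "q = (\<Sum>i\<in>I. t i *\<^sub>R u i)"
        by (auto simp: max_face_eq mem_Z)
      have "p - q = (\<Sum>i\<in>I. (s i - t i) *\<^sub>R u i)"
        by (simp add: s t scaleR_diff_left sum_subtractf)
      also have "\<dots> \<in> flat I u g"
        unfolding flat_def
      proof (rule span_sum, fold flat_def)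
        fix i assume i: "i \<in> I"
        show "(s i - t i) *\<^sub>R u i \<in> flat I u g"
        proof (cases "g \<bullet> u i = 0")
          case True
          then show ?thesis unfolding flat_def by (intro span_scale span_base) (use i in auto)
        next
          case False
          then have "s i = t i"
            using p q i sum_in_max_face[OF s(1)] sum_in_max_face[OF t(1)] s(2) t(2) by simp
          then show ?thesis by (simp add: flat_def span_0)
        qed
      qed
      finally show "p - q \<in> flat I u g" .
    qed
  qed (simp add: flat_def)
  show "flat I u g \<subseteq> direction_space (max_face g)" unfolding flat_def direction_space_def
  proof (rule span_minimal)
    show "u ` {i \<in> I. g \<bullet> u i = 0} \<subseteq> span {p - q |p q. p \<in> max_face g \<and> q \<in> max_face g}"
    proof clarify
      fix i assume i: "i \<in> I" "g \<bullet> u i = 0"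
      \<comment> \<open>This moves the centre of the face along the single free generator
        \<open>u i\<close>, so that the difference of two points of the face is \<open>u i\<close>
        itself.\<close>
      let ?t = "\<lambda>j. if j = i then 1 else sgn (g \<bullet> u j)"
      have 1: "(\<Sum>j\<in>I. ?t j *\<^sub>R u j) \<in> max_face g"
        by (subst sum_in_max_face) (auto simp: sgn_if i)
      have "(\<Sum>j\<in>I. ?t j *\<^sub>R u j) - vertex_towards g
          = (\<Sum>j\<in>I. (if j = i then u i else 0))"
        unfolding vertex_towards_def sum_subtractf[symmetric]
        by (intro sum.cong) (auto simp: i)
      also have "\<dots> = u i" using i finite_index by simp
      finally have "u i = (\<Sum>j\<in>I. ?t j *\<^sub>R u j) - vertex_towards g" by (rule sym)
      then have "u i \<in> {p - q |p q. p \<in> max_face g \<and> q \<in> max_face g}"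
        using 1 vertex_towards_in_max_face[of g] by blast
      then show "u i \<in> span {p - q |p q. p \<in> max_face g \<and> q \<in> max_face g}" by (rule span_base)
    qed
  qed simp
qed

end

lemma aff_dim_direction_space:
  fixes F :: "'u::euclidean_space set"
  assumes "F \<noteq> {}"
  shows "aff_dim F = int (dim (direction_space F))"
proof -
  obtain a where a: "a \<in> F" using assms by blast
  have "{p - q |p q. p \<in> F \<and> q \<in> F} \<subseteq> span ((\<lambda>x. x - a) ` F)"
  proof clarify
    fix p q assume "p \<in> F" "q \<in> F"
    then have "(p - a) - (q - a) \<in> span ((\<lambda>x. x - a) ` F)"
      by (intro span_diff span_base) auto
    then show "p - q \<in> span ((\<lambda>x. x - a) ` F)" by simp
  qed
  then have "direction_space F = span ((\<lambda>x. x - a) ` F)"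
    unfolding direction_space_def using a
    by (intro antisym span_minimal span_mono) auto
  then have "dim (direction_space F) = dim ((\<lambda>x. x - a) ` F)" by simp
  then show ?thesis using aff_dim_eq_dim_subtract[of a F] a by (simp add: hull_inc)
qed

lemma diff_in_direction_space: "p \<in> F \<Longrightarrow> q \<in> F \<Longrightarrow> p - q \<in> direction_space F"
  unfolding direction_space_def by (rule span_base) auto

lemma direction_space_mono: "F \<subseteq> G \<Longrightarrow> direction_space F \<subseteq> direction_space G"
  unfolding direction_space_def by (rule span_mono) auto

section \<open>Walls and diamonds\<close>

text \<open>Additive subgroups, stated as a single closure condition; they are the coefficient
  groups of all the cell complexes.\<close>

definition diff_closed :: "'g::ab_group_add set \<Rightarrow> bool" where
  "diff_closed G \<longleftrightarrow> 0 \<in> G \<and> (\<forall>x\<in>G. \<forall>y\<in>G. x - y \<in> G)"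

lemma diff_closed_zero: "diff_closed G \<Longrightarrow> 0 \<in> G"
  and diff_closed_diff: "diff_closed G \<Longrightarrow> x \<in> G \<Longrightarrow> y \<in> G \<Longrightarrow> x - y \<in> G"
  by (auto simp: diff_closed_def)

lemma diff_closed_sum:
  assumes "diff_closed G" "\<And>a. a \<in> A \<Longrightarrow> h a \<in> G"
  shows "sum h A \<in> G"
  using assms(2)
proof (induction A rule: infinite_finite_induct)
  case (insert a A)
  have "h a - (0 - sum h A) \<in> G" using insert assms(1)
    by (intro diff_closed_diff diff_closed_zero) auto
  then show ?case using insert by simp
qed (use diff_closed_zero[OF assms(1)] in auto)

lemma diff_closed_minus: "diff_closed G \<Longrightarrow> m \<in> G \<Longrightarrow> - m \<in> G"
  using diff_closed_diff[OF _ diff_closed_zero, of G m] by simp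

text \<open>The sign of \<open>s\<close> acting on an abelian group. The value \<open>s = 0\<close>
  counts as negative, whence the non-vanishing conditions in the rules below.\<close>

definition signed :: "real \<Rightarrow> 'g::ab_group_add \<Rightarrow> 'g" where
  "signed s m = (if s > 0 then m else - m)"

lemma signed_mult: "s \<noteq> 0 \<Longrightarrow> t \<noteq> 0 \<Longrightarrow> signed (s * t) m = signed s (signed t m)"
  by (auto simp: signed_def zero_less_mult_iff)

lemma signed_minus: "s \<noteq> 0 \<Longrightarrow> signed (- s) m = - signed s m"
  by (auto simp: signed_def)

lemma signed_zero [simp]: "signed s 0 = 0"
  by (auto simp: signed_def)

lemma signed_signed [simp]: "signed s (signed s m) = m"
  by (auto simp: signed_def)

lemma diff_closed_signed: "diff_closed G \<Longrightarrow> m \<in> G \<Longrightarrow> signed s m \<in> G"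
  by (simp add: signed_def diff_closed_minus)

lemma inner_flat_eq_0:
  assumes "x \<in> flat I u g"
  shows "g \<bullet> x = 0"
proof -
  have "real_inner_class.orthogonal g x"
    by (rule orthogonal_to_span[OF assms[unfolded flat_def]]) (auto simp: real_inner_class.orthogonal_def)
  then show ?thesis by (simp only: real_inner_class.orthogonal_def)
qed

lemma flat_not_orthogonal:
  assumes "h \<in> flat I u g" "h \<noteq> 0"
  shows "\<exists>i\<in>I. g \<bullet> u i = 0 \<and> h \<bullet> u i \<noteq> 0"
proof (rule ccontr)
  assume "\<not> ?thesis"
  then have "\<And>x. x \<in> u ` {i \<in> I. g \<bullet> u i = 0} \<Longrightarrow> real_inner_class.orthogonal h x"
    by (auto simp: real_inner_class.orthogonal_def)
  then have "real_inner_class.orthogonal h h" using assms(1) orthogonal_to_span unfolding flat_def by blast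
  then show False using assms(2) by (simp add: real_inner_class.orthogonal_def)
qed

lemma subspace_flat: "subspace (flat I u g)"
  by (simp add: flat_def)

context zonotope
begin

text \<open>Each of the finitely many signs is constant for small positive
  \<open>\<epsilon>\<close>. The result is the composition of sign vectors: \<open>h\<close> decides
  only where \<open>g\<close> vanishes.\<close>

lemma perturb:
  "\<exists>\<epsilon>>0. \<forall>i\<in>I. sgn ((g + \<epsilon> *\<^sub>R h) \<bullet> u i) = (if g \<bullet> u i \<noteq> 0 then sgn (g \<bullet> u i) else sgn (h \<bullet> u i))"
proof -
  have "\<forall>i\<in>I. eventually (\<lambda>\<epsilon>. sgn ((g + \<epsilon> *\<^sub>R h) \<bullet> u i)
      = (if g \<bullet> u i \<noteq> 0 then sgn (g \<bullet> u i) else sgn (h \<bullet> u i))) (at_right 0)"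
  proof
    fix i
    have lim: "((\<lambda>\<epsilon>. (g + \<epsilon> *\<^sub>R h) \<bullet> u i) \<longlongrightarrow> (g + 0 *\<^sub>R h) \<bullet> u i) (at_right 0)"
      by (intro tendsto_intros)
    show "eventually (\<lambda>\<epsilon>. sgn ((g + \<epsilon> *\<^sub>R h) \<bullet> u i)
      = (if g \<bullet> u i \<noteq> 0 then sgn (g \<bullet> u i) else sgn (h \<bullet> u i))) (at_right 0)"
    proof (cases "g \<bullet> u i" "0::real" rule: linorder_cases)
      case less
      then have "eventually (\<lambda>\<epsilon>. (g + \<epsilon> *\<^sub>R h) \<bullet> u i < 0) (at_right 0)"
        using order_tendstoD(2)[OF lim, of 0] by simp
      then show ?thesis by eventually_elim (use less in auto)
    next
      case equal
      show ?thesis using eventually_at_right_less[of "0::real"]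
        by eventually_elim (simp add: equal inner_add_left sgn_mult)
    next
      case greater
      then have "eventually (\<lambda>\<epsilon>. (g + \<epsilon> *\<^sub>R h) \<bullet> u i > 0) (at_right 0)"
        using order_tendstoD(1)[OF lim, of 0] by simp
      then show ?thesis by eventually_elim (use greater in auto)
    qed
  qed
  then have "eventually (\<lambda>\<epsilon>. \<forall>i\<in>I. sgn ((g + \<epsilon> *\<^sub>R h) \<bullet> u i)
      = (if g \<bullet> u i \<noteq> 0 then sgn (g \<bullet> u i) else sgn (h \<bullet> u i))) (at_right 0)"
    using finite_index by (simp add: eventually_ball_finite_distrib)
  then have "eventually (\<lambda>\<epsilon>. \<epsilon> > 0 \<and> (\<forall>i\<in>I. sgn ((g + \<epsilon> *\<^sub>R h) \<bullet> u i)
      = (if g \<bullet> u i \<noteq> 0 then sgn (g \<bullet> u i) else sgn (h \<bullet> u i)))) (at_right 0)"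
    using eventually_at_right_less[of "0::real"] by eventually_elim auto
  then show ?thesis using eventually_happens'[OF trivial_limit_at_right_real] by blast
qed

text \<open>The faces dual to the cells in the relatively open convex cone cut out by the conditions
  \<open>c\<close> on the hyperplanes in \<open>B\<close>.\<close>

definition cells :: "'i set \<Rightarrow> ('i \<Rightarrow> real) \<Rightarrow> 'u set set" where
  "cells B c = {max_face g | g. \<forall>i\<in>B. sgn (g \<bullet> u i) = c i}"

text \<open>Its dimension is the codimension of the region, and for a non-empty region the least
  dimension of a face in it (\<open>cell_span_subset\<close>,
  \<open>top_cell_exists\<close>).\<close>

definition cell_span :: "'i set \<Rightarrow> ('i \<Rightarrow> real) \<Rightarrow> 'u set" where
  "cell_span B c = span (u ` {i \<in> B. c i = 0})"

lemma max_face_in_cells: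
  "B \<subseteq> I \<Longrightarrow> max_face g \<in> cells B c \<longleftrightarrow> (\<forall>i\<in>B. sgn (g \<bullet> u i) = c i)"
  unfolding cells_def by (auto simp: max_face_eq_iff subset_iff)

lemma cell_span_subset:
  assumes "B \<subseteq> I" "F \<in> cells B c"
  shows "cell_span B c \<subseteq> direction_space F"
proof -
  obtain g where g: "F = max_face g" "\<forall>i\<in>B. sgn (g \<bullet> u i) = c i" using assms(2) unfolding cells_def by blast
  show ?thesis unfolding g(1) direction_space_max_face cell_span_def flat_def
    by (rule span_mono, rule image_mono) (use assms(1) g(2) in \<open>auto simp: sgn_zero_iff\<close>)
qed

lemma subspace_cell_span: "subspace (cell_span B c)"
  by (simp add: cell_span_def)

text \<open>A cell of codimension 1 in the region has exactly two top cells next to it. They arise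
  from \<open>g\<close> by small steps along plus and minus the normal of
  \<open>cell_span B c\<close> inside the flat of \<open>g\<close>; the transversal vector
  \<open>v\<close> serves to tell the two sides apart.\<close>

lemma wall:
  assumes B: "B \<subseteq> I" and g: "max_face g \<in> cells B c"
    and dim: "dim (flat I u g) = dim (cell_span B c) + 1"
    and v: "v \<in> flat I u g" "v \<notin> cell_span B c"
  obtains g1 g2 where "max_face g1 \<in> cells B c" "max_face g2 \<in> cells B c"
    "max_face g1 \<subseteq> max_face g" "max_face g2 \<subseteq> max_face g"
    "flat I u g1 = cell_span B c" "flat I u g2 = cell_span B c"
    "max_face g1 \<noteq> max_face g2" "g1 \<bullet> v > 0" "g2 \<bullet> v < 0"
    "\<And>F'. F' \<in> cells B c \<Longrightarrow> F' \<subseteq> max_face g \<Longrightarrow> dim (direction_space F') = dim (cell_span B c)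
      \<Longrightarrow> F' = max_face g1 \<or> F' = max_face g2"
proof -
  let ?V = "flat I u g" and ?K = "cell_span B c"
  have KV: "?K \<subseteq> ?V" using cell_span_subset[OF B g] by (simp add: direction_space_max_face)
  have gB: "\<forall>i\<in>B. sgn (g \<bullet> u i) = c i" using g max_face_in_cells[OF B] by simp
  have sp: "span ?K = ?K" "span ?V = ?V" by (simp_all add: cell_span_def flat_def)
  have "span ?K \<subset> span ?V" unfolding sp using KV v by blast
  from orthogonal_to_subspace_exists_gen[OF this] obtain h0 where
    h0: "h0 \<noteq> 0" "h0 \<in> ?V" "\<And>y. y \<in> ?K \<Longrightarrow> h0 \<bullet> y = 0"
    unfolding sp by (auto simp: real_inner_class.orthogonal_def)
  have dec0: "\<exists>a k. k \<in> ?K \<and> x = a *\<^sub>R h0 + k" if x: "x \<in> ?V" for x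
  proof -
    have "h0 \<notin> ?K" using h0(1) h0(3)[of h0] by auto
    then have "dim (insert h0 ?K) = dim ?V"
      using dim by (simp add: dim_insert sp)
    moreover have "insert h0 ?K \<subseteq> ?V" using h0(2) KV by blast
    ultimately have "span (insert h0 ?K) = span ?V" by (intro dim_eq_span) auto
    then have "x \<in> span (insert h0 ?K)" using x span_base by blast
    then obtain a where "x - a *\<^sub>R h0 \<in> span ?K" using span_breakdown_eq by blast
    then have "x - a *\<^sub>R h0 \<in> ?K" by (simp only: sp)
    then show ?thesis by (intro exI[of _ a] exI[of _ "x - a *\<^sub>R h0"]) simp
  qed
  have "h0 \<bullet> v \<noteq> 0"
  proof
    assume 0: "h0 \<bullet> v = 0"
    obtain a k where "k \<in> ?K" "v = a *\<^sub>R h0 + k" using dec0[OF v(1)] by blast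
    then show False using 0 h0(1) h0(3)[of k] v(2) by (auto simp: inner_add_right)
  qed
  \<comment> \<open>The sign of the normal is chosen so that \<open>g1\<close> becomes the side on
    which \<open>v\<close> is positive.\<close>
  define h where "h = (if h0 \<bullet> v > 0 then h0 else - h0)"
  have h: "h \<noteq> 0" "h \<in> ?V" "\<And>y. y \<in> ?K \<Longrightarrow> h \<bullet> y = 0" "h \<bullet> v > 0"
    using h0 \<open>h0 \<bullet> v \<noteq> 0\<close> subspace_neg[OF subspace_flat h0(2)] by (simp_all add: h_def)
  have dec: "\<exists>a k. k \<in> ?K \<and> x = a *\<^sub>R h + k" if x: "x \<in> ?V" for x
  proof -
    obtain a k where "k \<in> ?K" "x = a *\<^sub>R h0 + k" using dec0[OF x] by blast
    then show ?thesis unfolding h_def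
      by (cases "h0 \<bullet> v > 0") (auto intro: exI[of _ a] exI[of _ "- a"])
  qed
  have *: "\<exists>g1. max_face g1 \<in> cells B c \<and> max_face g1 \<subseteq> max_face g \<and> flat I u g1 = ?K \<and>
      sgn (g1 \<bullet> v) = sgn (e \<bullet> v) \<and>
      (\<forall>i\<in>I. sgn (g1 \<bullet> u i) = (if g \<bullet> u i \<noteq> 0 then sgn (g \<bullet> u i) else sgn (e \<bullet> u i)))"
    if e: "e = h \<or> e = - h" for e
  proof -
    obtain \<epsilon> where \<epsilon>: "\<epsilon> > 0"
      "\<forall>i\<in>I. sgn ((g + \<epsilon> *\<^sub>R e) \<bullet> u i) = (if g \<bullet> u i \<noteq> 0 then sgn (g \<bullet> u i) else sgn (e \<bullet> u i))"
      using perturb by blast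
    let ?g1 = "g + \<epsilon> *\<^sub>R e"
    have eK: "\<And>y. y \<in> ?K \<Longrightarrow> e \<bullet> y = 0" using h(3) e by auto
    have uK: "u i \<in> ?K" if "i \<in> B" "c i = 0" for i
      unfolding cell_span_def by (rule span_base) (use that in auto)
    have 1: "max_face ?g1 \<in> cells B c" unfolding max_face_in_cells[OF B]
    proof
      fix i assume i: "i \<in> B"
      show "sgn (?g1 \<bullet> u i) = c i"
      proof (cases "g \<bullet> u i = 0")
        case True
        then have "c i = 0" using gB i by auto
        then show ?thesis using True eK[OF uK[OF i]] \<epsilon>(2) B i by auto
      qed (use \<epsilon>(2) gB B i in auto)
    qed
    moreover have "max_face ?g1 \<subseteq> max_face g" unfolding max_face_subset using \<epsilon>(2) by simp
    moreover have "flat I u ?g1 = ?K"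
    proof
      show "flat I u ?g1 \<subseteq> ?K" unfolding flat_def[of _ _ ?g1]
      proof (rule span_minimal[OF _ subspace_cell_span], clarify)
        fix i assume i: "i \<in> I" "?g1 \<bullet> u i = 0"
        then have gi: "g \<bullet> u i = 0" "e \<bullet> u i = 0" using \<epsilon>(2)[rule_format, of i]
          by (auto split: if_splits simp: sgn_zero_iff)
        then have "u i \<in> ?V" unfolding flat_def by (intro span_base) (use i in auto)
        then obtain a k where "k \<in> ?K" "u i = a *\<^sub>R h + k" using dec by blast
        then show "u i \<in> ?K" using gi(2) h(1) h(3)[of k] e by (auto simp: inner_add_right)
      qed
      show "?K \<subseteq> flat I u ?g1" using cell_span_subset[OF B 1] by (simp add: direction_space_max_face)
    qed
    moreover have "sgn (?g1 \<bullet> v) = sgn (e \<bullet> v)"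
      using inner_flat_eq_0[OF v(1)] \<epsilon>(1) by (simp add: inner_add_left sgn_mult)
    ultimately show ?thesis using \<epsilon>(2) by blast
  qed
  obtain g1 where g1: "max_face g1 \<in> cells B c" "max_face g1 \<subseteq> max_face g" "flat I u g1 = ?K"
      "sgn (g1 \<bullet> v) = sgn (h \<bullet> v)"
      "\<forall>i\<in>I. sgn (g1 \<bullet> u i) = (if g \<bullet> u i \<noteq> 0 then sgn (g \<bullet> u i) else sgn (h \<bullet> u i))"
    using *[of h] by blast
  obtain g2 where g2: "max_face g2 \<in> cells B c" "max_face g2 \<subseteq> max_face g" "flat I u g2 = ?K"
      "sgn (g2 \<bullet> v) = sgn (- h \<bullet> v)"
      "\<forall>i\<in>I. sgn (g2 \<bullet> u i) = (if g \<bullet> u i \<noteq> 0 then sgn (g \<bullet> u i) else sgn (- h \<bullet> u i))"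
    using *[of "- h"] by blast
  obtain i0 where i0: "i0 \<in> I" "g \<bullet> u i0 = 0" "h \<bullet> u i0 \<noteq> 0" using flat_not_orthogonal[OF h(2,1)] by blast
  have ne: "max_face g1 \<noteq> max_face g2"
  proof
    assume "max_face g1 = max_face g2"
    then have "sgn (h \<bullet> u i0) = sgn (- h \<bullet> u i0)"
      unfolding max_face_eq_iff using g1(5) g2(5) i0 by auto
    then show False using i0(3) by (auto simp: sgn_if split: if_splits)
  qed
  have uniq: "F' = max_face g1 \<or> F' = max_face g2"
    if F': "F' \<in> cells B c" "F' \<subseteq> max_face g" "dim (direction_space F') = dim ?K" for F'
  proof -
    obtain f where f: "F' = max_face f" using F'(1) unfolding cells_def by blast
    have fK: "flat I u f = ?K"
      using subspace_dim_equal[OF subspace_cell_span subspace_flat, of B c I u f]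
        cell_span_subset[OF B F'(1)] F'(3) by (simp add: f direction_space_max_face)
    have f0: "\<And>y. y \<in> ?K \<Longrightarrow> f \<bullet> y = 0" using inner_flat_eq_0 fK by blast
    have fh: "f \<bullet> h \<noteq> 0"
    proof
      assume "f \<bullet> h = 0"
      then have "f \<bullet> x = 0" if "x \<in> ?V" for x using dec[OF that] f0 by (auto simp: inner_add_right)
      then have "?V \<subseteq> flat I u f" unfolding flat_def
        by (intro span_mono image_mono) (auto intro: span_base)
      then show False using fK v by blast
    qed
    \<comment> \<open>On \<open>?V\<close> the forms given by \<open>f\<close> and \<open>h\<close>
      are proportional, since both vanish on \<open>?K\<close> and \<open>?V\<close> is spanned by
      \<open>h\<close> and \<open>?K\<close>. Only the sign of \<open>f \<bullet> h\<close> is free,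
      which leaves two faces.\<close>
    have sf: "sgn (f \<bullet> u i) = (if g \<bullet> u i \<noteq> 0 then sgn (g \<bullet> u i) else sgn (f \<bullet> h) * sgn (h \<bullet> u i))"
      if i: "i \<in> I" for i
    proof (cases "g \<bullet> u i = 0")
      case True
      then have "u i \<in> ?V" unfolding flat_def by (intro span_base) (use i in auto)
      then obtain a k where k: "k \<in> ?K" "u i = a *\<^sub>R h + k" using dec by blast
      then have "f \<bullet> u i = a * (f \<bullet> h)" "h \<bullet> u i = a * (h \<bullet> h)"
        using f0[OF k(1)] h(3)[OF k(1)] by (auto simp: inner_add_right)
      moreover have "h \<bullet> h > 0" using h(1) by simp
      ultimately show ?thesis using True by (simp add: sgn_mult)
    next
      case False
      then show ?thesis using F'(2) i unfolding f max_face_subset by auto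
    qed
    show ?thesis
    proof (cases "f \<bullet> h > 0")
      case True
      then have "F' = max_face g1" unfolding f max_face_eq_iff using sf g1(5) by simp
      then show ?thesis ..
    next
      case False
      then have "sgn (f \<bullet> h) = -1" using fh by simp
      then have "F' = max_face g2" unfolding f max_face_eq_iff using sf g2(5) by (simp add: sgn_minus)
      then show ?thesis ..
    qed
  qed
  have p1: "g1 \<bullet> v > 0" using g1(4) h(4) by (metis sgn_1_pos)
  have p2: "g2 \<bullet> v < 0" using g2(4) h(4) by (metis inner_minus_left neg_less_0_iff_less sgn_1_neg)
  show ?thesis by (rule that[OF g1(1) g2(1) g1(2) g2(2) g1(3) g2(3) ne p1 p2 uniq])
qed

lemma max_face_subset_flat: "max_face f \<subseteq> max_face g \<Longrightarrow> flat I u f \<subseteq> flat I u g"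
  using direction_space_mono direction_space_max_face by metis

text \<open>Restricted to the flat of \<open>g\<close>, the forms vanishing on the flat of
  \<open>f\<close> make up a plane. Weak agreement with the signs of \<open>f\<close> cuts out of it
  a pointed cone with \<open>f\<close> in its interior, and the two faces in between are the two
  boundary rays.\<close>

lemma diamond:
  assumes fg: "max_face f \<subseteq> max_face g"
    and dim: "dim (flat I u g) = dim (flat I u f) + 2"
  obtains e1 e2 where "max_face f \<subseteq> max_face e1" "max_face e1 \<subseteq> max_face g"
    "max_face f \<subseteq> max_face e2" "max_face e2 \<subseteq> max_face g"
    "dim (flat I u e1) = dim (flat I u f) + 1" "dim (flat I u e2) = dim (flat I u f) + 1"
    "max_face e1 \<noteq> max_face e2"
    "\<And>d. max_face f \<subseteq> max_face d \<Longrightarrow> max_face d \<subseteq> max_face g \<Longrightarrow>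
      dim (flat I u d) = dim (flat I u f) + 1 \<Longrightarrow> max_face d = max_face e1 \<or> max_face d = max_face e2"
proof -
  let ?V = "flat I u g" and ?K = "flat I u f"
  let ?S = "{i \<in> I. g \<bullet> u i = 0}"
  have finS: "finite ?S" using finite_index by simp
  have KV: "?K \<subseteq> ?V" using max_face_subset_flat[OF fg] .
  have sp: "span ?K = ?K" "span ?V = ?V" by (simp_all add: flat_def)
  have uV: "u i \<in> ?V" if "i \<in> ?S" for i unfolding flat_def by (intro span_base) (use that in auto)
  have f0: "f \<bullet> y = 0" if "y \<in> ?K" for y using inner_flat_eq_0 that by blast
  have uK: "u i \<in> ?K \<longleftrightarrow> f \<bullet> u i = 0" if "i \<in> I" for i
  proof
    assume "f \<bullet> u i = 0"
    then show "u i \<in> ?K" unfolding flat_def by (intro span_base) (use that in auto)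
  qed (rule f0)
  have fne: "\<exists>i\<in>?S. f \<bullet> u i \<noteq> 0"
  proof (rule ccontr)
    assume "\<not> ?thesis"
    then have "?V \<subseteq> ?K" unfolding flat_def[of I u g] using uK
      by (intro span_minimal subspace_flat) auto
    then have "?V = ?K" using KV by blast
    then show False using dim by simp
  qed
  \<comment> \<open>\<open>w\<close> is positive on the cone of forms between \<open>f\<close> and \<open>g\<close>, so a line through \<open>f\<close> in a direction
    orthogonal to \<open>w\<close> leaves that two-dimensional cone on both sides.\<close>
  define w where "w = (\<Sum>i\<in>?S. sgn (f \<bullet> u i) *\<^sub>R u i)"
  have wV: "w \<in> ?V" unfolding w_def
    by (rule subspace_sum[OF subspace_flat]) (intro subspace_mul[OF subspace_flat] uV)
  have inner_w: "x \<bullet> w = (\<Sum>i\<in>?S. sgn (f \<bullet> u i) * (x \<bullet> u i))" for x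
    by (simp add: w_def inner_sum_right)
  have pos_w: "x \<bullet> w > 0"
    if "\<forall>i\<in>?S. sgn (f \<bullet> u i) * (x \<bullet> u i) \<ge> 0" "\<exists>i\<in>?S. sgn (f \<bullet> u i) * (x \<bullet> u i) \<noteq> 0" for x
  proof -
    have "x \<bullet> w \<ge> 0" unfolding inner_w using that(1) by (intro sum_nonneg) auto
    moreover have "x \<bullet> w \<noteq> 0" unfolding inner_w
      using sum_nonneg_eq_0_iff[OF finS, of "\<lambda>i. sgn (f \<bullet> u i) * (x \<bullet> u i)"] that by auto
    ultimately show ?thesis by simp
  qed
  have fw: "f \<bullet> w > 0" using fne by (intro pos_w) (auto simp: sgn_if)
  have wK: "w \<notin> ?K" using fw f0 by force
  have dimw: "dim (insert w ?K) = dim ?K + 1" using wK by (simp add: dim_insert sp)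
  have "span (insert w ?K) \<subseteq> ?V" using wV KV by (intro span_minimal subspace_flat) auto
  moreover have "span (insert w ?K) \<noteq> ?V"
  proof
    assume "span (insert w ?K) = ?V"
    then have "dim (insert w ?K) = dim ?V" by (metis dim_span)
    then show False using dim dimw by simp
  qed
  ultimately have "span (insert w ?K) \<subset> span ?V" unfolding sp by blast
  from orthogonal_to_subspace_exists_gen[OF this] obtain h where
    h: "h \<noteq> 0" "h \<in> ?V" and h': "\<And>y. y \<in> span (insert w ?K) \<Longrightarrow> h \<bullet> y = 0"
    unfolding sp by (auto simp: real_inner_class.orthogonal_def)
  have hK: "h \<bullet> y = 0" if "y \<in> ?K" for y using h'[of y] that by (simp add: span_base)
  have hw: "h \<bullet> w = 0" by (simp add: h' span_base)
  have hh: "h \<bullet> h > 0" using h by simp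
  have hne: "\<exists>i\<in>?S. h \<bullet> u i \<noteq> 0" using flat_not_orthogonal[OF h(2,1)] by blast
  have span_all: "x \<in> span (insert h (insert w ?K))" if "x \<in> ?V" for x
  proof -
    have "h \<notin> span (insert w ?K)" using h'[of h] h(1) by auto
    then have "dim (insert h (insert w ?K)) = dim ?V" using dim dimw by (simp add: dim_insert)
    moreover have "insert h (insert w ?K) \<subseteq> ?V" using h(2) wV KV by blast
    ultimately have "span (insert h (insert w ?K)) = span ?V" by (intro dim_eq_span) auto
    then show ?thesis using that span_base by blast
  qed
  \<comment> \<open>\<open>t\<close> is the time at which the ray from \<open>f\<close> in direction
    \<open>e\<close> leaves the cone: all constraints still hold weakly and one of them has become
    tight.\<close>
  define T where "T e t \<longleftrightarrow> t > 0 \<and> (\<forall>i\<in>?S. sgn (f \<bullet> u i) * ((f + t *\<^sub>R e) \<bullet> u i) \<ge> 0)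
      \<and> (\<exists>i\<in>?S. f \<bullet> u i \<noteq> 0 \<and> (f + t *\<^sub>R e) \<bullet> u i = 0)" for e t
  have T_less: False if T: "T e t" "T e t'" "t < t'" for e t t'
  proof -
    obtain i where i: "i \<in> ?S" "f \<bullet> u i \<noteq> 0" "(f + t *\<^sub>R e) \<bullet> u i = 0" using T(1) unfolding T_def by blast
    have t: "t > 0" using that(1) by (simp add: T_def)
    have e: "t * (e \<bullet> u i) = - (f \<bullet> u i)" using i(3) by (simp add: inner_add_left)
    have "0 \<le> sgn (f \<bullet> u i) * ((f + t' *\<^sub>R e) \<bullet> u i)" using that(2) i(1) unfolding T_def by blast
    then have "0 \<le> t * (sgn (f \<bullet> u i) * ((f + t' *\<^sub>R e) \<bullet> u i))" using t by simp
    also have "\<dots> = sgn (f \<bullet> u i) * (t * (f \<bullet> u i) + t' * (t * (e \<bullet> u i)))"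
      by (simp add: inner_add_left algebra_simps)
    also have "\<dots> = (t - t') * \<bar>f \<bullet> u i\<bar>" unfolding e by (simp add: abs_sgn algebra_simps)
    also have "\<dots> < 0" using that(3) i(2) by (simp add: mult_less_0_iff)
    finally show False by simp
  qed
  have T_unique: "t = t'" if "T e t" "T e t'" for e t t'
    using T_less that by (metis linorder_neqE_linordered_idom)
  have side: "\<exists>t d. T e t \<and> max_face f \<subseteq> max_face d \<and> max_face d \<subseteq> max_face g \<and>
      dim (flat I u d) = dim ?K + 1 \<and>
      (\<forall>i\<in>I. sgn (d \<bullet> u i) = (if g \<bullet> u i \<noteq> 0 then sgn (g \<bullet> u i) else sgn ((f + t *\<^sub>R e) \<bullet> u i)))"
    if e: "e = h \<or> e = - h" for e
  proof -
    have eK: "e \<bullet> y = 0" if "y \<in> ?K" for y using e hK[OF that] by auto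
    have ew: "e \<bullet> w = 0" using e hw by auto
    have ene: "\<exists>i\<in>?S. e \<bullet> u i \<noteq> 0" using e hne by auto
    \<comment> \<open>The constraints that decrease along \<open>e\<close>. If there were none,
      \<open>pos_w\<close> would make \<open>e \<bullet> w\<close> positive, but \<open>e\<close> is
      orthogonal to \<open>w\<close>.\<close>
    define N where "N = {i \<in> ?S. sgn (f \<bullet> u i) * (e \<bullet> u i) < 0}"
    have "N \<noteq> {}"
    proof
      assume "N = {}"
      then have "\<forall>i\<in>?S. sgn (f \<bullet> u i) * (e \<bullet> u i) \<ge> 0" unfolding N_def by force
      moreover have "\<exists>i\<in>?S. sgn (f \<bullet> u i) * (e \<bullet> u i) \<noteq> 0"
        using ene eK uK by (force simp: sgn_zero_iff)
      ultimately show False using pos_w[of e] ew by auto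
    qed
    moreover have finN: "finite N" unfolding N_def by (rule finite_subset[OF _ finS]) auto
    \<comment> \<open>The ratio test: the first decreasing constraint to become tight gives the exit
      time.\<close>
    define t where "t = Min ((\<lambda>i. \<bar>f \<bullet> u i\<bar> / \<bar>e \<bullet> u i\<bar>) ` N)"
    ultimately have tin: "t \<in> (\<lambda>i. \<bar>f \<bullet> u i\<bar> / \<bar>e \<bullet> u i\<bar>) ` N" unfolding t_def
      using finN by (intro Min_in) auto
    then obtain i0 where i0: "i0 \<in> N" "t = \<bar>f \<bullet> u i0\<bar> / \<bar>e \<bullet> u i0\<bar>" by blast
    have tle: "t \<le> \<bar>f \<bullet> u i\<bar> / \<bar>e \<bullet> u i\<bar>" if "i \<in> N" for i
      unfolding t_def using finN that by (intro Min_le) auto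
    have nz: "f \<bullet> u i \<noteq> 0" "e \<bullet> u i \<noteq> 0" if "i \<in> N" for i using that by (auto simp: N_def)
    have tpos: "t > 0" using i0 nz[OF i0(1)] by simp
    have split: "sgn (f \<bullet> u i) * ((f + s *\<^sub>R e) \<bullet> u i) = \<bar>f \<bullet> u i\<bar> + s * (sgn (f \<bullet> u i) * (e \<bullet> u i))" for s i
      by (simp add: inner_add_left abs_sgn algebra_simps)
    have neg: "sgn (f \<bullet> u i) * (e \<bullet> u i) = - \<bar>e \<bullet> u i\<bar>" if "i \<in> N" for i
      using that unfolding N_def by (cases "f \<bullet> u i > 0"; cases "f \<bullet> u i = 0") auto
    have nonneg: "sgn (f \<bullet> u i) * ((f + t *\<^sub>R e) \<bullet> u i) \<ge> 0" if "i \<in> ?S" for i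
    proof (cases "i \<in> N")
      case True
      then have "t * \<bar>e \<bullet> u i\<bar> \<le> \<bar>f \<bullet> u i\<bar>" using tle[OF True] nz[OF True] by (simp add: pos_le_divide_eq)
      then show ?thesis unfolding split neg[OF True] by simp
    next
      case False
      then have "sgn (f \<bullet> u i) * (e \<bullet> u i) \<ge> 0" using that unfolding N_def by force
      then show ?thesis unfolding split using tpos by simp
    qed
    have "sgn (f \<bullet> u i0) * ((f + t *\<^sub>R e) \<bullet> u i0) = 0"
      unfolding split neg[OF i0(1)] using i0(2) nz[OF i0(1)] by simp
    then have zero: "(f + t *\<^sub>R e) \<bullet> u i0 = 0" using nz[OF i0(1)] by (simp add: sgn_zero_iff)
    have i0S: "i0 \<in> ?S" using i0(1) by (simp add: N_def)
    have T: "T e t" unfolding T_def using tpos nonneg zero nz[OF i0(1)] i0S by blast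
    \<comment> \<open>The form \<open>f + t *\<^sub>R e\<close> may violate the signs prescribed by
      \<open>g\<close>. Adding a small multiple of it to \<open>g\<close> keeps those signs and uses
      it only where \<open>g\<close> vanishes.\<close>
    obtain \<epsilon> where \<epsilon>: "\<epsilon> > 0" "\<forall>i\<in>I. sgn ((g + \<epsilon> *\<^sub>R (f + t *\<^sub>R e)) \<bullet> u i) =
        (if g \<bullet> u i \<noteq> 0 then sgn (g \<bullet> u i) else sgn ((f + t *\<^sub>R e) \<bullet> u i))"
      using perturb by blast
    let ?d = "g + \<epsilon> *\<^sub>R (f + t *\<^sub>R e)"
    have 1: "max_face f \<subseteq> max_face ?d" unfolding max_face_subset
    proof (intro ballI impI)
      fix i assume i: "i \<in> I" "?d \<bullet> u i \<noteq> 0"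
      show "sgn (f \<bullet> u i) = sgn (?d \<bullet> u i)"
      proof (cases "g \<bullet> u i = 0")
        case False
        then show ?thesis using fg i(1) \<epsilon>(2) unfolding max_face_subset by auto
      next
        case True
        then have iS: "i \<in> ?S" using i(1) by simp
        have d: "sgn (?d \<bullet> u i) = sgn ((f + t *\<^sub>R e) \<bullet> u i)" using \<epsilon>(2) i(1) True by simp
        then have n: "(f + t *\<^sub>R e) \<bullet> u i \<noteq> 0" using i(2) by (metis sgn_zero_iff)
        then have "f \<bullet> u i \<noteq> 0" using eK uK[OF i(1)] by (auto simp: inner_add_left)
        then have "sgn (f \<bullet> u i) = sgn ((f + t *\<^sub>R e) \<bullet> u i)"
          using nonneg[OF iS] n by (auto simp: sgn_if split: if_splits)
        then show ?thesis using d by simp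
      qed
    qed
    have 2: "max_face ?d \<subseteq> max_face g" unfolding max_face_subset using \<epsilon>(2) by simp
    have d0: "?d \<bullet> u i0 = 0" using i0S zero by (simp add: inner_add_left[of g])
    have u0: "u i0 \<in> flat I u ?d" unfolding flat_def by (intro span_base) (use i0S d0 in auto)
    have u0K: "u i0 \<notin> ?K" using uK[of i0] i0S nz[OF i0(1)] by auto
    have spd: "span (flat I u ?d) = flat I u ?d" by (simp add: flat_def)
    have "span ?K \<subset> span (flat I u ?d)" unfolding sp spd using u0 u0K max_face_subset_flat[OF 1] by blast
    from dim_psubset[OF this] have 3: "dim ?K < dim (flat I u ?d)" .
    have "flat I u ?d \<noteq> ?V"
    proof
      assume "flat I u ?d = ?V"
      then have "?d \<bullet> w = 0" using wV inner_flat_eq_0 by blast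
      moreover have "?d \<bullet> w = \<epsilon> * (f \<bullet> w)"
        using ew inner_flat_eq_0[OF wV] by (simp add: inner_add_left)
      ultimately show False using fw \<epsilon>(1) by simp
    qed
    then have "span (flat I u ?d) \<subset> span ?V" unfolding sp spd using max_face_subset_flat[OF 2] by blast
    from dim_psubset[OF this] have 4: "dim (flat I u ?d) < dim ?V" .
    have 5: "dim (flat I u ?d) = dim ?K + 1" using 3 4 dim by simp
    show ?thesis using T 1 2 5 \<epsilon>(2) by blast
  qed
  obtain t1 e1 where e1: "T h t1" "max_face f \<subseteq> max_face e1" "max_face e1 \<subseteq> max_face g"
      "dim (flat I u e1) = dim ?K + 1"
      "\<forall>i\<in>I. sgn (e1 \<bullet> u i) = (if g \<bullet> u i \<noteq> 0 then sgn (g \<bullet> u i) else sgn ((f + t1 *\<^sub>R h) \<bullet> u i))"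
    using side[of h] by blast
  obtain t2 e2 where e2: "T (- h) t2" "max_face f \<subseteq> max_face e2" "max_face e2 \<subseteq> max_face g"
      "dim (flat I u e2) = dim ?K + 1"
      "\<forall>i\<in>I. sgn (e2 \<bullet> u i) = (if g \<bullet> u i \<noteq> 0 then sgn (g \<bullet> u i) else sgn ((f + t2 *\<^sub>R (- h)) \<bullet> u i))"
    using side[of "- h"] by blast
  have ne: "max_face e1 \<noteq> max_face e2"
  proof
    assume eq: "max_face e1 = max_face e2"
    obtain i where i: "i \<in> ?S" "f \<bullet> u i \<noteq> 0" "(f + t1 *\<^sub>R h) \<bullet> u i = 0" using e1(1) unfolding T_def by blast
    have "sgn ((f + t1 *\<^sub>R h) \<bullet> u i) = sgn ((f + t2 *\<^sub>R (- h)) \<bullet> u i)"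
      using eq e1(5) e2(5) i(1) unfolding max_face_eq_iff by auto
    then have "(f + t2 *\<^sub>R (- h)) \<bullet> u i = 0" using i(3) by (simp add: sgn_zero_iff)
    then have "(t1 + t2) * (h \<bullet> u i) = 0" using i(3) by (simp add: inner_add_left inner_diff_left algebra_simps)
    moreover have "t1 > 0" "t2 > 0" using e1(1) e2(1) by (simp_all add: T_def)
    ultimately have "h \<bullet> u i = 0" by simp
    then show False using i(2,3) by (simp add: inner_add_left)
  qed
  have uniq: "max_face d = max_face e1 \<or> max_face d = max_face e2"
    if d: "max_face f \<subseteq> max_face d" "max_face d \<subseteq> max_face g" "dim (flat I u d) = dim ?K + 1" for d
  proof -
    have sgd: "sgn (d \<bullet> u i) = sgn (g \<bullet> u i)" if "i \<in> I" "g \<bullet> u i \<noteq> 0" for i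
      using d(2) that unfolding max_face_subset by blast
    have nn: "sgn (f \<bullet> u i) * (d \<bullet> u i) \<ge> 0" if "i \<in> I" for i
      using d(1) that unfolding max_face_subset
      by (cases "d \<bullet> u i = 0") (auto simp: sgn_if)
    have "\<exists>i\<in>?S. d \<bullet> u i \<noteq> 0"
    proof (rule ccontr)
      assume "\<not> ?thesis"
      then have "?V \<subseteq> flat I u d" unfolding flat_def by (intro span_mono image_mono) auto
      then have "?V = flat I u d" using max_face_subset_flat[OF d(2)] by blast
      then show False using dim d(3) by simp
    qed
    then obtain i1 where i1: "i1 \<in> ?S" "d \<bullet> u i1 \<noteq> 0" by blast
    then have "sgn (f \<bullet> u i1) = sgn (d \<bullet> u i1)" using d(1) unfolding max_face_subset by auto
    then have "sgn (f \<bullet> u i1) * (d \<bullet> u i1) \<noteq> 0" using i1(2) by (simp add: sgn_zero_iff)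
    then have dw: "d \<bullet> w > 0" using nn i1(1) by (intro pos_w) auto
    have d0: "d \<bullet> y = 0" if "y \<in> ?K" for y
      using that max_face_subset_flat[OF d(1)] inner_flat_eq_0 by blast
    \<comment> \<open>On \<open>?V\<close> the form \<open>d\<close> equals \<open>\<alpha>\<close>
      times \<open>f\<close> plus \<open>\<beta>\<close> times \<open>h\<close>. The first
      coefficient is read off at \<open>w\<close>, where \<open>h\<close> vanishes, the second at
      \<open>h\<close>. Dividing by \<open>\<alpha> > 0\<close> keeps all signs and puts
      \<open>d\<close> on the line through \<open>f\<close> in direction \<open>h\<close>.\<close>
    define \<alpha> where "\<alpha> = (d \<bullet> w) / (f \<bullet> w)"
    define \<beta> where "\<beta> = (d \<bullet> h - \<alpha> * (f \<bullet> h)) / (h \<bullet> h)"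
    have \<alpha>: "\<alpha> > 0" using dw fw by (simp add: \<alpha>_def)
    let ?x = "d - \<alpha> *\<^sub>R f - \<beta> *\<^sub>R h"
    have "real_inner_class.orthogonal ?x y" if "y \<in> insert h (insert w ?K)" for y
    proof -
      have "?x \<bullet> h = 0" using hh by (simp add: \<beta>_def inner_diff_left)
      moreover have "?x \<bullet> w = 0" using fw hw by (simp add: \<alpha>_def inner_diff_left)
      moreover have "y \<in> ?K \<Longrightarrow> ?x \<bullet> y = 0" using d0 f0 hK by (simp add: inner_diff_left)
      ultimately show ?thesis using that by (auto simp: real_inner_class.orthogonal_def)
    qed
    then have "?x \<bullet> y = 0" if "y \<in> ?V" for y
      using orthogonal_to_span[OF span_all[OF that]] by (simp add: real_inner_class.orthogonal_def)
    then have dS0: "d \<bullet> u i = \<alpha> * (f \<bullet> u i) + \<beta> * (h \<bullet> u i)" if "i \<in> ?S" for i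
      using uV[OF that] by (simp add: inner_diff_left algebra_simps)
    define \<tau> where "\<tau> = \<beta> / \<alpha>"
    have dS: "d \<bullet> u i = \<alpha> * ((f + \<tau> *\<^sub>R h) \<bullet> u i)" if "i \<in> ?S" for i
      using dS0[OF that] \<alpha> by (simp add: inner_add_left \<tau>_def algebra_simps)
    have sgS: "sgn (d \<bullet> u i) = sgn ((f + \<tau> *\<^sub>R h) \<bullet> u i)" if "i \<in> ?S" for i
      using dS[OF that] \<alpha> by (simp add: sgn_mult)
    have "\<exists>i\<in>?S. f \<bullet> u i \<noteq> 0 \<and> d \<bullet> u i = 0"
    proof (rule ccontr)
      assume n: "\<not> ?thesis"
      have "f \<bullet> u i = 0" if "i \<in> I" "d \<bullet> u i = 0" for i
      proof -
        have "g \<bullet> u i = 0" using sgd[OF that(1)] that(2) by (metis sgn_zero sgn_zero_iff)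
        then show ?thesis using n that by blast
      qed
      then have "flat I u d \<subseteq> ?K" unfolding flat_def by (intro span_mono image_mono) auto
      then have "flat I u d = ?K" using max_face_subset_flat[OF d(1)] by blast
      then show False using d(3) by simp
    qed
    then obtain i2 where i2: "i2 \<in> ?S" "f \<bullet> u i2 \<noteq> 0" "d \<bullet> u i2 = 0" by blast
    have z2: "(f + \<tau> *\<^sub>R h) \<bullet> u i2 = 0" using dS[OF i2(1)] i2(3) \<alpha> by simp
    have nnS: "sgn (f \<bullet> u i) * ((f + \<tau> *\<^sub>R h) \<bullet> u i) \<ge> 0" if "i \<in> ?S" for i
    proof -
      have "0 \<le> \<alpha> * (sgn (f \<bullet> u i) * ((f + \<tau> *\<^sub>R h) \<bullet> u i))"
        using nn[of i] that unfolding dS[OF that] by (simp add: mult.left_commute)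
      then show ?thesis using \<alpha> by (simp only: zero_le_mult_iff) auto
    qed
    have "\<tau> \<noteq> 0" using z2 i2(2) by auto
    then consider "\<tau> > 0" | "\<tau> < 0" by linarith
    then show ?thesis
    proof cases
      case 1
      then have "T h \<tau>" unfolding T_def using nnS i2 z2 by blast
      then have "\<tau> = t1" using T_unique e1(1) by blast
      then have "max_face d = max_face e1" unfolding max_face_eq_iff using e1(5) sgd sgS by auto
      then show ?thesis ..
    next
      case 2
      have n: "f + (- \<tau>) *\<^sub>R (- h) = f + \<tau> *\<^sub>R h" by simp
      have "T (- h) (- \<tau>)" unfolding T_def n using nnS i2 z2 2 by auto
      then have "- \<tau> = t2" using T_unique e2(1) by blast
      then have "f + t2 *\<^sub>R (- h) = f + \<tau> *\<^sub>R h" using n by simp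
      then have "max_face d = max_face e2" unfolding max_face_eq_iff using e2(5) sgd sgS by auto
      then show ?thesis ..
    qed
  qed
  show ?thesis by (rule that[OF e1(2,3) e2(2,3) e1(4) e2(4) ne uniq])
qed

end

section \<open>Incidence signs\<close>

definition incidence_map :: "('u::euclidean_space set \<Rightarrow> 'u list) \<Rightarrow> 'u set \<Rightarrow> 'u set \<Rightarrow> 'g::ab_group_add \<Rightarrow> 'g"
  where "incidence_map ori F' F m = (if incidence_sign ori F' F = 1 then m else - m)"

lemma incidence_map_add: "incidence_map ori F' F (m + n) = incidence_map ori F' F m + incidence_map ori F' F n"
  by (simp add: incidence_map_def)

lemma incidence_map_diff: "incidence_map ori F' F (m - n) = incidence_map ori F' F m - incidence_map ori F' F n"
  by (simp add: incidence_map_def)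

lemma incidence_map_zero [simp]: "incidence_map ori F' F 0 = 0"
  by (simp add: incidence_map_def)

lemma incidence_map_sum: "incidence_map ori F' F (sum h A) = (\<Sum>x\<in>A. incidence_map ori F' F (h x))"
  by (simp add: incidence_map_def sum_negf)

lemma diff_closed_incidence_map: "diff_closed G \<Longrightarrow> m \<in> G \<Longrightarrow> incidence_map ori F' F m \<in> G"
  by (simp add: incidence_map_def diff_closed_minus)

locale oriented_zonotope = zonotope I u Z
  for I :: "'i set" and u :: "'i \<Rightarrow> 'u::euclidean_space" and Z :: "'u set" +
  fixes ori :: "'u set \<Rightarrow> 'u list"
  assumes orientations: "face_orientations Z ori"
begin

lemma max_face_less: "p \<in> max_face h \<Longrightarrow> q \<in> Z \<Longrightarrow> q \<notin> max_face h \<Longrightarrow> h \<bullet> q < h \<bullet> p"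
  unfolding max_face_def by force

lemma max_face_subset_Z: "max_face h \<subseteq> Z"
  by (auto simp: max_face_def)

abbreviation "frame_of g \<equiv> ori (max_face g)"

lemma frame_ori: "frame (frame_of g)"
  and span_ori: "span (set (frame_of g)) = flat I u g"
  and length_ori: "length (frame_of g) = dim (flat I u g)"
proof -
  have *: "distinct (frame_of g) \<and> independent (set (frame_of g)) \<and>
        span (set (frame_of g)) = direction_space (max_face g)"
    using orientations max_face_face_of max_face_nonempty unfolding face_orientations_def by blast
  then show "frame (frame_of g)" "span (set (frame_of g)) = flat I u g"
    by (auto simp: frame_def direction_space_max_face)
  show "length (frame_of g) = dim (flat I u g)"
    using * dim_span_eq_card_independent[of "set (frame_of g)"]
    by (simp add: distinct_card direction_space_max_face)
qed

lemma frame_Cons_ori: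
  assumes "max_face f \<subseteq> max_face g" "dim (flat I u g) = dim (flat I u f) + 1"
    and v: "v \<in> flat I u g" "f \<bullet> v \<noteq> 0"
  shows "frame (v # frame_of f)" "span (set (v # frame_of f)) = flat I u g"
    "length (v # frame_of f) = length (frame_of g)"
proof -
  have n: "v \<notin> span (set (frame_of f))" unfolding span_ori using v(2) inner_flat_eq_0 by blast
  then show "frame (v # frame_of f)" by (simp add: frame_Cons frame_ori)
  show "length (v # frame_of f) = length (frame_of g)" using assms(2) by (simp add: length_ori)
  have "dim (set (frame_of f)) = dim (flat I u f)" by (metis span_ori dim_span)
  then have "dim (insert v (set (frame_of f))) = dim (flat I u g)"
    using n assms(2) by (simp add: dim_insert)
  moreover have "insert v (set (frame_of f)) \<subseteq> flat I u g"
    using v(1) span_ori[of f] max_face_subset_flat[OF assms(1)] span_superset by fastforce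
  ultimately have "span (insert v (set (frame_of f))) = span (flat I u g)"
    by (intro dim_eq_span) auto
  then show "span (set (v # frame_of f)) = flat I u g" by (simp add: flat_def)
qed

lemma incidence_det_nonzero:
  assumes "max_face f \<subseteq> max_face g" "dim (flat I u g) = dim (flat I u f) + 1"
    and v: "v \<in> flat I u g" "f \<bullet> v \<noteq> 0"
  shows "frame_det (v # frame_of f) (frame_of g) \<noteq> 0"
  using frame_Cons_ori[OF assms] by (intro frame_det_nonzero frame_ori) (auto simp: span_ori)

text \<open>An outward vector \<open>p - q\<close> satisfies \<open>f \<bullet> (p - q) > 0\<close>
  and is a multiple of \<open>v\<close> modulo the flat of \<open>f\<close>, the factor having the
  sign of \<open>f \<bullet> v\<close>. Hence any transversal \<open>v\<close> computes the
  incidence sign, and one \<open>v\<close> can be shared by several faces.\<close>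

lemma incidence_map_eq:
  assumes sub: "max_face f \<subseteq> max_face g" and dim: "dim (flat I u g) = dim (flat I u f) + 1"
    and v: "v \<in> flat I u g" "f \<bullet> v \<noteq> 0"
  shows "incidence_map ori (max_face f) (max_face g) m
    = signed ((f \<bullet> v) * frame_det (v # frame_of f) (frame_of g)) m"
proof -
  let ?D = "frame_det (v # frame_of f) (frame_of g)"
  note fr = frame_Cons_ori[OF assms]
  have so: "same_orientation ((p - q) # frame_of f) (frame_of g) \<longleftrightarrow> (f \<bullet> v) * ?D > 0"
    if pq: "p \<in> max_face f" "q \<in> max_face g - max_face f" for p q
  proof -
    have wV: "p - q \<in> flat I u g"
      using pq sub diff_in_direction_space[of p "max_face g" q] by (auto simp: direction_space_max_face)
    then have "p - q \<in> span (insert v (set (frame_of f)))" using fr(2) by simp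
    then obtain c where c: "p - q - c *\<^sub>R v \<in> span (set (frame_of f))"
      using span_breakdown_eq by blast
    then have "f \<bullet> (p - q - c *\<^sub>R v) = 0" unfolding span_ori by (rule inner_flat_eq_0)
    then have fc: "f \<bullet> (p - q) = c * (f \<bullet> v)" by (simp add: inner_diff_right)
    have "f \<bullet> q < f \<bullet> p"
      using pq max_face_subset_Z[of g] by (intro max_face_less) auto
    then have pos: "c * (f \<bullet> v) > 0" using fc by (simp add: inner_diff_right)
    have "frame_det ((p - q) # frame_of f) (frame_of g)
        = frame_det ((p - q) # frame_of f) (v # frame_of f) * ?D"
      using fr wV span_ori max_face_subset_flat[OF sub] span_superset
      by (intro frame_det_trans frame_ori) (auto simp: span_ori intro: span_base)
    also have "frame_det ((p - q) # frame_of f) (v # frame_of f) = c"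
      using frame_det_Cons[OF fr(1) refl span_superset c] frame_det_self[OF frame_ori[of f]] by simp
    finally have D: "frame_det ((p - q) # frame_of f) (frame_of g) = c * ?D" .
    have "set ((p - q) # frame_of f) \<subseteq> span (set (frame_of g))"
      using wV max_face_subset_flat[OF sub] span_superset[of "set (frame_of f)"]
      by (auto simp: span_ori)
    then have "same_orientation ((p - q) # frame_of f) (frame_of g) \<longleftrightarrow> c * ?D > 0"
      using fr(3) D by (subst same_orientation_iff) (auto simp: frame_ori)
    also have "\<dots> \<longleftrightarrow> (f \<bullet> v) * ?D > 0" using pos by (auto simp: zero_less_mult_iff)
    finally show ?thesis .
  qed
  have "max_face f \<noteq> max_face g" using dim direction_space_max_face by (metis add_cancel_right_right one_neq_zero)
  then obtain q where q: "q \<in> max_face g - max_face f" using sub by blast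
  obtain p where p: "p \<in> max_face f" using max_face_nonempty by blast
  have "incidence_sign ori (max_face f) (max_face g) = 1 \<longleftrightarrow> (f \<bullet> v) * ?D > 0"
    unfolding incidence_sign_def using so p q max_face_nonempty[of f] by auto
  then show ?thesis by (simp add: incidence_map_def signed_def)
qed

lemma face_of_same_dim:
  assumes "max_face e \<subseteq> max_face d" "dim (flat I u e) = dim (flat I u d)"
  shows "max_face e = max_face d"
proof -
  have e: "flat I u e = flat I u d"
    by (intro subspace_dim_equal subspace_flat max_face_subset_flat assms(1)) (simp add: assms(2))
  show ?thesis unfolding max_face_eq_iff
  proof
    fix i assume i: "i \<in> I"
    show "sgn (e \<bullet> u i) = sgn (d \<bullet> u i)"
    proof (cases "d \<bullet> u i = 0")
      case True
      then have "u i \<in> flat I u d" unfolding flat_def by (intro span_base) (use i in auto)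
      then show ?thesis using e inner_flat_eq_0[of "u i" I u e] True by simp
    qed (use assms(1) i max_face_subset in auto)
  qed
qed

text \<open>Both composites compare a frame of \<open>f\<close>, extended by the same two outward
  vectors, with the frame of \<open>g\<close>; only the order of the two vectors differs.\<close>

lemma incidence_diamond:
  assumes f1: "max_face f \<subseteq> max_face e1" "max_face e1 \<subseteq> max_face g"
    and f2: "max_face f \<subseteq> max_face e2" "max_face e2 \<subseteq> max_face g"
    and d: "dim (flat I u g) = dim (flat I u f) + 2"
    and d1: "dim (flat I u e1) = dim (flat I u f) + 1" and d2: "dim (flat I u e2) = dim (flat I u f) + 1"
    and ne: "max_face e1 \<noteq> max_face e2"
  shows "incidence_map ori (max_face e1) (max_face g) (incidence_map ori (max_face f) (max_face e1) m)
    = - incidence_map ori (max_face e2) (max_face g) (incidence_map ori (max_face f) (max_face e2) m)"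
proof -
  obtain p where p: "p \<in> max_face f" using max_face_nonempty by blast
  obtain q1 where q1: "q1 \<in> max_face e1" "q1 \<notin> max_face e2"
    using face_of_same_dim[of e1 e2] ne d1 d2 by auto
  obtain q2 where q2: "q2 \<in> max_face e2" "q2 \<notin> max_face e1"
    using face_of_same_dim[of e2 e1] ne d1 d2 by auto
  \<comment> \<open>Since \<open>q1\<close> lies in \<open>e1\<close> but not in \<open>e2\<close>,
    the vector \<open>w1\<close> is outward for \<open>f\<close> in \<open>e1\<close> and also for
    \<open>e2\<close> in \<open>g\<close>; symmetrically for \<open>w2\<close>. All four incidences
    are then computed by these two vectors.\<close>
  define w1 where "w1 = p - q1"
  define w2 where "w2 = p - q2"
  have w1: "w1 \<in> flat I u e1" unfolding w1_def direction_space_max_face[symmetric]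
    using p q1 f1 by (intro diff_in_direction_space) auto
  have w2: "w2 \<in> flat I u e2" unfolding w2_def direction_space_max_face[symmetric]
    using p q2 f2 by (intro diff_in_direction_space) auto
  have "q1 \<notin> max_face f" "q2 \<notin> max_face f" using q1(2) q2(2) f1(1) f2(1) by auto
  then have pos: "f \<bullet> w1 > 0" "f \<bullet> w2 > 0" "e1 \<bullet> w2 > 0" "e2 \<bullet> w1 > 0"
    using max_face_less[of p f q1] max_face_less[of p f q2] max_face_less[of p e1 q2]
      max_face_less[of p e2 q1] p q1 q2 max_face_subset_Z[of e1] max_face_subset_Z[of e2] f1 f2
    by (auto simp: w1_def w2_def inner_diff_right subset_iff)
  have w1g: "w1 \<in> flat I u g" and w2g: "w2 \<in> flat I u g"
    using w1 w2 max_face_subset_flat[OF f1(2)] max_face_subset_flat[OF f2(2)] by auto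
  have dd: "dim (flat I u g) = dim (flat I u e1) + 1" "dim (flat I u g) = dim (flat I u e2) + 1"
    using d d1 d2 by auto
  let ?o = "frame_of f" and ?o1 = "frame_of e1" and ?o2 = "frame_of e2" and ?g = "frame_of g"
  have nz: "f \<bullet> w1 \<noteq> 0" "f \<bullet> w2 \<noteq> 0" "e1 \<bullet> w2 \<noteq> 0" "e2 \<bullet> w1 \<noteq> 0" using pos by auto
  note F1 = frame_Cons_ori[OF f1(1) d1 w1 nz(1)] and F2 = frame_Cons_ori[OF f2(1) d2 w2 nz(2)]
  note G1 = frame_Cons_ori[OF f1(2) dd(1) w2g nz(3)] and G2 = frame_Cons_ori[OF f2(2) dd(2) w1g nz(4)]
  have n1: "frame (w2 # w1 # ?o)"
    using F1 inner_flat_eq_0 pos(3) frame_Cons[of w2 "w1 # ?o"] by force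
  have n2: "frame (w1 # w2 # ?o)"
    using F2 inner_flat_eq_0 pos(4) frame_Cons[of w1 "w2 # ?o"] by force
  have step: "frame_det (w' # w # ?o) ?g = frame_det (w # ?o) oe * frame_det (w' # oe) ?g"
    if "frame (w' # oe)" "length (w # ?o) = length oe" "length (w' # oe) = length ?g"
      "set (w # ?o) \<subseteq> span (set oe)" "set (w' # oe) \<subseteq> span (set ?g)" for w w' oe
  proof -
    have "frame_det (w' # w # ?o) ?g = frame_det (w' # w # ?o) (w' # oe) * frame_det (w' # oe) ?g"
    proof (intro frame_det_trans frame_ori that)
      have "span (set oe) \<subseteq> span (set (w' # oe))" by (rule span_mono) auto
      then show "set (w' # w # ?o) \<subseteq> span (set (w' # oe))" using that(4) by (auto intro: span_base)
    qed (use that in auto)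
    also have "frame_det (w' # w # ?o) (w' # oe) = frame_det (w # ?o) oe"
      using frame_det_Cons[OF that(1,2,4), of w' 1] by (simp add: span_0)
    finally show ?thesis .
  qed
  have "frame_det (w2 # w1 # ?o) ?g = frame_det (w1 # ?o) ?o1 * frame_det (w2 # ?o1) ?g"
    using F1 G1 span_superset[of "set (w1 # ?o)"] span_superset[of "set (w2 # ?o1)"]
    by (intro step) (auto simp: span_ori)
  moreover have "frame_det (w1 # w2 # ?o) ?g = frame_det (w2 # ?o) ?o2 * frame_det (w1 # ?o2) ?g"
    using F2 G2 span_superset[of "set (w2 # ?o)"] span_superset[of "set (w1 # ?o2)"]
    by (intro step) (auto simp: span_ori)
  moreover have "frame_det (w1 # w2 # ?o) ?g = frame_det (w1 # w2 # ?o) (w2 # w1 # ?o) * frame_det (w2 # w1 # ?o) ?g"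
  proof (intro frame_det_trans n1 frame_ori)
    show "set (w2 # w1 # ?o) \<subseteq> span (set ?g)" unfolding span_ori
      using w1g w2g max_face_subset_flat[OF f1(1)] max_face_subset_flat[OF f1(2)]
        span_superset[of "set ?o"] by (auto simp: span_ori)
    show "length (w2 # w1 # ?o) = length ?g" using F1(3) G1(3) by simp
    show "set (w1 # w2 # ?o) \<subseteq> span (set (w2 # w1 # ?o))" by (auto intro: span_base)
  qed simp
  ultimately have main: "frame_det (w2 # ?o) ?o2 * frame_det (w1 # ?o2) ?g
      = - (frame_det (w1 # ?o) ?o1 * frame_det (w2 # ?o1) ?g)"
    using frame_det_swap[OF n1] by simp
  have s: "signed (a * x) (signed (b * y) m) = signed (y * x) m"
    if "a > 0" "b > 0" "x \<noteq> 0" "y \<noteq> 0" for a b x y :: real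
    using that by (auto simp: signed_def zero_less_mult_iff)
  note D1 = incidence_det_nonzero[OF f1(1) d1 w1 nz(1)] and D2 = incidence_det_nonzero[OF f2(1) d2 w2 nz(2)]
  note E1 = incidence_det_nonzero[OF f1(2) dd(1) w2g nz(3)] and E2 = incidence_det_nonzero[OF f2(2) dd(2) w1g nz(4)]
  have "incidence_map ori (max_face e1) (max_face g) (incidence_map ori (max_face f) (max_face e1) m)
    = signed (frame_det (w1 # ?o) ?o1 * frame_det (w2 # ?o1) ?g) m"
    unfolding incidence_map_eq[OF f1(1) d1 w1 nz(1)] incidence_map_eq[OF f1(2) dd(1) w2g nz(3)]
    by (rule s[OF pos(3,1) E1 D1])
  moreover have "incidence_map ori (max_face e2) (max_face g) (incidence_map ori (max_face f) (max_face e2) m)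
    = signed (frame_det (w2 # ?o) ?o2 * frame_det (w1 # ?o2) ?g) m"
    unfolding incidence_map_eq[OF f2(1) d2 w2 nz(2)] incidence_map_eq[OF f2(2) dd(2) w1g nz(4)]
    by (rule s[OF pos(4,2) E2 D2])
  ultimately show ?thesis unfolding main using E1 D1 by (simp add: signed_minus)
qed

end

section \<open>Cell complexes of regions\<close>

lemma separate_from_subspace:
  fixes S :: "'u::euclidean_space set"
  assumes "subspace S" "x \<notin> S"
  obtains h where "\<And>y. y \<in> S \<Longrightarrow> h \<bullet> y = 0" "h \<bullet> x > 0"
proof -
  have sp: "span S = S" using assms(1) by (simp add: span_eq_iff)
  have "span S \<subset> span (insert x S)"
  proof
    show "span S \<subseteq> span (insert x S)" by (rule span_mono) auto
    show "span S \<noteq> span (insert x S)" using assms(2) span_base[of x "insert x S"] unfolding sp by blast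
  qed
  from orthogonal_to_subspace_exists_gen[OF this] obtain h where
    h: "h \<noteq> 0" "h \<in> span (insert x S)" "\<And>y. y \<in> S \<Longrightarrow> h \<bullet> y = 0"
    unfolding sp by (auto simp: real_inner_class.orthogonal_def)
  obtain a where a: "h - a *\<^sub>R x \<in> S" using h(2) span_breakdown_eq[of h x S] unfolding sp by blast
  have "h \<bullet> x \<noteq> 0"
  proof
    assume "h \<bullet> x = 0"
    moreover have "h \<bullet> (h - a *\<^sub>R x) = 0" by (rule h(3)[OF a])
    ultimately show False using h(1) by (simp add: inner_diff_right)
  qed
  then show ?thesis using that[of h] that[of "- h"] h(3) by (cases "h \<bullet> x > 0") auto
qed

context oriented_zonotope
begin

definition cell_facets :: "'u set set \<Rightarrow> 'u set \<Rightarrow> 'u set set" where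
  "cell_facets K F = {F' \<in> K. F' \<subseteq> F \<and> aff_dim F' = aff_dim F - 1}"

text \<open>Facets outside \<open>K\<close> are simply dropped. For a region this still gives a
  complex, thanks to \<open>cells_convex\<close>.\<close>

definition cell_diff :: "'u set set \<Rightarrow> ('u set \<Rightarrow> 'g::ab_group_add) \<Rightarrow> 'u set \<Rightarrow> 'g" where
  "cell_diff K z F = (\<Sum>F'\<in>cell_facets K F. incidence_map ori F' F (z F'))"

lemma cell_diff_add: "cell_diff K (\<lambda>F. z F + w F) F = cell_diff K z F + cell_diff K w F"
  by (simp add: cell_diff_def incidence_map_add sum.distrib)

lemma cell_diff_diff: "cell_diff K (\<lambda>F. z F - w F) F = cell_diff K z F - cell_diff K w F"
  by (simp add: cell_diff_def incidence_map_diff sum_subtractf)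

lemma aff_dim_max_face: "aff_dim (max_face g) = int (dim (flat I u g))"
  using aff_dim_direction_space[OF max_face_nonempty] by (simp add: direction_space_max_face)

lemma finite_faces: "finite {F. F face_of Z}"
  by (rule finite_polytope_faces[OF polytope_Z])

lemma finite_cells: "finite (cells B c)"
  by (rule finite_subset[OF _ finite_faces]) (auto simp: cells_def max_face_face_of)

lemma finite_cell_facets: "finite K \<Longrightarrow> finite (cell_facets K F)"
  by (simp add: cell_facets_def)

text \<open>Keeps diamonds intact: if the two ends lie in the region, so do both faces in the
  middle, and their contributions cancel.\<close>

lemma cells_convex:
  assumes "B \<subseteq> I" "max_face f \<in> cells B c" "max_face g \<in> cells B c"
    and "max_face f \<subseteq> max_face e" "max_face e \<subseteq> max_face g"
  shows "max_face e \<in> cells B c"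
  unfolding max_face_in_cells[OF assms(1)]
proof
  fix i assume i: "i \<in> B"
  then have iI: "i \<in> I" using assms(1) by blast
  have "sgn (f \<bullet> u i) = c i" "sgn (g \<bullet> u i) = c i" using assms(2,3) i max_face_in_cells[OF assms(1)] by auto
  then show "sgn (e \<bullet> u i) = c i" using assms(4,5) iI unfolding max_face_subset
    by (metis sgn_zero_iff)
qed

lemma cell_diff_twice:
  assumes B: "B \<subseteq> I" and F: "F \<in> cells B c"
  shows "cell_diff (cells B c) (cell_diff (cells B c) z) F = 0"
proof -
  let ?K = "cells B c"
  let ?A = "cell_facets ?K F" and ?C = "{F'' \<in> ?K. aff_dim F'' = aff_dim F - 2}"
  have finA: "finite ?A" and finC: "finite ?C" using finite_cells[of B c] by (auto simp: finite_cell_facets)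
  have "cell_diff ?K (cell_diff ?K z) F
    = (\<Sum>F'\<in>?A. \<Sum>F''\<in>cell_facets ?K F'. incidence_map ori F' F (incidence_map ori F'' F' (z F'')))"
    by (simp add: cell_diff_def incidence_map_sum)
  also have "\<dots> = (\<Sum>F'\<in>?A. \<Sum>F''\<in>{F'' \<in> ?C. F'' \<subseteq> F'}. incidence_map ori F' F (incidence_map ori F'' F' (z F'')))"
    by (intro sum.cong refl) (auto simp: cell_facets_def)
  also have "\<dots> = (\<Sum>F''\<in>?C. \<Sum>F'\<in>{F' \<in> ?A. F'' \<subseteq> F'}. incidence_map ori F' F (incidence_map ori F'' F' (z F'')))"
    by (rule sum.swap_restrict[OF finA finC])
  also have "\<dots> = 0"
  proof (rule sum.neutral, rule ballI)
    fix F'' assume F'': "F'' \<in> ?C"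
    show "(\<Sum>F'\<in>{F' \<in> ?A. F'' \<subseteq> F'}. incidence_map ori F' F (incidence_map ori F'' F' (z F''))) = 0"
    proof (cases "F'' \<subseteq> F")
      case False
      then have empty: "{F' \<in> ?A. F'' \<subseteq> F'} = {}" by (auto simp: cell_facets_def)
      show ?thesis unfolding empty by simp
    next
      case True
      obtain f where f: "F'' = max_face f" using F'' by (auto simp: cells_def)
      obtain g where g: "F = max_face g" using F by (auto simp: cells_def)
      have sub: "max_face f \<subseteq> max_face g" using True f g by simp
      have d: "dim (flat I u g) = dim (flat I u f) + 2" using F'' unfolding f g by (simp add: aff_dim_max_face)
      obtain e1 e2 where e: "max_face f \<subseteq> max_face e1" "max_face e1 \<subseteq> max_face g"
        "max_face f \<subseteq> max_face e2" "max_face e2 \<subseteq> max_face g"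
        "dim (flat I u e1) = dim (flat I u f) + 1" "dim (flat I u e2) = dim (flat I u f) + 1"
        "max_face e1 \<noteq> max_face e2"
        and uniq: "\<And>d. max_face f \<subseteq> max_face d \<Longrightarrow> max_face d \<subseteq> max_face g \<Longrightarrow>
          dim (flat I u d) = dim (flat I u f) + 1 \<Longrightarrow> max_face d = max_face e1 \<or> max_face d = max_face e2"
        by (rule diamond[OF sub d]) blast
      have "{F' \<in> ?A. F'' \<subseteq> F'} = {max_face e1, max_face e2}"
      proof
        show "{F' \<in> ?A. F'' \<subseteq> F'} \<subseteq> {max_face e1, max_face e2}"
        proof
          fix F' assume F': "F' \<in> {F' \<in> ?A. F'' \<subseteq> F'}"
          then obtain e where e: "F' = max_face e" by (auto simp: cell_facets_def cells_def)
          show "F' \<in> {max_face e1, max_face e2}"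
            using F' uniq[of e] d unfolding e f g by (auto simp: cell_facets_def aff_dim_max_face)
        qed
        have "max_face e1 \<in> ?K" "max_face e2 \<in> ?K"
          using cells_convex[OF B _ _ e(1,2)] cells_convex[OF B _ _ e(3,4)] F'' F f g by auto
        then show "{max_face e1, max_face e2} \<subseteq> {F' \<in> ?A. F'' \<subseteq> F'}"
          using e d unfolding f g by (auto simp: cell_facets_def aff_dim_max_face)
      qed
      then show ?thesis
        using e(7) incidence_diamond[OF e(1-4) d e(5-7), of "z (max_face f)"] unfolding f g by simp
    qed
  qed
  finally show ?thesis .
qed

lemma cell_span_orthogonal:
  assumes "B \<subseteq> I" "max_face g \<in> cells B c" "y \<in> cell_span B c"
  shows "g \<bullet> y = 0"
  using cell_span_subset[OF assms(1,2)] assms(3) inner_flat_eq_0[of y I u g] by (auto simp: direction_space_max_face)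

lemma in_cell_span: "i \<in> B \<Longrightarrow> c i = 0 \<Longrightarrow> u i \<in> cell_span B c"
  unfolding cell_span_def by (intro span_base) auto

lemma perturb_cell:
  assumes B: "B \<subseteq> I" and g: "max_face g \<in> cells B c" and h: "\<And>y. y \<in> cell_span B c \<Longrightarrow> h \<bullet> y = 0"
  obtains g' where "max_face g' \<in> cells B c"
    "\<And>i. i \<in> I \<Longrightarrow> sgn (g' \<bullet> u i) = (if g \<bullet> u i \<noteq> 0 then sgn (g \<bullet> u i) else sgn (h \<bullet> u i))"
proof -
  obtain \<epsilon> where \<epsilon>: "\<epsilon> > 0" "\<forall>i\<in>I. sgn ((g + \<epsilon> *\<^sub>R h) \<bullet> u i) =
      (if g \<bullet> u i \<noteq> 0 then sgn (g \<bullet> u i) else sgn (h \<bullet> u i))" using perturb by blast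
  have "max_face (g + \<epsilon> *\<^sub>R h) \<in> cells B c" unfolding max_face_in_cells[OF B]
  proof
    fix i assume i: "i \<in> B"
    have "sgn (g \<bullet> u i) = c i" using g i by (simp add: max_face_in_cells[OF B])
    then show "sgn ((g + \<epsilon> *\<^sub>R h) \<bullet> u i) = c i"
      using \<epsilon>(2) i B h[OF in_cell_span[OF i]] by (cases "g \<bullet> u i = 0") auto
  qed
  then show ?thesis using that \<epsilon>(2) by blast
qed

text \<open>Take a form in the region vanishing on as few generators as possible. If it vanished on
  a generator outside \<open>cell_span B c\<close>, a perturbation orthogonal to
  \<open>cell_span B c\<close> would stay in the region and vanish on fewer.\<close>

lemma top_cell_exists:
  assumes B: "B \<subseteq> I" and ne: "cells B c \<noteq> {}"
  obtains g where "max_face g \<in> cells B c" "flat I u g = cell_span B c"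
proof -
  let ?m = "\<lambda>g. card {i \<in> I. g \<bullet> u i = 0}"
  have "\<exists>g. max_face g \<in> cells B c" using ne by (auto simp: cells_def)
  then obtain g where g: "max_face g \<in> cells B c" "\<And>g'. max_face g' \<in> cells B c \<Longrightarrow> ?m g \<le> ?m g'"
    using ex_has_least_nat[of "\<lambda>g. max_face g \<in> cells B c" _ ?m] by blast
  have "u i \<in> cell_span B c" if i: "i \<in> I" "g \<bullet> u i = 0" for i
  proof (rule ccontr)
    assume "u i \<notin> cell_span B c"
    then obtain h where h: "\<And>y. y \<in> cell_span B c \<Longrightarrow> h \<bullet> y = 0" "h \<bullet> u i > 0"
      using separate_from_subspace[OF subspace_cell_span] by metis
    obtain g' where g': "max_face g' \<in> cells B c"
      "\<And>i. i \<in> I \<Longrightarrow> sgn (g' \<bullet> u i) = (if g \<bullet> u i \<noteq> 0 then sgn (g \<bullet> u i) else sgn (h \<bullet> u i))"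
      using perturb_cell[OF B g(1) h(1)] by metis
    have "{i \<in> I. g' \<bullet> u i = 0} \<subset> {i \<in> I. g \<bullet> u i = 0}"
    proof (intro psubsetI subsetI notI)
      fix k assume k: "k \<in> {i \<in> I. g' \<bullet> u i = 0}"
      then show "k \<in> {i \<in> I. g \<bullet> u i = 0}" using g'(2)[of k] by (auto split: if_splits simp: sgn_zero_iff)
    next
      assume "{i \<in> I. g' \<bullet> u i = 0} = {i \<in> I. g \<bullet> u i = 0}"
      then have "g' \<bullet> u i = 0" using i by blast
      then show False using g'(2)[OF i(1)] i(2) h(2) by simp
    qed
    then have "?m g' < ?m g" by (intro psubset_card_mono) (use finite_index in auto)
    then show False using g(2)[OF g'(1)] by simp
  qed
  then have "flat I u g \<subseteq> cell_span B c" unfolding flat_def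
    by (intro span_minimal subspace_cell_span) auto
  then show ?thesis using that[OF g(1)] cell_span_subset[OF B g(1)] by (simp add: direction_space_max_face)
qed

section \<open>Cutting a region by one more hyperplane\<close>

abbreviation "slice B c i s \<equiv> cells (insert i B) (c(i := s))"

lemma slice_iff:
  assumes "B \<subseteq> I" "i \<in> I" "i \<notin> B"
  shows "max_face g \<in> slice B c i s \<longleftrightarrow> max_face g \<in> cells B c \<and> sgn (g \<bullet> u i) = s"
proof -
  have "insert i B \<subseteq> I" using assms by blast
  then show ?thesis using assms by (auto simp: max_face_in_cells)
qed

lemma slice_subset:
  assumes "B \<subseteq> I" "i \<in> I" "i \<notin> B"
  shows "slice B c i s \<subseteq> cells B c"
proof
  fix F assume F: "F \<in> slice B c i s"
  then obtain g where "F = max_face g" by (auto simp: cells_def)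
  then show "F \<in> cells B c" using F slice_iff[OF assms] by simp
qed

lemma slice_cases:
  assumes "B \<subseteq> I" "i \<in> I" "i \<notin> B" "F \<in> cells B c"
  obtains "F \<in> slice B c i 1" | "F \<in> slice B c i 0" | "F \<in> slice B c i (-1)"
proof -
  obtain g where g: "F = max_face g" using assms(4) by (auto simp: cells_def)
  have "sgn (g \<bullet> u i) = 1 \<or> sgn (g \<bullet> u i) = 0 \<or> sgn (g \<bullet> u i) = -1" by (auto simp: sgn_if)
  then show ?thesis using that assms(4) slice_iff[OF assms(1-3)] unfolding g by blast
qed

lemma slice_disjoint:
  assumes "B \<subseteq> I" "i \<in> I" "i \<notin> B" "F \<in> slice B c i s" "F \<in> slice B c i t"
  shows "s = t"
proof -
  obtain g where "F = max_face g" using assms(4) by (auto simp: cells_def)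
  then show ?thesis using assms slice_iff[OF assms(1-3)] by simp
qed

text \<open>Non-zero signs survive passage to a smaller face: the two halves are open in the region.
  So the differential on a half needs no values from outside it, whereas on the wall it also sees
  both halves.\<close>

lemma slice_down:
  assumes "B \<subseteq> I" "i \<in> I" "i \<notin> B" "F \<in> slice B c i s" "s \<noteq> 0" "F' \<in> cells B c" "F' \<subseteq> F"
  shows "F' \<in> slice B c i s"
proof -
  obtain g where g: "F = max_face g" using assms(4) by (auto simp: cells_def)
  obtain f where f: "F' = max_face f" using assms(6) by (auto simp: cells_def)
  have s: "sgn (g \<bullet> u i) = s" using assms(4) slice_iff[OF assms(1-3)] unfolding g by simp
  then have "sgn (f \<bullet> u i) = s" using assms(2,5,7) unfolding f g max_face_subset
    by (metis sgn_zero_iff)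
  then show ?thesis using assms(6) slice_iff[OF assms(1-3)] unfolding f by simp
qed

lemma slice_facets:
  assumes "B \<subseteq> I" "i \<in> I" "i \<notin> B" "F \<in> slice B c i s" "s \<noteq> 0"
  shows "cell_facets (cells B c) F = cell_facets (slice B c i s) F"
  using slice_down[OF assms] slice_subset[OF assms(1-3)] by (auto simp: cell_facets_def)

lemma cell_span_slice:
  assumes "i \<notin> B"
  shows "s \<noteq> 0 \<Longrightarrow> cell_span (insert i B) (c(i := s)) = cell_span B c"
    and "cell_span (insert i B) (c(i := 0)) = span (insert (u i) (cell_span B c))"
proof -
  assume "s \<noteq> 0"
  then have "{k \<in> insert i B. (c(i := s)) k = 0} = {k \<in> B. c k = 0}" using assms by auto
  then show "cell_span (insert i B) (c(i := s)) = cell_span B c" by (simp add: cell_span_def)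
next
  have "{k \<in> insert i B. (c(i := 0)) k = 0} = insert i {k \<in> B. c k = 0}" using assms by auto
  then have "cell_span (insert i B) (c(i := 0)) = span (insert (u i) (u ` {k \<in> B. c k = 0}))"
    by (simp add: cell_span_def)
  also have "\<dots> = span (insert (u i) (cell_span B c))"
    unfolding cell_span_def by (simp add: span_insert span_span)
  finally show "cell_span (insert i B) (c(i := 0)) = span (insert (u i) (cell_span B c))" .
qed

text \<open>Convexity: if both halves are non-empty, so is the wall between them. In the uncut case
  the extra condition changes neither the cells nor the span, and the induction hypothesis applies
  directly.\<close>

lemma slice_trichotomy:
  assumes B: "B \<subseteq> I" "i \<in> I" "i \<notin> B" and ne: "cells B c \<noteq> {}"
  obtains (uncut) s where "cells B c = slice B c i s"
      "cell_span (insert i B) (c(i := s)) = cell_span B c"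
  | (cut) "u i \<notin> cell_span B c" "slice B c i 0 \<noteq> {}"
proof (cases "u i \<in> cell_span B c")
  case True
  have "cells B c \<subseteq> slice B c i 0"
  proof
    fix F assume F: "F \<in> cells B c"
    then obtain g where g: "F = max_face g" by (auto simp: cells_def)
    then show "F \<in> slice B c i 0" using F cell_span_orthogonal[OF B(1) _ True] slice_iff[OF B] by simp
  qed
  then have "cells B c = slice B c i 0" using slice_subset[OF B] by blast
  moreover have "cell_span (insert i B) (c(i := 0)) = cell_span B c"
    unfolding cell_span_slice(2)[OF B(3)] using True subspace_cell_span
    by (metis insert_absorb span_eq_iff)
  ultimately show ?thesis by (rule uncut)
next
  case False
  show ?thesis
  proof (cases "slice B c i 0 = {}")
    case True
    have "slice B c i 1 = {} \<or> slice B c i (-1) = {}"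
    proof (rule ccontr)
      assume "\<not> ?thesis"
      then obtain g1 g2 where g: "max_face g1 \<in> slice B c i 1" "max_face g2 \<in> slice B c i (-1)"
        by (auto simp: cells_def)
      then have gi: "g1 \<bullet> u i > 0" "g2 \<bullet> u i < 0" and gB: "max_face g1 \<in> cells B c" "max_face g2 \<in> cells B c"
        unfolding slice_iff[OF B] by (auto simp: sgn_1_pos sgn_1_neg)
      \<comment> \<open>Both weights are positive, so the common signs of \<open>g1\<close> and
        \<open>g2\<close> on \<open>B\<close> persist, and they are chosen to cancel at
        \<open>u i\<close>.\<close>
      let ?g = "(- (g2 \<bullet> u i)) *\<^sub>R g1 + (g1 \<bullet> u i) *\<^sub>R g2"
      have "max_face ?g \<in> cells B c" unfolding max_face_in_cells[OF B(1)]
      proof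
        fix k assume k: "k \<in> B"
        then have s: "sgn (g1 \<bullet> u k) = c k" "sgn (g2 \<bullet> u k) = c k"
          using gB by (auto simp: max_face_in_cells[OF B(1)])
        have e: "?g \<bullet> u k = (- (g2 \<bullet> u i)) * (g1 \<bullet> u k) + (g1 \<bullet> u i) * (g2 \<bullet> u k)"
          by (simp add: inner_diff_left inner_add_left)
        have comb: "sgn (a * x + b * y) = t" if "a > 0" "b > 0" "sgn x = t" "sgn y = t" for a b x y t :: real
        proof (cases x "0::real" rule: linorder_cases)
          case less
          then have "y < 0" using that by (metis sgn_1_neg)
          then have "a * x + b * y < 0" using less that(1,2) by (intro add_neg_neg mult_pos_neg)
          then show ?thesis using less that(3) by simp
        next
          case equal
          then have "y = 0" using that(3,4) by (simp add: sgn_zero_iff)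
          then show ?thesis using equal that(3) by simp
        next
          case greater
          then have "y > 0" using that by (metis sgn_1_pos)
          then have "a * x + b * y > 0" using greater that(1,2) by (intro add_pos_pos mult_pos_pos)
          then show ?thesis using greater that(3) by simp
        qed
        show "sgn (?g \<bullet> u k) = c k" unfolding e by (rule comb) (use s gi in auto)
      qed
      moreover have "?g \<bullet> u i = 0" by (simp add: inner_diff_left inner_add_left)
      ultimately have "max_face ?g \<in> slice B c i 0" unfolding slice_iff[OF B] by simp
      then show False using True by blast
    qed
    moreover have "cells B c = slice B c i 1 \<union> slice B c i (-1)"
    proof
      show "cells B c \<subseteq> slice B c i 1 \<union> slice B c i (-1)"
      proof
        fix F assume "F \<in> cells B c"
        then show "F \<in> slice B c i 1 \<union> slice B c i (-1)"
          by (rule slice_cases[OF B]) (use True in auto)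
      qed
    qed (use slice_subset[OF B] in auto)
    ultimately consider "cells B c = slice B c i 1" | "cells B c = slice B c i (-1)" by auto
    then show ?thesis
    proof cases
      case 1
      show ?thesis by (rule uncut[OF 1]) (simp add: cell_span_slice(1)[OF B(3)])
    next
      case 2
      show ?thesis by (rule uncut[OF 2]) (simp add: cell_span_slice(1)[OF B(3)])
    qed
  qed (use cut False in blast)
qed

end

section \<open>Cohomology of regions\<close>

lemma signed_cancel:
  assumes "s \<noteq> 0" "t \<noteq> 0" "signed (s * t) x = signed t y"
  shows "x = signed s y"
proof -
  have "signed t (signed s x) = signed t y" using assms signed_mult[of t s x] by (simp add: mult.commute)
  then show ?thesis by (metis signed_signed)
qed

context oriented_zonotope
begin

text \<open>With one transversal \<open>v\<close> for both neighbours, the outward factor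
  \<open>g2 \<bullet> v < 0\<close> becomes the minus sign, and the remaining signs depend only on
  the frames.\<close>

lemma wall_facets:
  fixes z :: "'u set \<Rightarrow> 'g::ab_group_add"
  assumes B: "B \<subseteq> I" and g: "max_face g \<in> cells B c"
    and dim: "dim (flat I u g) = dim (cell_span B c) + 1"
    and v: "v \<in> flat I u g" "v \<notin> cell_span B c"
  obtains g1 g2 where "max_face g1 \<in> cells B c" "max_face g2 \<in> cells B c"
    "flat I u g1 = cell_span B c" "flat I u g2 = cell_span B c" "g1 \<bullet> v > 0" "g2 \<bullet> v < 0"
    "max_face g1 \<subseteq> max_face g" "max_face g2 \<subseteq> max_face g"
    "cell_facets (cells B c) (max_face g) = {max_face g1, max_face g2}"
    "cell_diff (cells B c) z (max_face g) =
      signed (frame_det (v # frame_of g1) (frame_of g)) (z (max_face g1))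
      - signed (frame_det (v # frame_of g2) (frame_of g)) (z (max_face g2))"
proof -
  obtain g1 g2 where w: "max_face g1 \<in> cells B c" "max_face g2 \<in> cells B c"
    "max_face g1 \<subseteq> max_face g" "max_face g2 \<subseteq> max_face g"
    "flat I u g1 = cell_span B c" "flat I u g2 = cell_span B c"
    "max_face g1 \<noteq> max_face g2" "g1 \<bullet> v > 0" "g2 \<bullet> v < 0"
    and uniq: "\<And>F'. F' \<in> cells B c \<Longrightarrow> F' \<subseteq> max_face g \<Longrightarrow> dim (direction_space F') = dim (cell_span B c)
      \<Longrightarrow> F' = max_face g1 \<or> F' = max_face g2"
    by (rule wall[OF assms]) blast
  have facets: "cell_facets (cells B c) (max_face g) = {max_face g1, max_face g2}"
  proof
    show "cell_facets (cells B c) (max_face g) \<subseteq> {max_face g1, max_face g2}"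
    proof
      fix F' assume F': "F' \<in> cell_facets (cells B c) (max_face g)"
      then obtain f where f: "F' = max_face f" by (auto simp: cell_facets_def cells_def)
      show "F' \<in> {max_face g1, max_face g2}" using uniq[of F'] F' dim
        by (auto simp: cell_facets_def f aff_dim_max_face direction_space_max_face)
    qed
    show "{max_face g1, max_face g2} \<subseteq> cell_facets (cells B c) (max_face g)"
      using w dim by (auto simp: cell_facets_def aff_dim_max_face)
  qed
  have d: "dim (flat I u g) = dim (flat I u g1) + 1" "dim (flat I u g) = dim (flat I u g2) + 1"
    using dim w by auto
  have nz: "g1 \<bullet> v \<noteq> 0" "g2 \<bullet> v \<noteq> 0" using w by auto
  let ?D1 = "frame_det (v # frame_of g1) (frame_of g)"
    and ?D2 = "frame_det (v # frame_of g2) (frame_of g)"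
  have D: "?D1 \<noteq> 0" "?D2 \<noteq> 0"
    using incidence_det_nonzero[OF w(3) d(1) v(1) nz(1)] incidence_det_nonzero[OF w(4) d(2) v(1) nz(2)] by auto
  have "cell_diff (cells B c) z (max_face g) = signed ?D1 (z (max_face g1)) - signed ?D2 (z (max_face g2))"
  proof -
    have "signed ((g1 \<bullet> v) * ?D1) (z (max_face g1)) = signed ?D1 (z (max_face g1))"
      using w(8) by (simp add: signed_def zero_less_mult_iff)
    moreover have "signed ((g2 \<bullet> v) * ?D2) (z (max_face g2)) = - signed ?D2 (z (max_face g2))"
      using w(9) D(2) by (auto simp: signed_def zero_less_mult_iff)
    ultimately show ?thesis unfolding cell_diff_def facets using w(7)
      by (simp add: incidence_map_eq[OF w(3) d(1) v(1) nz(1)] incidence_map_eq[OF w(4) d(2) v(1) nz(2)])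
  qed
  then show ?thesis by (rule that[OF w(1,2,5,6,8,9,3,4) facets])
qed

lemma frame_det_ori_trans:
  assumes "flat I u f = flat I u g" "flat I u g = flat I u h"
  shows "frame_det (frame_of f) (frame_of h)
    = frame_det (frame_of f) (frame_of g) * frame_det (frame_of g) (frame_of h)"
  using assms span_superset[of "set (frame_of f)"] span_superset[of "set (frame_of g)"]
  by (intro frame_det_trans frame_ori) (auto simp: length_ori span_ori)

lemma frame_det_ori_nonzero:
  assumes "flat I u f = flat I u g"
  shows "frame_det (frame_of f) (frame_of g) \<noteq> 0"
  using assms by (intro frame_det_nonzero frame_ori) (auto simp: length_ori span_ori)

lemma frame_det_Cons_ori_trans:
  assumes fg: "max_face f \<subseteq> max_face g" "dim (flat I u g) = dim (flat I u f) + 1"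
    and v: "v \<in> flat I u g" "f \<bullet> v \<noteq> 0" and gh: "flat I u g = flat I u h"
  shows "frame_det (v # frame_of f) (frame_of h)
    = frame_det (v # frame_of f) (frame_of g) * frame_det (frame_of g) (frame_of h)"
proof -
  note f = frame_Cons_ori[OF fg v]
  have "set (v # frame_of f) \<subseteq> flat I u g" using f(2) span_superset by metis
  moreover have "set (frame_of g) \<subseteq> flat I u h" using span_superset[of "set (frame_of g)"] gh by (simp add: span_ori)
  ultimately show ?thesis using f(3) gh by (intro frame_det_trans frame_ori) (auto simp: length_ori span_ori)
qed

text \<open>\<open>f'\<close> need not be a face of \<open>g\<close>; only its flat matters. This
  carries a comparison with \<open>g\<close> over to cells that are not adjacent to it.\<close>

lemma frame_det_Cons_ori_change:
  assumes fg: "max_face f \<subseteq> max_face g" "dim (flat I u g) = dim (flat I u f) + 1"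
    and v: "v \<in> flat I u g" "f \<bullet> v \<noteq> 0" and f': "flat I u f' = flat I u f"
  shows "frame_det (v # frame_of f') (frame_of g)
    = frame_det (frame_of f') (frame_of f) * frame_det (v # frame_of f) (frame_of g)"
proof -
  note f = frame_Cons_ori[OF fg v]
  have s: "set (frame_of f') \<subseteq> span (set (frame_of f))"
    using span_superset[of "set (frame_of f')"] f' by (simp add: span_ori)
  have l: "length (frame_of f') = length (frame_of f)" using f' by (simp add: length_ori)
  have "span (set (frame_of f)) \<subseteq> span (set (v # frame_of f))" by (rule span_mono) auto
  then have "set (v # frame_of f') \<subseteq> span (set (v # frame_of f))" using s by (auto intro: span_base)
  moreover have "set (v # frame_of f) \<subseteq> span (set (frame_of g))"
    unfolding span_ori using f(2) span_superset by metis
  ultimately have "frame_det (v # frame_of f') (frame_of g)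
    = frame_det (v # frame_of f') (v # frame_of f) * frame_det (v # frame_of f) (frame_of g)"
    using l f(3) by (intro frame_det_trans f(1) frame_ori) auto
  also have "frame_det (v # frame_of f') (v # frame_of f) = frame_det (frame_of f') (frame_of f)"
    using frame_det_Cons[OF f(1) l s, of v 1] by (simp add: span_0)
  finally show ?thesis .
qed

lemma cell_diff_slice:
  assumes "B \<subseteq> I" "i \<in> I" "i \<notin> B" "F \<in> slice B c i s" "s \<noteq> 0"
  shows "cell_diff (cells B c) z F = cell_diff (slice B c i s) z F"
  unfolding cell_diff_def slice_facets[OF assms] ..

text \<open>A top cell of the wall has codimension 1 in the region, and \<open>u i\<close> is
  transversal to it; so by \<open>wall\<close> it has one neighbour in each half.\<close>

lemma cut_slices_nonempty:
  assumes B: "B \<subseteq> I" "i \<in> I" "i \<notin> B" and cut: "u i \<notin> cell_span B c" "slice B c i 0 \<noteq> {}"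
  obtains g0 where "max_face g0 \<in> slice B c i 0" "flat I u g0 = cell_span (insert i B) (c(i := 0))"
    "max_face g0 \<in> cells B c" "dim (flat I u g0) = dim (cell_span B c) + 1" "u i \<in> flat I u g0"
proof -
  have iB: "insert i B \<subseteq> I" using B by blast
  obtain g0 where g0: "max_face g0 \<in> slice B c i 0" "flat I u g0 = cell_span (insert i B) (c(i := 0))"
    using top_cell_exists[OF iB cut(2)] .
  have "dim (flat I u g0) = dim (insert (u i) (cell_span B c))"
    unfolding g0(2) cell_span_slice(2)[OF B(3)] by simp
  also have "\<dots> = dim (cell_span B c) + 1" using cut(1) subspace_cell_span
    by (simp add: dim_insert span_eq_iff[THEN iffD2])
  finally have d: "dim (flat I u g0) = dim (cell_span B c) + 1" .
  have "u i \<in> flat I u g0" unfolding g0(2) cell_span_slice(2)[OF B(3)] by (intro span_base) auto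
  moreover have "max_face g0 \<in> cells B c" using g0(1) slice_subset[OF B] by blast
  ultimately show ?thesis using that g0 d by blast
qed

text \<open>The lowest cohomology of a region is one copy of the coefficients, because the region is
  connected: each half has a constant cocycle by induction, and a single cell of the wall ties the
  two constants together. Constancy is meant up to the change of frame.\<close>

lemma top_cocycle_constant:
  fixes z :: "'u set \<Rightarrow> 'g::ab_group_add"
  assumes "B \<subseteq> I"
    and "\<And>F. F \<in> cells B c \<Longrightarrow> aff_dim F = int (dim (cell_span B c)) + 1 \<Longrightarrow> cell_diff (cells B c) z F = 0"
    and "max_face g \<in> cells B c" "flat I u g = cell_span B c"
    and "max_face g' \<in> cells B c" "flat I u g' = cell_span B c"
  shows "z (max_face g) = signed (frame_det (frame_of g) (frame_of g')) (z (max_face g'))"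
  using assms
proof (induction "card (I - B)" arbitrary: B c g g')
  case 0
  then have "B = I" using finite_index by auto
  then have "max_face g = max_face g'" using 0(4,6) by (simp add: max_face_in_cells max_face_eq_iff)
  then show ?case by (simp add: frame_det_self frame_ori signed_def)
next
  case (Suc n)
  then obtain i where i: "i \<in> I" "i \<notin> B" by (metis Diff_iff card.empty ex_in_conv nat.distinct(1))
  note B = Suc.prems(1) i
  have iB: "insert i B \<subseteq> I" using B by blast
  have "I - insert i B = (I - B) - {i}" by blast
  then have n: "n = card (I - insert i B)" using Suc.hyps(2) i finite_index by simp
  let ?K = "cells B c" and ?S = "cell_span B c"
  define R where "R h h' \<longleftrightarrow> z (max_face h) = signed (frame_det (frame_of h) (frame_of h')) (z (max_face h'))" for h h'
  have R_trans: "R h h''" if "R h h'" "R h' h''" "flat I u h = ?S" "flat I u h' = ?S" "flat I u h'' = ?S" for h h' h''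
    using that frame_det_ori_trans[of h h' h''] frame_det_ori_nonzero[of h h'] frame_det_ori_nonzero[of h' h'']
    unfolding R_def by (simp add: signed_mult)
  have R_sym: "R h' h" if "R h h'" "flat I u h = ?S" "flat I u h' = ?S" for h h'
  proof -
    have "frame_det (frame_of h) (frame_of h') * frame_det (frame_of h') (frame_of h) = 1"
      using frame_det_ori_trans[of h h' h] that frame_det_self[OF frame_ori[of h]] by simp
    then have "signed (frame_det (frame_of h') (frame_of h)) x = signed (frame_det (frame_of h) (frame_of h')) x" for x :: 'g
      by (auto simp: signed_def) (metis less_numeral_extra(1) zero_less_mult_pos zero_less_mult_pos2)+
    then show ?thesis using that(1) unfolding R_def by (metis signed_signed)
  qed
  have "?K \<noteq> {}" using Suc.prems(3) by blast
  then consider (uncut) s where "?K = slice B c i s" "cell_span (insert i B) (c(i := s)) = ?S"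
    | (cut) "u i \<notin> ?S" "slice B c i 0 \<noteq> {}"
    using slice_trichotomy[OF B] by metis
  then have "R g g'"
  proof cases
    case uncut
    show ?thesis unfolding R_def
      by (rule Suc.hyps(1)[OF n iB]) (use Suc.prems uncut in auto)
  next
    case cut
    have R_slice: "R h h'" if "max_face h \<in> slice B c i s" "max_face h' \<in> slice B c i s" "s \<noteq> 0"
        "flat I u h = ?S" "flat I u h' = ?S" for h h' s
    proof -
      have "cell_span (insert i B) (c(i := s)) = ?S" using cell_span_slice(1)[OF B(3)] that(3) by simp
      moreover have "cell_diff (slice B c i s) z F = 0"
        if "F \<in> slice B c i s" "aff_dim F = int (dim ?S) + 1" for F
        using that Suc.prems(2)[of F] cell_diff_slice[OF B that(1) \<open>s \<noteq> 0\<close>, of z]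
          slice_subset[OF B, of c s] by auto
      ultimately show ?thesis unfolding R_def by (intro Suc.hyps(1)[OF n iB]) (use that in auto)
    qed
    obtain g0 where g0: "max_face g0 \<in> slice B c i 0" "flat I u g0 = cell_span (insert i B) (c(i := 0))"
      "max_face g0 \<in> ?K" "dim (flat I u g0) = dim ?S + 1" "u i \<in> flat I u g0"
      using cut_slices_nonempty[OF B cut] .
    obtain g1 g2 where g12: "max_face g1 \<in> ?K" "max_face g2 \<in> ?K"
      "flat I u g1 = ?S" "flat I u g2 = ?S" "g1 \<bullet> u i > 0" "g2 \<bullet> u i < 0"
      "max_face g1 \<subseteq> max_face g0" "max_face g2 \<subseteq> max_face g0"
      and diff: "cell_diff ?K z (max_face g0) =
        signed (frame_det (u i # frame_of g1) (frame_of g0)) (z (max_face g1))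
        - signed (frame_det (u i # frame_of g2) (frame_of g0)) (z (max_face g2))"
      by (rule wall_facets[OF B(1) g0(3,4,5) cut(1), of z], rule that)
    have s1: "max_face g1 \<in> slice B c i 1" and s2: "max_face g2 \<in> slice B c i (-1)"
      using g12 by (simp_all add: slice_iff[OF B])
    have d: "dim (flat I u g0) = dim (flat I u g2) + 1" using g0(4) g12(4) by simp
    \<comment> \<open>The cocycle condition at this one cell of the wall relates its neighbours on
      the two sides.\<close>
    have "cell_diff ?K z (max_face g0) = 0" using Suc.prems(2)[OF g0(3)] g0(4) by (simp add: aff_dim_max_face)
    then have e: "signed (frame_det (u i # frame_of g1) (frame_of g0)) (z (max_face g1))
        = signed (frame_det (u i # frame_of g2) (frame_of g0)) (z (max_face g2))"
      using diff by simp
    let ?D2 = "frame_det (u i # frame_of g2) (frame_of g0)"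
    have "g2 \<bullet> u i \<noteq> 0" using g12(6) by simp
    note nz2 = this
    have D2: "?D2 \<noteq> 0" by (rule incidence_det_nonzero[OF g12(8) d g0(5) nz2])
    have g1g2: "flat I u g1 = flat I u g2" using g12(3,4) by simp
    have "frame_det (u i # frame_of g1) (frame_of g0)
      = frame_det (frame_of g1) (frame_of g2) * ?D2"
      by (rule frame_det_Cons_ori_change[OF g12(8) d g0(5) nz2 g1g2])
    then have R12: "R g1 g2" using e unfolding R_def
      by (intro signed_cancel[OF frame_det_ori_nonzero[OF g1g2] D2]) (simp only:)
    have slices: "\<exists>s. s \<in> {1, -1} \<and> max_face h \<in> slice B c i s" if "max_face h \<in> ?K" "flat I u h = ?S" for h
    proof -
      have "h \<bullet> u i \<noteq> 0"
      proof
        assume "h \<bullet> u i = 0"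
        then have "u i \<in> flat I u h" unfolding flat_def by (intro span_base) (use i in auto)
        then show False using that(2) cut(1) by simp
      qed
      then have "sgn (h \<bullet> u i) \<in> {1, -1}" by (simp add: sgn_if)
      moreover have "max_face h \<in> slice B c i (sgn (h \<bullet> u i))" using that(1) slice_iff[OF B] by simp
      ultimately show ?thesis by blast
    qed
    have to1: "R h g1" if h: "max_face h \<in> ?K" "flat I u h = ?S" for h
    proof -
      obtain s where s: "s \<in> {1, -1}" "max_face h \<in> slice B c i s" using slices[OF h] by blast
      show ?thesis
      proof (cases "s = 1")
        case True
        then show ?thesis using R_slice[OF s(2)] s1 h(2) g12(3) by simp
      next
        case False
        then have "R h g2" using R_slice[OF s(2)] s s2 h(2) g12(4) by simp
        then show ?thesis using R_trans R_sym[OF R12] h(2) g12(3,4) by blast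
      qed
    qed
    show ?thesis using R_trans to1[of g] R_sym[OF to1[of g']] Suc.prems g12(3) by blast
  qed
  then show ?case by (simp add: R_def)
qed

lemma cell_diff_cong:
  assumes "\<And>F'. F' \<in> cell_facets K F \<Longrightarrow> z F' = w F'"
  shows "cell_diff K z F = cell_diff K w F"
  unfolding cell_diff_def using assms by (intro sum.cong) auto

lemma cell_diff_in:
  "diff_closed G \<Longrightarrow> (\<And>F'. F' \<in> cell_facets K F \<Longrightarrow> z F' \<in> G) \<Longrightarrow> cell_diff K z F \<in> G"
  unfolding cell_diff_def by (intro diff_closed_sum diff_closed_incidence_map)

text \<open>Vanishing of the cohomology above the lowest degree, which is governed by
  \<open>top_cocycle_constant\<close>. The solution is required to take values in \<open>G\<close>
  on all sets, so that solutions on different parts can be combined freely.\<close>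

lemma cocycle_is_coboundary:
  fixes z :: "'u set \<Rightarrow> 'g::ab_group_add"
  assumes G: "diff_closed G" and "B \<subseteq> I" "j > int (dim (cell_span B c))"
    and "\<And>F. F \<in> cells B c \<Longrightarrow> aff_dim F = j \<Longrightarrow> z F \<in> G"
    and "\<And>F. F \<in> cells B c \<Longrightarrow> aff_dim F = j + 1 \<Longrightarrow> cell_diff (cells B c) z F = 0"
  shows "\<exists>w. (\<forall>F. w F \<in> G) \<and> (\<forall>F\<in>cells B c. aff_dim F = j \<longrightarrow> cell_diff (cells B c) w F = z F)"
  using assms(2-)
proof (induction "card (I - B)" arbitrary: B c z)
  case 0
  then have "B = I" using finite_index by auto
  \<comment> \<open>With a condition on every hyperplane at most one cell remains; its face has the
    dimension of \<open>cell_span B c\<close>, which is less than \<open>j\<close>.\<close>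
  have "aff_dim F \<noteq> j" if "F \<in> cells B c" for F
  proof -
    obtain g where g: "F = max_face g" "max_face g \<in> cells B c" using \<open>F \<in> cells B c\<close> by (auto simp: cells_def)
    have "\<forall>i\<in>B. sgn (g \<bullet> u i) = c i" using g(2) max_face_in_cells[OF 0(2)] by simp
    then have "g \<bullet> u i = 0 \<longleftrightarrow> c i = 0" if "i \<in> B" for i using that by (metis sgn_zero_iff)
    then have "{i \<in> I. g \<bullet> u i = 0} = {i \<in> B. c i = 0}" unfolding \<open>B = I\<close> by blast
    then have "flat I u g = cell_span B c" by (simp add: flat_def cell_span_def)
    then show ?thesis using 0(3) g(1) by (simp add: aff_dim_max_face)
  qed
  then show ?case using diff_closed_zero[OF G] by (intro exI[of _ "\<lambda>_. 0"]) auto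
next
  case (Suc n)
  then obtain i where i: "i \<in> I" "i \<notin> B" by (metis Diff_iff card.empty ex_in_conv nat.distinct(1))
  note B = Suc.prems(1) i
  have iB: "insert i B \<subseteq> I" using B by blast
  have "I - insert i B = (I - B) - {i}" by blast
  then have n: "n = card (I - insert i B)" using Suc.hyps(2) i finite_index by simp
  let ?K = "cells B c" and ?S = "cell_span B c"
  show ?case
  proof (cases "?K = {}")
    case True
    then show ?thesis using diff_closed_zero[OF G] by (intro exI[of _ "\<lambda>_. 0"]) auto
  next
    case False
    then consider (uncut) s where "?K = slice B c i s" "cell_span (insert i B) (c(i := s)) = ?S"
      | (cut) "u i \<notin> ?S" "slice B c i 0 \<noteq> {}"
      using slice_trichotomy[OF B] by metis
    then show ?thesis
    proof cases
      case uncut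
      show ?thesis unfolding uncut(1)
        by (rule Suc.hyps(1)[OF n iB]) (use Suc.prems uncut in auto)
    next
      case cut
      have side: "\<exists>w. (\<forall>F. w F \<in> G) \<and> (\<forall>F\<in>slice B c i s. aff_dim F = j \<longrightarrow> cell_diff (slice B c i s) w F = z F)"
        if s: "s \<noteq> 0" for s
      proof (rule Suc.hyps(1)[OF n iB])
        show "int (dim (cell_span (insert i B) (c(i := s)))) < j"
          using Suc.prems(2) cell_span_slice(1)[OF B(3) s] by simp
        show "z F \<in> G" if "F \<in> slice B c i s" "aff_dim F = j" for F
          using Suc.prems(3) that slice_subset[OF B, of c s] by blast
        show "cell_diff (slice B c i s) z F = 0" if "F \<in> slice B c i s" "aff_dim F = j + 1" for F
          using Suc.prems(4)[of F] that slice_subset[OF B, of c s] cell_diff_slice[OF B that(1) s, of z] by auto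
      qed
      obtain wp where wp: "\<And>F. wp F \<in> G"
        "\<And>F. F \<in> slice B c i 1 \<Longrightarrow> aff_dim F = j \<Longrightarrow> cell_diff (slice B c i 1) wp F = z F"
        using side[of 1] by auto
      obtain wm where wm: "\<And>F. wm F \<in> G"
        "\<And>F. F \<in> slice B c i (-1) \<Longrightarrow> aff_dim F = j \<Longrightarrow> cell_diff (slice B c i (-1)) wm F = z F"
        using side[of "-1"] by auto
      \<comment> \<open>No compatibility between the two solutions is needed: facets of a face in
        one half stay in that half. The value on the wall is set to 0.\<close>
      define w1 where "w1 F = (if F \<in> slice B c i 1 then wp F else if F \<in> slice B c i (-1) then wm F else 0)" for F
      have w1G: "w1 F \<in> G" for F using wp(1) wm(1) diff_closed_zero[OF G] by (simp add: w1_def)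
      have w1p: "cell_diff ?K w1 F = z F" if "F \<in> slice B c i 1" "aff_dim F = j" for F
      proof -
        have "cell_diff ?K w1 F = cell_diff (slice B c i 1) w1 F" by (rule cell_diff_slice[OF B that(1)]) simp
        also have "\<dots> = cell_diff (slice B c i 1) wp F"
          by (rule cell_diff_cong) (simp add: cell_facets_def w1_def)
        finally show ?thesis using wp(2)[OF that] by simp
      qed
      have w1m: "cell_diff ?K w1 F = z F" if "F \<in> slice B c i (-1)" "aff_dim F = j" for F
      proof -
        have "cell_diff ?K w1 F = cell_diff (slice B c i (-1)) w1 F" by (rule cell_diff_slice[OF B that(1)]) simp
        also have "\<dots> = cell_diff (slice B c i (-1)) wm F"
          using slice_disjoint[OF B, of _ c 1 "-1"]
          by (intro cell_diff_cong) (auto simp: cell_facets_def w1_def)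
        finally show ?thesis using wm(2)[OF that] by simp
      qed
      \<comment> \<open>The remaining cocycle vanishes in degree \<open>j\<close> on both halves, so
        it lives on the wall.\<close>
      define z' where "z' F = z F - cell_diff ?K w1 F" for F
      have z'0: "z' F = 0" if "F \<in> slice B c i s" "s \<in> {1, -1}" "aff_dim F = j" for F s
        using that w1p w1m by (auto simp: z'_def)
      have z'G: "z' F \<in> G" if "F \<in> ?K" "aff_dim F = j" for F
        unfolding z'_def by (intro diff_closed_diff[OF G] Suc.prems(3) that cell_diff_in[OF G] w1G)
      have z'cocycle: "cell_diff ?K z' F = 0" if "F \<in> ?K" "aff_dim F = j + 1" for F
        unfolding z'_def cell_diff_diff using Suc.prems(4)[OF that] cell_diff_twice[OF B(1) that(1)] by simp
      \<comment> \<open>On the wall the differential of the region agrees with that of the wall only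
        for cochains that vanish on the neighbouring facets in the halves.\<close>
      have restrict0: "cell_diff ?K y F = cell_diff (slice B c i 0) y F"
        if "F \<in> slice B c i 0" "\<And>F' s. F' \<in> cell_facets ?K F \<Longrightarrow> F' \<in> slice B c i s \<Longrightarrow> s \<in> {1, -1} \<Longrightarrow> y F' = 0" for y F
      proof -
        have "cell_facets (slice B c i 0) F \<subseteq> cell_facets ?K F"
          using slice_subset[OF B, of c 0] by (auto simp: cell_facets_def)
        moreover have "y F' = 0" if F': "F' \<in> cell_facets ?K F - cell_facets (slice B c i 0) F" for F'
        proof -
          have K: "F' \<in> ?K" and n: "F' \<notin> slice B c i 0" using F' by (auto simp: cell_facets_def)
          show ?thesis by (rule slice_cases[OF B K]) (use F' n \<open>\<And>F' s. F' \<in> cell_facets ?K F \<Longrightarrow> F' \<in> slice B c i s \<Longrightarrow> s \<in> {1, -1} \<Longrightarrow> y F' = 0\<close> in auto)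
        qed
        ultimately show ?thesis unfolding cell_diff_def
          by (intro sum.mono_neutral_right finite_cell_facets finite_cells) auto
      qed
      have z'cocycle0: "cell_diff (slice B c i 0) z' F = 0" if "F \<in> slice B c i 0" "aff_dim F = j + 1" for F
      proof -
        have "cell_diff ?K z' F = cell_diff (slice B c i 0) z' F"
          by (rule restrict0[OF that(1)]) (use that(2) z'0 in \<open>auto simp: cell_facets_def\<close>)
        then show ?thesis using z'cocycle[of F] that slice_subset[OF B, of c 0] by auto
      qed
      obtain g0 where g0: "max_face g0 \<in> slice B c i 0" "flat I u g0 = cell_span (insert i B) (c(i := 0))"
        "max_face g0 \<in> ?K" "dim (flat I u g0) = dim ?S + 1" "u i \<in> flat I u g0"
        using cut_slices_nonempty[OF B cut] .
      have dim0: "dim (cell_span (insert i B) (c(i := 0))) = dim ?S + 1" using g0(2,4) by simp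
      have "\<exists>w0. (\<forall>F. w0 F \<in> G) \<and> (\<forall>F\<in>?K. aff_dim F = j \<longrightarrow> cell_diff ?K w0 F = z' F)"
      \<comment> \<open>The wall has span of dimension \<open>dim ?S + 1\<close>. The induction
        hypothesis covers it unless \<open>j\<close> is exactly this value, the lowest degree on the
        wall.\<close>
      proof (cases "j = int (dim ?S) + 1")
        case False
        then have j: "int (dim (cell_span (insert i B) (c(i := 0)))) < j" using Suc.prems(2) dim0 by simp
        have "\<exists>w. (\<forall>F. w F \<in> G) \<and> (\<forall>F\<in>slice B c i 0. aff_dim F = j \<longrightarrow> cell_diff (slice B c i 0) w F = z' F)"
          by (rule Suc.hyps(1)[OF n iB j]) (use z'G z'cocycle0 slice_subset[OF B, of c 0] in auto)
        then obtain y where y: "\<And>F. y F \<in> G"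
          "\<And>F. F \<in> slice B c i 0 \<Longrightarrow> aff_dim F = j \<Longrightarrow> cell_diff (slice B c i 0) y F = z' F" by blast
        define w0 where "w0 F = (if F \<in> slice B c i 0 then y F else 0)" for F
        have w0s: "w0 F = 0" if "F \<in> slice B c i s" "s \<in> {1, -1}" for F s
          using slice_disjoint[OF B that(1), of 0] that(2) by (auto simp: w0_def)
        have "cell_diff ?K w0 F = z' F" if F: "F \<in> ?K" "aff_dim F = j" for F
        proof -
          have pm: ?thesis if s: "F \<in> slice B c i s" "s \<in> {1, -1}" for s
          proof -
            have "s \<noteq> 0" using s(2) by auto
            have "cell_diff (slice B c i s) w0 F = cell_diff (slice B c i s) (\<lambda>_. 0) F"
              by (rule cell_diff_cong) (use w0s s(2) in \<open>auto simp: cell_facets_def\<close>)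
            then have "cell_diff ?K w0 F = 0"
              using cell_diff_slice[OF B s(1) \<open>s \<noteq> 0\<close>, of w0] by (simp add: cell_diff_def)
            then show ?thesis using z'0[OF s F(2)] by simp
          qed
          have zero: ?thesis if F0: "F \<in> slice B c i 0"
          proof -
            have "cell_diff ?K w0 F = cell_diff (slice B c i 0) w0 F"
              by (rule restrict0[OF F0]) (use w0s in auto)
            also have "\<dots> = cell_diff (slice B c i 0) y F"
              by (rule cell_diff_cong) (simp add: cell_facets_def w0_def)
            finally show ?thesis using y(2)[OF F0 F(2)] by simp
          qed
          show ?thesis by (rule slice_cases[OF B F(1)]) (use pm zero in auto)
        qed
        then show ?thesis using y(1) diff_closed_zero[OF G] by (intro exI[of _ w0]) (auto simp: w0_def)
      next
        case True
        let ?F0 = "max_face g0"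
        \<comment> \<open>The fundamental class of the positive part, oriented along the wall.\<close>
        define w0 where "w0 F = (if F \<in> slice B c i 1 \<and> aff_dim F = j - 1
          then signed (frame_det (u i # ori F) (ori ?F0)) (z' ?F0) else 0)" for F
        have w0G: "w0 F \<in> G" for F
          using diff_closed_signed[OF G z'G[OF g0(3)]] diff_closed_zero[OF G] g0(4) True by (simp add: w0_def aff_dim_max_face)
        have Fd: "dim (flat I u g) = dim ?S + 1" if "aff_dim (max_face g) = j" for g
          using that True by (simp add: aff_dim_max_face)
        have w0m: "w0 F = 0" if "F \<in> slice B c i (-1)" for F
          using slice_disjoint[OF B that, of 1] by (auto simp: w0_def)
        have "cell_diff ?K w0 F = z' F" if F: "F \<in> ?K" "aff_dim F = j" for F
        proof -
          obtain g where g: "F = max_face g" using F(1) by (auto simp: cells_def)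
          have gK: "max_face g \<in> ?K" and gd: "dim (flat I u g) = dim ?S + 1" using F Fd g by auto
          have zero: ?thesis if F0: "F \<in> slice B c i 0"
          proof -
            have flat: "flat I u g = flat I u g0"
            proof -
              have "cell_span (insert i B) (c(i := 0)) \<subseteq> flat I u g"
                using cell_span_subset[OF iB F0] by (simp add: g direction_space_max_face)
              then have "cell_span (insert i B) (c(i := 0)) = flat I u g"
                by (intro subspace_dim_equal subspace_cell_span subspace_flat) (simp_all add: gd dim0)
              then show ?thesis using g0(2) by simp
            qed
            then have ug: "u i \<in> flat I u g" using g0(5) by simp
            obtain g1 g2 where g12: "max_face g1 \<in> ?K" "max_face g2 \<in> ?K"
              "flat I u g1 = ?S" "flat I u g2 = ?S" "g1 \<bullet> u i > 0" "g2 \<bullet> u i < 0"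
              "max_face g1 \<subseteq> max_face g" "max_face g2 \<subseteq> max_face g"
              and diff: "cell_diff ?K w0 (max_face g) =
                signed (frame_det (u i # frame_of g1) (frame_of g)) (w0 (max_face g1))
                - signed (frame_det (u i # frame_of g2) (frame_of g)) (w0 (max_face g2))"
              by (rule wall_facets[OF B(1) gK gd ug cut(1), of w0], rule that)
            have s1: "max_face g1 \<in> slice B c i 1" and s2: "max_face g2 \<in> slice B c i (-1)"
              using g12 by (simp_all add: slice_iff[OF B])
            have d: "dim (flat I u g) = dim (flat I u g1) + 1" using gd g12(3) by simp
            have nz: "g1 \<bullet> u i \<noteq> 0" using g12(5) by simp
            let ?D1 = "frame_det (u i # frame_of g1) (frame_of g)"
            let ?D = "frame_det (frame_of g) (ori ?F0)"
            have D1: "?D1 \<noteq> 0" by (rule incidence_det_nonzero[OF g12(7) d ug nz])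
            have D: "?D \<noteq> 0" by (rule frame_det_ori_nonzero[OF flat])
            have "w0 (max_face g1) = signed (?D1 * ?D) (z' ?F0)"
              using s1 g12(3) True frame_det_Cons_ori_trans[OF g12(7) d ug nz flat]
              by (simp add: w0_def aff_dim_max_face)
            \<comment> \<open>Only the positive neighbour contributes. Its factor \<open>?D1\<close>
              occurs both in the differential and in \<open>w0\<close> and cancels, leaving the
              change of frame between \<open>F\<close> and \<open>?F0\<close>; this is precisely how
              a lowest cocycle on the wall varies.\<close>
            then have "cell_diff ?K w0 F = signed ?D (z' ?F0)"
              unfolding g diff using w0m[OF s2] D D1 by (simp add: signed_mult)
            also have "\<dots> = z' F" unfolding g
            proof (rule top_cocycle_constant[OF iB, symmetric])
              show "cell_diff (slice B c i 0) z' F = 0"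
                if "F \<in> slice B c i 0" "aff_dim F = int (dim (cell_span (insert i B) (c(i := 0)))) + 1" for F
                using z'cocycle0[OF that(1)] that(2) dim0 True by simp
            qed (use F0 g g0 flat in auto)
            finally show ?thesis .
          qed
          have plus: ?thesis if F1: "F \<in> slice B c i 1"
          proof -
            have SV: "?S \<subseteq> flat I u g" using cell_span_subset[OF B(1) gK] by (simp add: direction_space_max_face)
            moreover have "?S \<noteq> flat I u g" using gd by auto
            ultimately obtain v where v: "v \<in> flat I u g" "v \<notin> ?S" by blast
            obtain g1 g2 where g12: "max_face g1 \<in> ?K" "max_face g2 \<in> ?K"
              "flat I u g1 = ?S" "flat I u g2 = ?S" "g1 \<bullet> v > 0" "g2 \<bullet> v < 0"
              "max_face g1 \<subseteq> max_face g" "max_face g2 \<subseteq> max_face g"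
              and diff: "cell_diff ?K w0 (max_face g) =
                signed (frame_det (v # frame_of g1) (frame_of g)) (w0 (max_face g1))
                - signed (frame_det (v # frame_of g2) (frame_of g)) (w0 (max_face g2))"
              by (rule wall_facets[OF B(1) gK gd v, of w0], rule that)
            have s: "max_face g1 \<in> slice B c i 1" "max_face g2 \<in> slice B c i 1"
              using slice_down[OF B F1] g12 g by auto
            \<comment> \<open>\<open>g1\<close> and \<open>g2\<close> need not be faces of
              \<open>?F0\<close>, so their frames extended by \<open>u i\<close> are compared with
              that of \<open>?F0\<close> through a cell \<open>h1\<close> that is.\<close>
            obtain h1 where h1: "max_face h1 \<in> ?K" "flat I u h1 = ?S" "h1 \<bullet> u i > 0" "max_face h1 \<subseteq> ?F0"
              by (rule wall[OF B(1) g0(3,4,5) cut(1)], rule that)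
            have d: "dim (flat I u g) = dim (flat I u g1) + 1" using gd g12(3) by simp
            have dh: "dim (flat I u g0) = dim (flat I u h1) + 1" using g0(4) h1(2) by simp
            have nz: "g1 \<bullet> v \<noteq> 0" "h1 \<bullet> u i \<noteq> 0" using g12(5) h1(3) by auto
            let ?D = "frame_det (frame_of g2) (frame_of g1)"
            let ?V1 = "frame_det (v # frame_of g1) (frame_of g)"
            let ?U = "\<lambda>k. frame_det (u i # frame_of k) (ori ?F0)"
            have nonzero: "?V1 \<noteq> 0" "?D \<noteq> 0"
              by (rule incidence_det_nonzero[OF g12(7) d v(1) nz(1)], rule frame_det_ori_nonzero) (simp only: g12(3,4))
            have V2: "frame_det (v # frame_of g2) (frame_of g) = ?D * ?V1"
              by (rule frame_det_Cons_ori_change[OF g12(7) d v(1) nz(1)]) (simp only: g12(3,4))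
            have Uk: "?U k = frame_det (frame_of k) (frame_of h1) * ?U h1" if "flat I u k = ?S" for k
              by (rule frame_det_Cons_ori_change[OF h1(4) dh g0(5) nz(2)]) (simp only: that h1(2))
            have Uh: "?U h1 \<noteq> 0" by (rule incidence_det_nonzero[OF h1(4) dh g0(5) nz(2)])
            have Uk0: "?U k \<noteq> 0" if "flat I u k = ?S" for k
            proof -
              have "frame_det (frame_of k) (frame_of h1) \<noteq> 0"
                by (rule frame_det_ori_nonzero) (simp only: that h1(2))
              then show ?thesis unfolding Uk[OF that] using Uh by simp
            qed
            have U2: "?U g2 = ?D * ?U g1"
            proof -
              have "frame_det (frame_of g2) (frame_of h1)
                = ?D * frame_det (frame_of g1) (frame_of h1)"
                by (rule frame_det_ori_trans) (simp_all only: g12(3,4) h1(2))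
              then show ?thesis unfolding Uk[OF g12(3)] Uk[OF g12(4)] by simp
            qed
            have w0k: "w0 (max_face k) = signed (?U k) (z' ?F0)" if "max_face k \<in> slice B c i 1" "flat I u k = ?S" for k
              using that True by (simp add: w0_def aff_dim_max_face)
            \<comment> \<open>Inside the positive half the class is closed: \<open>?D\<close> enters
              both through the differential and through \<open>w0\<close>, so the two neighbours
              contribute equal terms with opposite signs.\<close>
            have "signed (?D * ?V1) (signed (?D * ?U g1) (z' ?F0)) = signed ?V1 (signed (?U g1) (z' ?F0))"
              using nonzero Uk0[OF g12(3)] by (auto simp: signed_def zero_less_mult_iff)
            then have "cell_diff ?K w0 F = 0"
              unfolding g diff w0k[OF s(1) g12(3)] w0k[OF s(2) g12(4)] V2 U2 by simp
            then show ?thesis using z'0[OF F1 _ F(2)] by simp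
          qed
          have minus: ?thesis if Fm: "F \<in> slice B c i (-1)"
          proof -
            have "cell_diff (slice B c i (-1)) w0 F = cell_diff (slice B c i (-1)) (\<lambda>_. 0) F"
              by (rule cell_diff_cong) (use w0m in \<open>auto simp: cell_facets_def\<close>)
            then have "cell_diff ?K w0 F = 0"
              using cell_diff_slice[OF B Fm, of w0] by (simp add: cell_diff_def)
            then show ?thesis using z'0[OF Fm _ F(2)] by simp
          qed
          show ?thesis by (rule slice_cases[OF B F(1)]) (use plus zero minus in auto)
        qed
        then show ?thesis using w0G by blast
      qed
      then obtain w0 where w0: "\<And>F. w0 F \<in> G" "\<And>F. F \<in> ?K \<Longrightarrow> aff_dim F = j \<Longrightarrow> cell_diff ?K w0 F = z' F" by blast
      have "w1 F + w0 F \<in> G" for F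
      proof -
        have "w1 F - (0 - w0 F) \<in> G" by (intro diff_closed_diff[OF G] diff_closed_zero[OF G] w1G w0(1))
        then show ?thesis by simp
      qed
      moreover have "cell_diff ?K (\<lambda>F. w1 F + w0 F) F = z F" if "F \<in> ?K" "aff_dim F = j" for F
        unfolding cell_diff_add w0(2)[OF that] z'_def by simp
      ultimately show ?thesis by (intro exI[of _ "\<lambda>F. w1 F + w0 F"]) auto
    qed
  qed
qed

end

section \<open>The intersection lattice\<close>

abbreviation riesz :: "'u::euclidean_space \<Rightarrow> 'u dual" where "riesz \<equiv> blinfun_inner_right"

lemma blinfun_euclidean:
  fixes f :: "'u::euclidean_space dual"
  shows "f = riesz (\<Sum>b\<in>Basis. blinfun_apply f b *\<^sub>R b)"
proof (rule blinfun_eqI)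
  fix x :: 'u
  have "blinfun_apply f x = blinfun_apply f (\<Sum>b\<in>Basis. (x \<bullet> b) *\<^sub>R b)" by (simp add: euclidean_representation)
  also have "\<dots> = (\<Sum>b\<in>Basis. (x \<bullet> b) * blinfun_apply f b)"
    by (simp add: blinfun.sum_right blinfun.scaleR_right)
  finally show "blinfun_apply f x = blinfun_apply (riesz (\<Sum>b\<in>Basis. blinfun_apply f b *\<^sub>R b)) x"
    by (simp add: inner_sum_right inner_commute mult.commute)
qed

lemma linear_riesz: "linear (riesz :: 'u::euclidean_space \<Rightarrow> _)"
  using bounded_linear_blinfun_inner_right bounded_linear.linear by blast

lemma inj_riesz: "inj (riesz :: 'u::euclidean_space \<Rightarrow> _)"
proof (rule injI)
  fix x y :: 'u assume "riesz x = riesz y"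
  then have "x \<bullet> z = y \<bullet> z" for z by (metis blinfun_inner_right.rep_eq)
  then show "x = y" by (metis vector_eq_ldot inner_commute)
qed

lemma riesz_image_vimage: "riesz ` (riesz -` S) = (S :: 'u::euclidean_space dual set)"
  using blinfun_euclidean by (intro image_vimage_eq[THEN trans]) blast

lemma dim_riesz_vimage:
  fixes S :: "'u::euclidean_space dual set"
  shows "dim (riesz -` S) = dim S"
proof -
  have "dim (riesz ` (riesz -` S)) = dim (riesz -` S)"
    by (rule eucl.dim_image_eq[OF linear_riesz]) (rule inj_on_subset[OF inj_riesz subset_UNIV])
  then show ?thesis by (simp only: riesz_image_vimage)
qed

lemma dim_dual: "dim (UNIV :: 'u::euclidean_space dual set) = DIM('u)"
  using dim_riesz_vimage[of "UNIV :: 'u dual set"] by simp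

definition forms_vanishing :: "'u::euclidean_space set \<Rightarrow> 'u dual set" where
  "forms_vanishing W = {f. \<forall>w\<in>W. blinfun_apply f w = 0}"

lemma forms_vanishing_span: "forms_vanishing (span W) = forms_vanishing W"
proof
  show "forms_vanishing W \<subseteq> forms_vanishing (span W)"
  proof
    fix f assume f: "f \<in> forms_vanishing W"
    have "blinfun_apply f w = 0" if "w \<in> span W" for w
      using linear_eq_0_on_span[OF blinfun.bounded_linear_right[THEN bounded_linear.linear], of W f w] f that by (simp add: forms_vanishing_def)
    then show "f \<in> forms_vanishing (span W)" by (simp add: forms_vanishing_def)
  qed
qed (auto simp: forms_vanishing_def span_base)

lemma riesz_in_forms_vanishing: "riesz g \<in> forms_vanishing W \<longleftrightarrow> (\<forall>w\<in>W. g \<bullet> w = 0)"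
  by (simp add: forms_vanishing_def)

lemma dim_forms_vanishing:
  fixes W :: "'u::euclidean_space set"
  shows "dim (forms_vanishing W) + dim W = DIM('u)"
proof -
  have "riesz -` forms_vanishing (span W) = {y \<in> UNIV. \<forall>x\<in>span W. real_inner_class.orthogonal x y}"
    by (auto simp: riesz_in_forms_vanishing real_inner_class.orthogonal_def inner_commute)
  then have "dim (forms_vanishing (span W)) + dim (span W) = dim (UNIV :: 'u set)"
    using dim_subspace_orthogonal_to_vectors[of "span W" UNIV] dim_riesz_vimage[of "forms_vanishing (span W)"] by simp
  then show ?thesis by (simp add: forms_vanishing_span)
qed

lemma rk_forms_vanishing: "rk (forms_vanishing W) = dim W"
  unfolding rk_def dim_dual using dim_forms_vanishing[of W] by simp

text \<open>The double annihilator: a vector outside the span is separated from it by a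
  form.\<close>

lemma in_span_of_forms_vanishing:
  assumes "forms_vanishing W \<subseteq> forms_vanishing {v}"
  shows "v \<in> span W"
proof (rule ccontr)
  assume "v \<notin> span W"
  then obtain h where h: "\<And>y. y \<in> span W \<Longrightarrow> h \<bullet> y = 0" "h \<bullet> v > 0"
    using separate_from_subspace[OF subspace_span] by metis
  have "riesz h \<in> forms_vanishing W" using h(1) span_base[of _ W] by (simp add: riesz_in_forms_vanishing)
  then have "h \<bullet> v = 0" using assms riesz_in_forms_vanishing[of h "{v}"] by auto
  then show False using h(2) by simp
qed

text \<open>One inclusion is the choice of \<open>v\<close>, and the dimensions agree. Hyperplanes
  are thereby recovered from their normals, so that ranks become dimensions of spans.\<close>

lemma hyperplane_eq_forms_vanishing:
  assumes "linear_hyperplane H" "v \<in> annihilator H" "v \<noteq> 0"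
  shows "H = forms_vanishing {v}"
proof -
  let ?R = "riesz :: 'a \<Rightarrow> 'a dual"
  have sub: "H \<subseteq> forms_vanishing {v}" using assms(2) by (auto simp: annihilator_def forms_vanishing_def)
  have "subspace (?R -` H)" using assms(1) linear_riesz linear_hyperplane_def by (metis linear_subspace_vimage)
  moreover have "subspace (?R -` forms_vanishing {v})"
    by (auto simp: subspace_def riesz_in_forms_vanishing inner_add_left)
  moreover have "?R -` H \<subseteq> ?R -` forms_vanishing {v}" using sub by blast
  moreover have "dim (forms_vanishing {v}) + 1 = dim (UNIV :: 'a dual set)"
    using dim_forms_vanishing[of "{v}"] assms(3) by (simp add: dim_dual)
  then have "dim (?R -` forms_vanishing {v}) \<le> dim (?R -` H)"
    using assms(1) unfolding dim_riesz_vimage linear_hyperplane_def by simp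
  ultimately have "?R -` H = ?R -` forms_vanishing {v}" by (rule subspace_dim_equal)
  then show ?thesis using riesz_image_vimage by metis
qed

section \<open>Ranks, atoms and face types\<close>

locale arrangement = oriented_zonotope \<H> u Z ori + atomic_datum scale \<H> M
  for \<H> :: "'u::euclidean_space dual set set" and u :: "'u dual set \<Rightarrow> 'u" and Z :: "'u set"
    and ori :: "'u set \<Rightarrow> 'u list" and scale :: "'r::{ring,monoid_mult} \<Rightarrow> 'm::ab_group_add \<Rightarrow> 'm"
    and M :: "'u dual set \<Rightarrow> 'm set" +
  assumes hyperplane: "H \<in> \<H> \<Longrightarrow> linear_hyperplane H"
    and normal: "H \<in> \<H> \<Longrightarrow> u H \<in> annihilator H" "H \<in> \<H> \<Longrightarrow> u H \<noteq> 0"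
begin

lemma hyperplane_eq: "H \<in> \<H> \<Longrightarrow> H = forms_vanishing {u H}"
  using hyperplane_eq_forms_vanishing hyperplane normal by blast

text \<open>For \<open>y\<close> in the lattice this is the largest set of hyperplanes with
  intersection \<open>y\<close>, that is, a flat of the matroid of normals
  (\<open>in_span_containing\<close>).\<close>

definition containing :: "'u dual set \<Rightarrow> 'u dual set set" where
  "containing y = {H \<in> \<H>. y \<subseteq> H}"

abbreviation "L \<equiv> intersection_lattice \<H>"

lemma containing_subset: "containing y \<subseteq> \<H>"
  by (auto simp: containing_def)

lemma lattice_eq_Inter: "y \<in> L \<Longrightarrow> y = \<Inter>(containing y)"
  by (auto simp: intersection_lattice_def containing_def)

lemma Inter_eq_forms_vanishing: "S \<subseteq> \<H> \<Longrightarrow> \<Inter>S = forms_vanishing (u ` S)"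
  using hyperplane_eq by (auto simp: forms_vanishing_def)

lemma lattice_eq_forms_vanishing: "y \<in> L \<Longrightarrow> y = forms_vanishing (u ` containing y)"
  using lattice_eq_Inter Inter_eq_forms_vanishing[OF containing_subset] by metis

lemma rk_lattice: "y \<in> L \<Longrightarrow> rk y = dim (u ` containing y)"
  using lattice_eq_forms_vanishing rk_forms_vanishing by metis

lemma in_span_containing:
  assumes "y \<in> L" "H \<in> \<H>" "u H \<in> span (u ` containing y)"
  shows "y \<subseteq> H"
proof -
  have "y \<subseteq> forms_vanishing (span (u ` containing y))"
    using lattice_eq_forms_vanishing[OF assms(1)] by (simp add: forms_vanishing_span)
  then show ?thesis using hyperplane_eq[OF assms(2)] assms(3) by (auto simp: forms_vanishing_def)
qed

lemma lattice_UNIV: "UNIV \<in> L"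
  unfolding intersection_lattice_def by (intro CollectI exI[of _ "{}"]) auto

lemma lattice_Int: "x \<in> L \<Longrightarrow> H \<in> \<H> \<Longrightarrow> x \<inter> H \<in> L"
proof -
  assume "x \<in> L" and H: "H \<in> \<H>"
  then obtain S where "S \<subseteq> \<H>" "x = \<Inter>S" by (auto simp: intersection_lattice_def)
  then show "x \<inter> H \<in> L" using H unfolding intersection_lattice_def
    by (intro CollectI exI[of _ "insert H S"]) auto
qed

lemma atom_in_lattice: "H \<in> \<H> \<Longrightarrow> H \<in> L"
  using lattice_Int[OF lattice_UNIV] by simp

lemma rk_atom: "H \<in> \<H> \<Longrightarrow> rk H = 1"
  using hyperplane[of H] by (auto simp: linear_hyperplane_def rk_def)

lemma rk_UNIV: "rk (UNIV :: 'u dual set) = 0"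
  by (simp add: rk_def)

lemma lattice_neq_UNIV: "y \<in> L \<Longrightarrow> y \<noteq> UNIV \<Longrightarrow> \<exists>H\<in>\<H>. y \<subseteq> H"
  using lattice_eq_Inter[of y] by (auto simp: containing_def)

lemma rk_0: "y \<in> L \<Longrightarrow> rk y = 0 \<Longrightarrow> y = UNIV"
proof (rule ccontr)
  assume y: "y \<in> L" "rk y = 0" "y \<noteq> UNIV"
  then obtain H where "H \<in> containing y" using lattice_neq_UNIV by (auto simp: containing_def)
  then have "u H \<noteq> 0" "u H \<in> u ` containing y" using normal(2) containing_subset by auto
  then show False using y rk_lattice[of y] by (auto simp: dim_eq_0)
qed

lemma rk_1: "y \<in> L \<Longrightarrow> rk y = 1 \<longleftrightarrow> y \<in> \<H>"
proof
  assume y: "y \<in> L" "rk y = 1"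
  then have "y \<noteq> UNIV" using rk_UNIV by auto
  then obtain H where H: "H \<in> \<H>" "y \<subseteq> H" using lattice_neq_UNIV y by blast
  then have uH: "u H \<in> u ` containing y" by (auto simp: containing_def)
  have "span {u H} = span (u ` containing y)"
    using y rk_lattice[of y] uH normal(2)[OF H(1)] by (intro dim_eq_span) auto
  then have "forms_vanishing {u H} = forms_vanishing (u ` containing y)" by (metis forms_vanishing_span)
  then show "y \<in> \<H>" using H hyperplane_eq lattice_eq_forms_vanishing y by metis
qed (rule rk_atom)

lemma atoms_incomparable: "H \<in> \<H> \<Longrightarrow> K \<in> \<H> \<Longrightarrow> H \<subseteq> K \<Longrightarrow> H = K"
proof -
  assume H: "H \<in> \<H>" and K: "K \<in> \<H>" and "H \<subseteq> K"
  then have "u K \<in> span {u H}" using in_span_of_forms_vanishing hyperplane_eq by metis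
  then obtain c where c: "u K = c *\<^sub>R u H" by (auto simp: span_singleton)
  then have "c \<noteq> 0" using normal(2)[OF K] by auto
  then have "forms_vanishing {u K} = forms_vanishing {u H}" by (simp add: c forms_vanishing_def blinfun.scaleR_right)
  then show "H = K" using hyperplane_eq[OF H] hyperplane_eq[OF K] by metis
qed

text \<open>A hyperplane through \<open>x\<close> that does not contain \<open>y\<close> already
  cuts \<open>y\<close> down to \<open>x\<close>, since nothing lies in between; its normal is
  independent of those of the hyperplanes containing \<open>y\<close>.\<close>

lemma rk_covered_by:
  assumes "covered_by \<H> y x"
  shows "rk x = rk y + 1"
proof -
  have y: "y \<in> L" and x: "x \<in> L" and xy: "x \<subset> y" and
    nz: "\<And>z. z \<in> L \<Longrightarrow> x \<subset> z \<Longrightarrow> \<not> z \<subset> y" using assms unfolding covered_by_def by auto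
  have "\<exists>H\<in>containing x. \<not> y \<subseteq> H" using lattice_eq_Inter[OF x] xy by blast
  then obtain H where H: "H \<in> \<H>" "x \<subseteq> H" "\<not> y \<subseteq> H" by (auto simp: containing_def)
  have "y \<inter> H \<in> L" by (rule lattice_Int[OF y H(1)])
  moreover have "y \<inter> H \<subset> y" using H(3) by blast
  ultimately have "x = y \<inter> H" using nz[of "y \<inter> H"] xy H(2) by blast
  also have "\<dots> = forms_vanishing (insert (u H) (u ` containing y))"
    using lattice_eq_forms_vanishing[OF y] hyperplane_eq[OF H(1)] by (auto simp: forms_vanishing_def)
  finally have "rk x = dim (insert (u H) (u ` containing y))" by (simp add: rk_forms_vanishing)
  moreover have "u H \<notin> span (u ` containing y)" using in_span_containing[OF y H(1)] H(3) by blast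
  ultimately show ?thesis using rk_lattice[OF y] by (simp add: dim_insert)
qed

lemma covered_by_UNIV: "covered_by \<H> UNIV x \<longleftrightarrow> x \<in> \<H>"
proof
  assume c: "covered_by \<H> UNIV x"
  then have "x \<in> L" by (simp add: covered_by_def)
  then show "x \<in> \<H>" using rk_covered_by[OF c] rk_1 rk_UNIV by simp
next
  assume x: "x \<in> \<H>"
  have "x \<noteq> UNIV" using rk_atom[OF x] rk_UNIV by auto
  moreover have False if z: "z \<in> L" "x \<subset> z" "z \<subset> UNIV" for z
  proof -
    obtain K where "K \<in> \<H>" "z \<subseteq> K" using lattice_neq_UNIV[of z] z by blast
    then show False using atoms_incomparable[OF x, of K] z by blast
  qed
  ultimately show "covered_by \<H> UNIV x" using atom_in_lattice[OF x] lattice_UNIV by (auto simp: covered_by_def)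
qed

lemma covered_by_atom: "covered_by \<H> y a \<Longrightarrow> a \<in> \<H> \<Longrightarrow> y = UNIV"
  using rk_covered_by[of y a] rk_atom[of a] rk_0[of y] by (auto simp: covered_by_def)

lemma face_type_max_face: "face_type (max_face g) = \<Inter>{H \<in> \<H>. g \<bullet> u H = 0}"
proof -
  have "face_type (max_face g) = forms_vanishing (flat \<H> u g)"
    by (auto simp: face_type_def forms_vanishing_def direction_space_max_face)
  then show ?thesis using Inter_eq_forms_vanishing[of "{H \<in> \<H>. g \<bullet> u H = 0}"]
    by (simp add: flat_def forms_vanishing_span)
qed

lemma face_type_in_lattice: "face_type (max_face g) \<in> L"
  unfolding face_type_max_face intersection_lattice_def by blast

text \<open>The form \<open>riesz g\<close> itself lies in the type, so it must vanish on the normal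
  of every hyperplane that contains the type.\<close>

lemma containing_face_type: "containing (face_type (max_face g)) = {H \<in> \<H>. g \<bullet> u H = 0}"
proof
  show "containing (face_type (max_face g)) \<subseteq> {H \<in> \<H>. g \<bullet> u H = 0}"
  proof
    fix H assume H: "H \<in> containing (face_type (max_face g))"
    have "riesz g \<in> forms_vanishing (u ` {H \<in> \<H>. g \<bullet> u H = 0})"
      by (auto simp: riesz_in_forms_vanishing)
    then have "riesz g \<in> face_type (max_face g)"
      unfolding face_type_max_face using Inter_eq_forms_vanishing[of "{H \<in> \<H>. g \<bullet> u H = 0}"] by simp
    then have "riesz g \<in> forms_vanishing {u H}" using H hyperplane_eq[of H] by (auto simp: containing_def)
    then show "H \<in> {H \<in> \<H>. g \<bullet> u H = 0}" using H by (auto simp: riesz_in_forms_vanishing containing_def)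
  qed
qed (auto simp: containing_def face_type_max_face)

lemma rk_face_type: "rk (face_type (max_face g)) = dim (flat \<H> u g)"
  using rk_lattice[OF face_type_in_lattice] by (simp add: containing_face_type flat_def)

text \<open>Describes a row of the double complex: \<open>N\<close> at \<open>y\<close> occurs below
  the type of a face exactly when the cell of that face lies in the subspace \<open>y\<close>, a
  region all of whose conditions are zero.\<close>

lemma face_type_subset_iff:
  assumes "y \<in> L"
  shows "face_type (max_face g) \<subseteq> y \<longleftrightarrow> max_face g \<in> cells (containing y) (\<lambda>_. 0)"
proof -
  have "max_face g \<in> cells (containing y) (\<lambda>_. 0) \<longleftrightarrow> (\<forall>H\<in>containing y. g \<bullet> u H = 0)"
    by (simp add: max_face_in_cells[OF containing_subset] sgn_zero_iff)
  also have "\<dots> \<longleftrightarrow> containing y \<subseteq> containing (face_type (max_face g))"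
    unfolding containing_face_type using containing_subset by blast
  also have "\<dots> \<longleftrightarrow> face_type (max_face g) \<subseteq> y"
    using lattice_eq_Inter[OF assms] lattice_eq_Inter[OF face_type_in_lattice[of g]]
    by (auto simp: containing_def) blast
  finally show ?thesis by blast
qed

lemma face_type_antimono: "F' \<subseteq> F \<Longrightarrow> face_type F \<subseteq> face_type F'"
  using direction_space_mono[of F' F] by (auto simp: face_type_def)

end

section \<open>The Euler-Poincare complex\<close>

lemma diff_closed_direct_sum:
  assumes "\<And>i. i \<in> S \<Longrightarrow> diff_closed (N i)"
  shows "diff_closed (direct_sum S N)"
  using assms by (auto simp: diff_closed_def direct_sum_def)

lemma additive_map_sum:
  fixes \<phi> :: "'g::ab_group_add \<Rightarrow> 'h::ab_group_add"
  assumes "\<And>x y. \<phi> (x - y) = \<phi> x - \<phi> y"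
  shows "\<phi> (sum h A) = (\<Sum>a\<in>A. \<phi> (h a))"
proof -
  have 0: "\<phi> 0 = 0" using assms[of 0 0] by simp
  have add: "\<phi> (x + y) = \<phi> x + \<phi> y" for x y
    using assms[of x "- y"] assms[of 0 y] 0 by simp
  show ?thesis by (induction A rule: infinite_finite_induct) (simp_all add: 0 add)
qed

lemma additive_map_incidence:
  fixes \<phi> :: "'g::ab_group_add \<Rightarrow> 'h::ab_group_add"
  assumes "\<And>x y. \<phi> (x - y) = \<phi> x - \<phi> y"
  shows "\<phi> (incidence_map ori F' F m) = incidence_map ori F' F (\<phi> m)"
  using assms[of 0 0] assms[of 0 m] by (simp add: incidence_map_def)

lemma EP_differential_eq:
  "EP_differential ori Z m F =
    (if F face_of Z then \<Sum>F'\<in>faces F (aff_dim F - 1). incidence_map ori F' F (m F') else 0)"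
  by (simp add: EP_differential_def incidence_map_def)

text \<open>Serves three maps: the component at \<open>y\<close>, the boundary of the minimal
  complex, and the evaluation of degree 1 chains in the module \<open>M\<close> is drawn
  from.\<close>

lemma EP_differential_additive_map:
  fixes \<phi> :: "'g::ab_group_add \<Rightarrow> 'h::ab_group_add"
  assumes "\<And>x y. \<phi> (x - y) = \<phi> x - \<phi> y"
  shows "\<phi> (EP_differential ori Z m F) = EP_differential ori Z (\<lambda>F. \<phi> (m F)) F"
  unfolding EP_differential_eq using assms[of 0 0]
  by (simp add: additive_map_sum[of \<phi>, OF assms] additive_map_incidence[of \<phi>, OF assms])

lemma EP_differential_diff:
  "EP_differential ori Z (\<lambda>F. m F - n F) F = EP_differential ori Z m F - EP_differential ori Z n F"
  by (simp add: EP_differential_eq incidence_map_diff sum_subtractf)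

lemma facet_face:
  assumes "F face_of Z" "F' \<in> faces F (aff_dim F - 1)"
  shows "F' \<in> faces Z (aff_dim F - 1)" "F' \<subseteq> F"
proof -
  have F': "F' face_of F" "aff_dim F' = aff_dim F - 1" using assms(2) by (simp_all add: faces_def)
  show "F' \<in> faces Z (aff_dim F - 1)" using face_of_trans[OF F'(1) assms(1)] F'(2) by (simp add: faces_def)
  show "F' \<subseteq> F" by (rule face_of_imp_subset[OF F'(1)])
qed

lemma EP_differential_cong:
  assumes "\<And>F'. F' \<in> faces Z (aff_dim F - 1) \<Longrightarrow> F' \<subseteq> F \<Longrightarrow> m F' = n F'"
  shows "EP_differential ori Z m F = EP_differential ori Z n F"
  unfolding EP_differential_eq using assms facet_face[of F Z] by (auto intro!: sum.cong)

lemma EP_differential_in: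
  assumes "diff_closed G" "\<And>F'. F' \<in> faces Z (aff_dim F - 1) \<Longrightarrow> F' \<subseteq> F \<Longrightarrow> m F' \<in> G"
  shows "EP_differential ori Z m F \<in> G"
  unfolding EP_differential_eq using assms diff_closed_zero facet_face[of F Z]
  by (auto intro!: diff_closed_sum diff_closed_incidence_map)

lemma EP_differential_support:
  assumes "\<And>F'. F' \<notin> faces Z k \<Longrightarrow> m F' = 0" "F \<notin> faces Z (k + 1)"
  shows "EP_differential ori Z m F = 0"
proof (cases "F face_of Z")
  case True
  have "m F' = 0" if "F' \<in> faces F (aff_dim F - 1)" for F'
    using that assms(2) True by (intro assms(1)) (auto simp: faces_def)
  then show ?thesis by (simp add: EP_differential_eq)
qed (simp add: EP_differential_eq)

lemma faces_minus_1: "faces F (-1) = {{}}"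
  by (auto simp: faces_def simp flip: aff_dim_empty)

lemma faces_less:
  fixes F :: "'u::euclidean_space set"
  assumes "i < -1"
  shows "faces F i = {}"
proof -
  have "aff_dim F' \<noteq> i" for F' :: "'u set" using aff_dim_geq[of F'] assms by linarith
  then show ?thesis by (simp add: faces_def)
qed

context oriented_zonotope
begin

abbreviation "\<delta> \<equiv> EP_differential ori Z"

abbreviation "all_cells \<equiv> cells {} (\<lambda>_. 0)"

lemma cell_span_empty: "cell_span {} c = {0}"
  by (simp add: cell_span_def)

lemma in_all_cells: "F \<in> all_cells \<longleftrightarrow> F face_of Z \<and> F \<noteq> {}"
  using face_of_Z_iff[of F] by (auto simp: cells_def)

lemma faces_Z_in_all_cells: "F \<in> faces Z k \<Longrightarrow> k \<ge> 0 \<Longrightarrow> F \<in> all_cells"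
  by (auto simp: faces_def in_all_cells)

lemma max_face_of_faces: "F \<in> faces Z k \<Longrightarrow> k \<ge> 0 \<Longrightarrow> \<exists>g. F = max_face g"
  using faces_Z_in_all_cells[of F k] unfolding cells_def by blast

text \<open>The bound on the dimension excludes vertices, whose only facet is the empty face and
  hence not a cell.\<close>

lemma faces_eq_cell_facets:
  assumes "F face_of Z" "aff_dim F \<ge> 1"
  shows "faces F (aff_dim F - 1) = cell_facets all_cells F"
proof
  show "faces F (aff_dim F - 1) \<subseteq> cell_facets all_cells F"
    using facet_face[OF assms(1)] assms(2) by (auto simp: cell_facets_def in_all_cells) (auto simp: faces_def)
  show "cell_facets all_cells F \<subseteq> faces F (aff_dim F - 1)"
  proof
    fix F' assume F': "F' \<in> cell_facets all_cells F"
    then have "F' face_of F" using face_of_subset[of F' Z F] face_of_imp_subset[OF assms(1)]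
      by (simp add: cell_facets_def in_all_cells)
    then show "F' \<in> faces F (aff_dim F - 1)" using F' by (simp add: cell_facets_def faces_def)
  qed
qed

lemma EP_differential_eq_cell_diff:
  assumes "F face_of Z" "aff_dim F \<ge> 1"
  shows "\<delta> m F = cell_diff all_cells m F"
  using assms(1) faces_eq_cell_facets[OF assms] by (simp only: EP_differential_eq cell_diff_def if_True)

lemma EP_differential_vertex:
  assumes "F \<in> faces Z 0"
  shows "\<delta> m F = m {}"
  using assms by (simp add: EP_differential_eq faces_def[of Z] faces_minus_1 incidence_map_def incidence_sign_def)

text \<open>Vertices have empty frames, so both endpoints carry the same determinant, and only the
  opposite sides of the edge distinguish them.\<close>

lemma EP_differential_edge:
  assumes "F \<in> faces Z 1"
  obtains v v' s where "faces F 0 = {v, v'}" "\<delta> m F = signed s (m v - m v')"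
    "v \<in> faces Z 0" "v' \<in> faces Z 0"
proof -
  have F: "F face_of Z" "aff_dim F = 1" using assms by (auto simp: faces_def)
  obtain g where g: "F = max_face g" using max_face_of_faces[OF assms] by auto
  have d: "dim (flat I u g) = dim (cell_span {} (\<lambda>_. 0)) + 1" using F(2) by (simp add: g aff_dim_max_face cell_span_empty)
  have gK: "max_face g \<in> all_cells" using F by (simp add: in_all_cells g max_face_nonempty)
  have "\<not> flat I u g \<subseteq> {0}"
  proof
    assume "flat I u g \<subseteq> {0}"
    then have "dim (flat I u g) = 0" by (simp only: dim_eq_0)
    then show False using d by simp
  qed
  then obtain v where v: "v \<in> flat I u g" "v \<notin> cell_span {} (\<lambda>_. 0)" unfolding cell_span_empty by blast
  obtain g1 g2 where g12: "max_face g1 \<in> all_cells" "max_face g2 \<in> all_cells"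
    "flat I u g1 = cell_span {} (\<lambda>_. 0)" "flat I u g2 = cell_span {} (\<lambda>_. 0)"
    and facets: "cell_facets all_cells (max_face g) = {max_face g1, max_face g2}"
    and diff: "cell_diff all_cells m (max_face g) =
      signed (frame_det (v # frame_of g1) (frame_of g)) (m (max_face g1))
      - signed (frame_det (v # frame_of g2) (frame_of g)) (m (max_face g2))"
    by (rule wall_facets[OF empty_subsetI gK d v, of m], rule that)
  have "frame_of g1 = []" "frame_of g2 = []"
    using length_ori[of g1] length_ori[of g2] g12 by (simp_all add: cell_span_empty)
  then have "\<delta> m F = signed (frame_det [v] (frame_of g)) (m (max_face g1) - m (max_face g2))"
    using diff EP_differential_eq_cell_diff[OF F(1), of m] F(2) by (simp add: g signed_def)
  moreover have "faces F 0 = {max_face g1, max_face g2}"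
    using faces_eq_cell_facets[OF F(1)] F(2) facets by (simp add: g)
  moreover have "max_face g1 \<in> faces Z 0" "max_face g2 \<in> faces Z 0"
    using g12 by (simp_all add: faces_def max_face_face_of aff_dim_max_face cell_span_empty)
  ultimately show ?thesis using that by blast
qed

text \<open>\<open>cell_diff_twice\<close> deals with non-empty faces only. On an edge both
  endpoints carry the value at the empty face, and these cancel; in lower dimensions nothing is left
  below the empty face.\<close>

lemma EP_differential_twice: "\<delta> (\<delta> m) F = 0"
proof (cases "F face_of Z")
  case True
  consider "aff_dim F \<ge> 2" | "aff_dim F = 1" | "aff_dim F \<le> 0" by linarith
  then show ?thesis
  proof cases
    case 1
    have "\<delta> (\<delta> m) F = cell_diff all_cells (\<delta> m) F"
      using 1 True by (intro EP_differential_eq_cell_diff) auto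
    also have "\<dots> = cell_diff all_cells (cell_diff all_cells m) F"
      using 1 by (intro cell_diff_cong EP_differential_eq_cell_diff) (auto simp: cell_facets_def in_all_cells)
    also have "\<dots> = 0" using True 1 by (intro cell_diff_twice) (auto simp: in_all_cells)
    finally show ?thesis .
  next
    case 2
    then have "F \<in> faces Z 1" using True by (simp add: faces_def)
    then obtain v v' s where "\<delta> (\<delta> m) F
      = signed s (\<delta> m v - \<delta> m v')" "v \<in> faces Z 0" "v' \<in> faces Z 0"
      by (rule EP_differential_edge)
    then show ?thesis by (simp add: EP_differential_vertex)
  next
    case 3
    have "\<delta> m F' = 0" if "F' \<in> faces F (aff_dim F - 1)" for F'
    proof -
      have "aff_dim F' \<le> -1" using that 3 by (auto simp: faces_def)
      then have "faces F' (aff_dim F' - 1) = {}" by (intro faces_less) linarith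
      then show ?thesis by (simp add: EP_differential_eq)
    qed
    then show ?thesis by (simp add: EP_differential_eq)
  qed
qed (simp add: EP_differential_eq)

text \<open>For vertices the change of frame is the empty determinant 1, so constancy up to
  orientation becomes equality.\<close>

lemma vertex_cocycle_constant:
  assumes "\<And>F. F \<in> faces Z 1 \<Longrightarrow> \<delta> m F = 0" "v \<in> faces Z 0" "v' \<in> faces Z 0"
  shows "m v = m v'"
proof -
  obtain g where g: "v = max_face g" using max_face_of_faces assms(2) by blast
  obtain g' where g': "v' = max_face g'" using max_face_of_faces assms(3) by blast
  have d: "dim (flat I u g) = 0" "dim (flat I u g') = 0"
    using assms(2,3) by (auto simp: g g' faces_def aff_dim_max_face)
  then have "ori v = []" "ori v' = []" using length_ori[of g] length_ori[of g'] unfolding g g' by (metis length_0_conv)+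
  moreover have "flat I u g = {0}" "flat I u g' = {0}"
    using d subspace_0[OF subspace_flat] by (auto simp: dim_eq_0)
  moreover have "m (max_face g) = signed (frame_det (frame_of g) (frame_of g')) (m (max_face g'))"
  proof (rule top_cocycle_constant)
    show "cell_diff all_cells m F = 0" if "F \<in> all_cells" "aff_dim F = int (dim (cell_span {} (\<lambda>_. 0))) + 1" for F
      using that assms(1)[of F] EP_differential_eq_cell_diff[of F m]
      by (simp add: in_all_cells cell_span_empty faces_def)
  qed (use assms(2,3) calculation in \<open>auto simp: cell_span_empty in_all_cells g g' faces_def\<close>)
  ultimately show ?thesis using frame_det_self[OF frame_ori[of g]] by (simp add: g g' signed_def)
qed

end

section \<open>The double complex\<close>

lemma sum_fun_apply: "(\<Sum>a\<in>A. h a) x = (\<Sum>a\<in>A. h a x)"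
  for h :: "'a \<Rightarrow> 'b \<Rightarrow> 'c::comm_monoid_add"
  by (induction A rule: infinite_finite_induct) auto

lemma minimal_boundary_diff:
  "minimal_boundary \<H> (c - d) = minimal_boundary \<H> c - minimal_boundary \<H> d"
  by (rule ext) (simp add: minimal_boundary_def minimal_inclusion_def fun_diff_def sum_subtractf fun_eq_iff
    sum_fun_apply)

context arrangement
begin

abbreviation "bnd \<equiv> minimal_boundary \<H>"

section \<open>The minimal complex as a complex of subgroups\<close>

lemma scale_minus_one: "scale (- 1) m = - m"
proof -
  have "scale (0 + 0) m = scale 0 m + scale 0 m" by (rule scale_left_distrib)
  then have "scale 0 m = 0" by simp
  then have "scale (- 1) m + scale 1 m = 0" by (simp flip: scale_left_distrib)
  then show ?thesis by (simp add: scale_one add_eq_0_iff2)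
qed

lemma diff_closed_atom_module: "a \<in> \<H> \<Longrightarrow> diff_closed (M a)"
proof -
  assume "a \<in> \<H>"
  then have M: "submodule (M a)" by (rule submodule_atom)
  have "x - y \<in> M a" if "x \<in> M a" "y \<in> M a" for x y
  proof -
    have "x + scale (- 1) y \<in> M a" using M that unfolding submodule_def by blast
    then show ?thesis by (simp add: scale_minus_one)
  qed
  then show ?thesis using M by (auto simp: diff_closed_def submodule_def)
qed

lemma diff_closed_minimal_module_rk:
  "x \<in> L \<Longrightarrow> rk x = i \<Longrightarrow> diff_closed (minimal_module_rk \<H> M i x)"
proof (induction i arbitrary: x)
  case 0
  then show ?case by (auto simp: diff_closed_def)
next
  case (Suc i)
  let ?D = "direct_sum {y. covered_by \<H> y x} (minimal_module_rk \<H> M i)"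
  have "diff_closed ?D"
    by (rule diff_closed_direct_sum, rule Suc.IH)
      (use Suc.prems rk_covered_by in \<open>auto simp: covered_by_def\<close>)
  then have D0: "0 \<in> ?D" and D: "\<And>p q. p \<in> ?D \<Longrightarrow> q \<in> ?D \<Longrightarrow> p - q \<in> ?D" by (auto simp: diff_closed_def)
  have incl: "minimal_inclusion (n - n') = minimal_inclusion n - minimal_inclusion n'"
    "minimal_inclusion (0 :: 'u dual set list \<Rightarrow> 'm) = 0" for n n' :: "'u dual set list \<Rightarrow> 'm"
    by (auto simp: minimal_inclusion_def fun_eq_iff)
  have bd: "bnd (0 :: 'u dual set \<Rightarrow> 'u dual set list \<Rightarrow> 'm) = 0"
    using minimal_boundary_diff[of \<H> 0 0] by simp
  have Mx: "diff_closed (M x)" if "i = 0"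
    using rk_1[OF Suc.prems(1)] Suc.prems(2) that diff_closed_atom_module by simp
  show ?case unfolding diff_closed_def
  proof (intro conjI ballI)
    show "0 \<in> minimal_module_rk \<H> M (Suc i) x"
      using D0 bd Mx diff_closed_zero by (auto simp: incl)
    fix n n' assume n: "n \<in> minimal_module_rk \<H> M (Suc i) x" "n' \<in> minimal_module_rk \<H> M (Suc i) x"
    then have "minimal_inclusion (n - n') \<in> ?D" unfolding incl(1) by (intro D) auto
    moreover have "(n - n') [UNIV] \<in> M x" if "i = 0"
      using n that diff_closed_diff[OF Mx[OF that]] by auto
    moreover have "bnd (minimal_inclusion (n - n')) = 0" if "i \<noteq> 0"
      using n that by (simp add: incl(1) minimal_boundary_diff)
    ultimately show "n - n' \<in> minimal_module_rk \<H> M (Suc i) x" using n by auto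
  qed
qed

lemma diff_closed_minimal_module: "x \<in> L \<Longrightarrow> diff_closed (minimal_module \<H> M x)"
  by (simp add: minimal_module_def diff_closed_minimal_module_rk)

abbreviation "below \<equiv> minimal_complex_below \<H> M"

lemma diff_closed_below: "diff_closed (below x i)"
  unfolding minimal_complex_below_def by (rule diff_closed_direct_sum) (auto intro: diff_closed_minimal_module)

lemma below_mono: "x \<subseteq> x' \<Longrightarrow> below x' i \<subseteq> below x i"
proof
  fix c assume x: "x \<subseteq> x'" and c: "c \<in> below x' i"
  have "c y \<in> minimal_module \<H> M y" if y: "y \<in> L" "rk y = i" for y
  proof (cases "x' \<subseteq> y")
    case False
    then have "c y = 0" using c by (auto simp: minimal_complex_below_def direct_sum_def)
    then show ?thesis using diff_closed_zero[OF diff_closed_minimal_module[OF y(1)]] by simp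
  qed (use c y in \<open>auto simp: minimal_complex_below_def direct_sum_def\<close>)
  moreover have "c y = 0" if "\<not> (y \<in> L \<and> x \<subseteq> y \<and> rk y = i)" for y
    using c x that by (auto simp: minimal_complex_below_def direct_sum_def)
  ultimately show "c \<in> below x i" by (auto simp: minimal_complex_below_def direct_sum_def)
qed

lemma below_face_mono: "F' \<subseteq> F \<Longrightarrow> below (face_type F') i \<subseteq> below (face_type F) i"
  by (intro below_mono face_type_antimono)

text \<open>Below an atom there is only \<open>UNIV\<close>, so a degree 1 chain is concentrated on
  the list \<open>[UNIV]\<close> and its boundary on the entry at \<open>UNIV\<close> and
  \<open>[]\<close>. The boundary is thus a single element, the sum of the atomic parts.\<close>

lemma minimal_boundary_atoms:
  assumes c: "c \<in> below x 1"
  shows "bnd c = 0 \<longleftrightarrow> (\<Sum>a\<in>\<H>. c a [UNIV]) = 0"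
    and "bnd c UNIV [] = (\<Sum>a\<in>\<H>. c a [UNIV])"
proof -
  show at_UNIV: "bnd c UNIV [] = (\<Sum>a\<in>\<H>. c a [UNIV])"
    by (simp add: minimal_boundary_def covered_by_UNIV minimal_inclusion_def sum_fun_apply)
  have c0: "c a = 0" if "a \<notin> \<H>" for a
    using c that rk_1 by (auto simp: minimal_complex_below_def direct_sum_def)
  have ca: "c a (y # l) = 0" if "y \<noteq> UNIV \<or> l \<noteq> []" for a y l
  proof (cases "a \<in> \<H> \<and> c a \<noteq> 0")
    case True
    then have "c a \<in> minimal_module_rk \<H> M (Suc 0) a"
      using c rk_atom[of a] by (auto simp: minimal_complex_below_def direct_sum_def minimal_module_def)
    then have incl: "minimal_inclusion (c a) \<in> direct_sum {y. covered_by \<H> y a} (minimal_module_rk \<H> M 0)" by simp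
    have "minimal_inclusion (c a) y l = 0"
    proof (cases "covered_by \<H> y a")
      case True
      then have "y = UNIV" using covered_by_atom \<open>a \<in> \<H> \<and> c a \<noteq> 0\<close> by blast
      then show ?thesis using incl True that by (auto simp: direct_sum_def)
    qed (use incl in \<open>auto simp: direct_sum_def\<close>)
    then show ?thesis by (simp add: minimal_inclusion_def)
  qed (use c0 in auto)
  have else_0: "bnd c y l = 0" if "y \<noteq> UNIV \<or> l \<noteq> []" for y l
    using ca[OF that] by (simp add: minimal_boundary_def minimal_inclusion_def sum_fun_apply)
  show "bnd c = 0 \<longleftrightarrow> (\<Sum>a\<in>\<H>. c a [UNIV]) = 0"
  proof
    assume "(\<Sum>a\<in>\<H>. c a [UNIV]) = 0"
    then have "bnd c y l = 0" for y l
      using else_0[of y l] at_UNIV by (cases "y = UNIV \<and> l = []") auto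
    then show "bnd c = 0" by (intro ext) (simp only: zero_fun_apply)
  qed (simp flip: at_UNIV)
qed

text \<open>The term of bidegree \<open>(i, k)\<close> of the double complex. Values away from the
  faces of dimension \<open>k\<close> are left free, which is why equations are only asserted on
  those faces.\<close>

definition cochains :: "nat \<Rightarrow> int \<Rightarrow> ('u set \<Rightarrow> 'u dual set \<Rightarrow> 'u dual set list \<Rightarrow> 'm) set" where
  "cochains i k = {\<zeta>. \<forall>F\<in>faces Z k. \<zeta> F \<in> below (face_type F) i}"

text \<open>The rows split over the elements \<open>y\<close> of rank \<open>i\<close>, and the row
  of \<open>y\<close> is the complex of a region whose span has dimension \<open>rk y = i\<close>;
  \<open>k > i\<close> puts the cocycle above the lowest degree.\<close>

lemma cochains_row_exact:
  assumes \<zeta>: "\<zeta> \<in> cochains i k" and k: "k > int i"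
    and cocycle: "\<And>F. F \<in> faces Z (k + 1) \<Longrightarrow> \<delta> \<zeta> F = 0"
  shows "\<exists>w\<in>cochains i (k - 1). \<forall>F\<in>faces Z k. \<delta> w F = \<zeta> F"
proof -
  let ?K = "\<lambda>y. cells (containing y) (\<lambda>_. 0)"
  have type_iff: "face_type F \<subseteq> y \<longleftrightarrow> F \<in> ?K y" if "F \<in> all_cells" "y \<in> L" for F y
    using that face_type_subset_iff[OF that(2)] by (auto simp: cells_def[of "{}"])
  have comp: "\<delta> \<eta> F y = \<delta> (\<lambda>F. \<eta> F y) F"
    for \<eta> :: "'u set \<Rightarrow> 'u dual set \<Rightarrow> 'u dual set list \<Rightarrow> 'm" and F y
    by (rule EP_differential_additive_map[where \<phi> = "\<lambda>c. c y"]) simp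
  \<comment> \<open>Cutting the differential down to the row of \<open>y\<close> is legitimate
    because the \<open>y\<close>-component vanishes on faces outside that row.\<close>
  have row: "\<delta> (\<lambda>F. \<eta> F y) F = cell_diff (?K y) (\<lambda>F. \<eta> F y) F"
    if "y \<in> L" "F face_of Z" "aff_dim F \<ge> 1" "\<And>F'. F' \<in> faces Z (aff_dim F - 1) \<Longrightarrow> F' \<notin> ?K y \<Longrightarrow> \<eta> F' y = 0"
    for \<eta> :: "'u set \<Rightarrow> 'u dual set \<Rightarrow> 'u dual set list \<Rightarrow> 'm" and F y
  proof -
    have K: "?K y \<subseteq> all_cells" by (auto simp: cells_def)
    then have sub: "cell_facets (?K y) F \<subseteq> cell_facets all_cells F" by (auto simp: cell_facets_def)
    have "\<eta> F' y = 0" if F': "F' \<in> cell_facets all_cells F - cell_facets (?K y) F" for F'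
      by (rule \<open>\<And>F'. F' \<in> faces Z (aff_dim F - 1) \<Longrightarrow> F' \<notin> ?K y \<Longrightarrow> \<eta> F' y = 0\<close>)
        (use F' in \<open>auto simp: cell_facets_def in_all_cells faces_def\<close>)
    then have "cell_diff all_cells (\<lambda>F. \<eta> F y) F = cell_diff (?K y) (\<lambda>F. \<eta> F y) F"
      unfolding cell_diff_def
      by (intro sum.mono_neutral_right finite_cell_facets finite_cells sub) auto
    then show ?thesis using EP_differential_eq_cell_diff[OF that(2,3), of "\<lambda>F. \<eta> F y"] by simp
  qed
  have \<zeta>0: "\<zeta> F y = 0" if "F \<in> faces Z k" "\<not> (y \<in> L \<and> face_type F \<subseteq> y \<and> rk y = i)" for F y
    using \<zeta> that by (auto simp: cochains_def minimal_complex_below_def direct_sum_def)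
  have "\<exists>w. (\<forall>F. w F \<in> minimal_module \<H> M y) \<and>
      (\<forall>F\<in>?K y. aff_dim F = k \<longrightarrow> cell_diff (?K y) w F = \<zeta> F y)"
    if y: "y \<in> L" "rk y = i" for y
  proof (rule cocycle_is_coboundary)
    show "diff_closed (minimal_module \<H> M y)" by (rule diff_closed_minimal_module[OF y(1)])
    show "containing y \<subseteq> \<H>" by (rule containing_subset)
    have "cell_span (containing y) (\<lambda>_. 0) = span (u ` containing y)" by (simp add: cell_span_def)
    then show "int (dim (cell_span (containing y) (\<lambda>_. 0))) < k" using k rk_lattice[OF y(1)] y(2) by simp
    show "\<zeta> F y \<in> minimal_module \<H> M y" if F: "F \<in> ?K y" "aff_dim F = k" for F
    proof -
      have "F \<in> faces Z k" using F by (auto simp: cells_def faces_def max_face_face_of)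
      moreover have "F \<in> all_cells" using F(1) by (auto simp: cells_def)
      ultimately show ?thesis using \<zeta> type_iff[of F y] y F(1)
        by (auto simp: cochains_def minimal_complex_below_def direct_sum_def)
    qed
    show "cell_diff (?K y) (\<lambda>F. \<zeta> F y) F = 0" if F: "F \<in> ?K y" "aff_dim F = k + 1" for F
    proof -
      have Z: "F \<in> faces Z (k + 1)" using F by (auto simp: cells_def faces_def max_face_face_of)
      have "\<delta> (\<lambda>F. \<zeta> F y) F = cell_diff (?K y) (\<lambda>F. \<zeta> F y) F"
      proof (rule row[OF y(1)])
        show "\<zeta> F' y = 0" if "F' \<in> faces Z (aff_dim F - 1)" "F' \<notin> ?K y" for F'
          using \<zeta>0[of F' y] type_iff[of F' y] faces_Z_in_all_cells[of F' k] that F(2) k y by auto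
      qed (use Z F k in \<open>auto simp: faces_def\<close>)
      then show ?thesis using cocycle[OF Z] comp[of \<zeta> F y] by simp
    qed
  qed
  then obtain W where W: "\<And>y F. y \<in> L \<Longrightarrow> rk y = i \<Longrightarrow> W y F \<in> minimal_module \<H> M y"
    "\<And>y F. y \<in> L \<Longrightarrow> rk y = i \<Longrightarrow> F \<in> ?K y \<Longrightarrow> aff_dim F = k \<Longrightarrow> cell_diff (?K y) (W y) F = \<zeta> F y"
    by metis
  define w where "w F y = (if y \<in> L \<and> rk y = i \<and> face_type F \<subseteq> y then W y F else 0)" for F y
  have "w \<in> cochains i (k - 1)"
    using W(1) by (auto simp: cochains_def minimal_complex_below_def direct_sum_def w_def)
  moreover have "\<delta> w F = \<zeta> F" if F: "F \<in> faces Z k" for F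
  proof
    fix y
    have Fc: "F \<in> all_cells" using faces_Z_in_all_cells[OF F] k by simp
    show "\<delta> w F y = \<zeta> F y"
    proof (cases "y \<in> L \<and> rk y = i \<and> face_type F \<subseteq> y")
      case True
      then have FK: "F \<in> ?K y" using type_iff[OF Fc] by blast
      have "\<delta> w F y = \<delta> (\<lambda>F. w F y) F" by (rule comp)
      also have "\<dots> = cell_diff (?K y) (\<lambda>F. w F y) F"
      proof (rule row)
        show "w F' y = 0" if "F' \<in> faces Z (aff_dim F - 1)" "F' \<notin> ?K y" for F'
          using type_iff[of F' y] faces_Z_in_all_cells[OF that(1)] that F k by (auto simp: w_def faces_def)
      qed (use True F k in \<open>auto simp: faces_def\<close>)
      also have "\<dots> = cell_diff (?K y) (W y) F"
      proof (rule cell_diff_cong)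
        fix F' assume F': "F' \<in> cell_facets (?K y) F"
        then have "F' \<in> all_cells" by (auto simp: cell_facets_def cells_def)
        then show "w F' y = W y F'" using type_iff[of F' y] F' True by (auto simp: w_def cell_facets_def)
      qed
      also have "\<dots> = \<zeta> F y" using W(2)[of y F] True FK F by (auto simp: faces_def)
      finally show ?thesis .
    next
      case False
      \<comment> \<open>A face inside \<open>F\<close> has a larger type as a set, so if the type of
        \<open>F\<close> is not contained in \<open>y\<close>, neither is that of any of its
        facets.\<close>
      have "\<delta> (\<lambda>F. w F y) F = \<delta> (\<lambda>F. 0) F"
        using False face_type_antimono[of _ F] by (intro EP_differential_cong) (auto simp: w_def)
      also have "\<dots> = 0" by (simp add: EP_differential_eq)
      finally show ?thesis using \<zeta>0[OF F, of y] False comp[of w F y] by auto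
    qed
  qed
  ultimately show ?thesis by blast
qed

lemma differential_cochains:
  assumes "\<eta> \<in> cochains i (l - 1)" "F \<in> faces Z l"
  shows "\<delta> \<eta> F \<in> below (face_type F) i"
proof (rule EP_differential_in[OF diff_closed_below])
  fix F' assume "F' \<in> faces Z (aff_dim F - 1)" "F' \<subseteq> F"
  then show "\<eta> F' \<in> below (face_type F) i"
    using assms below_face_mono[of F' F i] by (auto simp: cochains_def faces_def)
qed

text \<open>The zigzag. Exactness of the minimal complexes lifts the failure of
  \<open>\<zeta>\<close> to be a cocycle to bidegree \<open>(i + 1, k + 1)\<close>, the recursion
  corrects the lift, and the corrected \<open>\<zeta>\<close> is a true cocycle of its row. Above
  the ambient dimension there are no faces and nothing to prove.\<close>

lemma double_complex_step:
  assumes exact: "\<And>x i. x \<in> L \<Longrightarrow> i \<ge> 1 \<Longrightarrow>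
      exact_at (bnd) (below x (i + 1)) (below x i) (bnd)"
    and "\<zeta> \<in> cochains i k" "i \<ge> 1" "k > int i"
    and "\<And>F. F \<in> faces Z (k + 1) \<Longrightarrow> bnd (\<delta> \<zeta> F) = 0"
  shows "\<exists>w\<in>cochains i (k - 1). \<forall>F\<in>faces Z k. bnd (\<zeta> F - \<delta> w F) = 0"
  using assms(2-)
proof (induction "nat (int DIM('u) + 1 - k)" arbitrary: i k \<zeta> rule: less_induct)
  case less
  have type_L: "face_type F \<in> L" if "F \<in> faces Z l" "l \<ge> 0" for F l
    using max_face_of_faces[OF that] face_type_in_lattice by auto
  have ex: "{b \<in> below (face_type F) i. bnd b = 0} = bnd ` below (face_type F) (i + 1)"
    if "F \<in> faces Z l" "l \<ge> 0" "i \<ge> 1" for F l i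
    using exact[OF type_L[OF that(1,2)] that(3)] by (simp add: exact_at_def)
  have bd: "bnd (\<delta> \<eta> F) = \<delta> (\<lambda>F. bnd (\<eta> F)) F"
    for \<eta> :: "'u set \<Rightarrow> 'u dual set \<Rightarrow> 'u dual set list \<Rightarrow> 'm" and F
    by (rule EP_differential_additive_map[where \<phi> = "bnd"]) (rule minimal_boundary_diff)
  show ?case
  proof (cases "k > int DIM('u)")
    case True
    have "aff_dim F \<noteq> k" for F :: "'u set" using aff_dim_le_DIM[of F] True by linarith
    then have "faces Z k = {}" by (simp add: faces_def)
    moreover have "0 \<in> cochains i (k - 1)" using diff_closed_zero[OF diff_closed_below] by (simp add: cochains_def)
    ultimately show ?thesis by blast
  next
    case False
    have k: "k \<ge> 0" using less.prems by simp
    \<comment> \<open>\<open>\<delta> \<zeta>\<close> is a \<open>bnd\<close>-cycle below the type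
      of each face, so it lifts one degree up. The lift again satisfies the hypothesis of the
      recursion because \<open>\<delta>\<close> squares to zero.\<close>
    have "\<exists>\<xi>. \<xi> \<in> below (face_type F) (i + 1) \<and> bnd \<xi> = \<delta> \<zeta> F"
      if F: "F \<in> faces Z (k + 1)" for F
    proof -
      have "\<delta> \<zeta> F \<in> {b \<in> below (face_type F) i. bnd b = 0}"
        using differential_cochains[of \<zeta> i "k + 1" F] less.prems F by simp
      also have "\<dots> = bnd ` below (face_type F) (i + 1)"
        using ex[OF F _ less.prems(2)] k by simp
      finally show ?thesis by auto
    qed
    then obtain \<xi> where \<xi>: "\<And>F. F \<in> faces Z (k + 1) \<Longrightarrow> \<xi> F \<in> below (face_type F) (i + 1)"
      "\<And>F. F \<in> faces Z (k + 1) \<Longrightarrow> bnd (\<xi> F) = \<delta> \<zeta> F"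
      by metis
    have "\<exists>w\<in>cochains (i + 1) (k + 1 - 1). \<forall>F\<in>faces Z (k + 1). bnd (\<xi> F - \<delta> w F) = 0"
    proof (rule less.hyps)
      show "nat (int DIM('u) + 1 - (k + 1)) < nat (int DIM('u) + 1 - k)" using False by simp
      show "\<xi> \<in> cochains (i + 1) (k + 1)" using \<xi>(1) by (simp add: cochains_def)
      show "bnd (\<delta> \<xi> F) = 0" if F: "F \<in> faces Z (k + 1 + 1)" for F
      proof -
        have "\<delta> (\<lambda>F. bnd (\<xi> F)) F = \<delta> (\<delta> \<zeta>) F"
          using F by (intro EP_differential_cong \<xi>(2)) (simp add: faces_def)
        then show ?thesis by (simp add: bd EP_differential_twice)
      qed
    qed (use less.prems in auto)
    then obtain w' where w': "w' \<in> cochains (i + 1) k"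
      "\<And>F. F \<in> faces Z (k + 1) \<Longrightarrow> bnd (\<xi> F - \<delta> w' F) = 0" by auto
    \<comment> \<open>That \<open>bnd\<close> vanishes on its own image is part of the exactness
      hypothesis.\<close>
    have bw': "bnd (w' F) \<in> below (face_type F) i" "bnd (bnd (w' F)) = 0"
      if F: "F \<in> faces Z k" for F
    proof -
      have "bnd (w' F) \<in> bnd ` below (face_type F) (i + 1)"
        using w'(1) F by (simp add: cochains_def)
      then have "bnd (w' F) \<in> {b \<in> below (face_type F) i. bnd b = 0}"
        using ex[OF F k less.prems(2)] by simp
      then show "bnd (w' F) \<in> below (face_type F) i" "bnd (bnd (w' F)) = 0"
        by auto
    qed
    \<comment> \<open>The correction is a boundary, so it is invisible to \<open>bnd\<close>, and it
      cancels \<open>\<delta> \<zeta>\<close> because \<open>\<xi>\<close> and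
      \<open>\<delta> w'\<close> have the same boundary.\<close>
    define \<zeta>' where "\<zeta>' F = \<zeta> F - bnd (w' F)" for F
    have "\<zeta>' \<in> cochains i k" unfolding cochains_def \<zeta>'_def
      using bw'(1) less.prems(1) diff_closed_diff[OF diff_closed_below] by (simp add: cochains_def)
    moreover have "\<delta> \<zeta>' F = 0" if F: "F \<in> faces Z (k + 1)" for F
    proof -
      have "\<delta> \<zeta>' F = \<delta> \<zeta> F - \<delta> (\<lambda>F. bnd (w' F)) F"
        unfolding \<zeta>'_def by (rule EP_differential_diff)
      also have "\<dots> = bnd (\<xi> F) - bnd (\<delta> w' F)"
        by (simp add: \<xi>(2)[OF F] bd)
      also have "\<dots> = 0" using w'(2)[OF F] by (simp add: minimal_boundary_diff)
      finally show ?thesis .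
    qed
    ultimately obtain w where w: "w \<in> cochains i (k - 1)" "\<And>F. F \<in> faces Z k \<Longrightarrow> \<delta> w F = \<zeta>' F"
      using cochains_row_exact[of \<zeta>' i k] less.prems(3) by blast
    have "bnd (\<zeta> F - \<delta> w F) = 0" if F: "F \<in> faces Z k" for F
      using w(2)[OF F] bw'(2)[OF F] by (simp add: \<zeta>'_def)
    then show ?thesis using w(1) by blast
  qed
qed

section \<open>From the double complex to the modified Euler-Poincare complex\<close>

lemma face_module_iff:
  "x \<in> face_module \<H> M F \<longleftrightarrow>
    (\<exists>m. (\<forall>a. m a \<in> (if a \<in> \<H> \<and> face_type F \<subseteq> a then M a else {0})) \<and> x = (\<Sum>a\<in>\<H>. m a))"
proof
  assume "x \<in> face_module \<H> M F"
  then obtain s where s: "x = sum s {a \<in> \<H>. face_type F \<subseteq> a}" "\<forall>a\<in>{a \<in> \<H>. face_type F \<subseteq> a}. s a \<in> M a"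
    unfolding face_module_def using finite_index by (auto simp: set_sum_alt)
  have "x = (\<Sum>a\<in>\<H>. if face_type F \<subseteq> a then s a else 0)"
    unfolding s(1) using finite_index by (simp add: sum.inter_filter)
  then show "\<exists>m. (\<forall>a. m a \<in> (if a \<in> \<H> \<and> face_type F \<subseteq> a then M a else {0})) \<and> x = (\<Sum>a\<in>\<H>. m a)"
    using s(2) by (intro exI[of _ "\<lambda>a. if a \<in> \<H> \<and> face_type F \<subseteq> a then s a else 0"]) auto
next
  assume "\<exists>m. (\<forall>a. m a \<in> (if a \<in> \<H> \<and> face_type F \<subseteq> a then M a else {0})) \<and> x = (\<Sum>a\<in>\<H>. m a)"
  then obtain m where m: "\<And>a. m a \<in> (if a \<in> \<H> \<and> face_type F \<subseteq> a then M a else {0})" "x = (\<Sum>a\<in>\<H>. m a)" by blast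
  have "m a = 0" if "a \<in> \<H> - {a \<in> \<H>. face_type F \<subseteq> a}" for a using m(1)[of a] that by auto
  then have "x = sum m {a \<in> \<H>. face_type F \<subseteq> a}" unfolding m(2)
    using finite_index by (intro sum.mono_neutral_right) auto
  moreover have "\<forall>a\<in>{a \<in> \<H>. face_type F \<subseteq> a}. m a \<in> M a"
  proof
    fix a assume "a \<in> {a \<in> \<H>. face_type F \<subseteq> a}"
    then show "m a \<in> M a" using m(1)[of a] by simp
  qed
  ultimately show "x \<in> face_module \<H> M F"
    unfolding face_module_def using finite_index by (auto simp: set_sum_alt)
qed

lemma diff_closed_face_module: "diff_closed (face_module \<H> M F)"
  unfolding diff_closed_def
proof (intro conjI ballI)
  have N: "diff_closed (if a \<in> \<H> \<and> face_type F \<subseteq> a then M a else {0})" for a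
    using diff_closed_atom_module by (auto simp: diff_closed_def)
  show "0 \<in> face_module \<H> M F" unfolding face_module_iff
    by (intro exI[of _ "\<lambda>_. 0"]) (use diff_closed_zero[OF N] in simp)
  fix x y assume "x \<in> face_module \<H> M F" "y \<in> face_module \<H> M F"
  then obtain m n where m: "\<And>a. m a \<in> (if a \<in> \<H> \<and> face_type F \<subseteq> a then M a else {0})" "x = (\<Sum>a\<in>\<H>. m a)"
    and n: "\<And>a. n a \<in> (if a \<in> \<H> \<and> face_type F \<subseteq> a then M a else {0})" "y = (\<Sum>a\<in>\<H>. n a)"
    unfolding face_module_iff by blast
  have "\<forall>a. m a - n a \<in> (if a \<in> \<H> \<and> face_type F \<subseteq> a then M a else {0})"
    using diff_closed_diff[OF N m(1) n(1)] by blast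
  moreover have "x - y = (\<Sum>a\<in>\<H>. m a - n a)" by (simp add: m(2) n(2) sum_subtractf)
  ultimately show "x - y \<in> face_module \<H> M F" unfolding face_module_iff
    by (intro exI[of _ "\<lambda>a. m a - n a"] conjI)
qed

lemma face_module_mono: "F' \<subseteq> F \<Longrightarrow> face_module \<H> M F' \<subseteq> face_module \<H> M F"
proof
  fix x assume F: "F' \<subseteq> F" and "x \<in> face_module \<H> M F'"
  then obtain m where m: "\<And>a. m a \<in> (if a \<in> \<H> \<and> face_type F' \<subseteq> a then M a else {0})" "x = (\<Sum>a\<in>\<H>. m a)"
    unfolding face_module_iff by blast
  have "m a \<in> (if a \<in> \<H> \<and> face_type F \<subseteq> a then M a else {0})" for a
    using m(1)[of a] face_type_antimono[OF F] diff_closed_zero[OF diff_closed_atom_module]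
    by (auto split: if_splits)
  then show "x \<in> face_module \<H> M F" unfolding face_module_iff using m(2) by blast
qed

lemma face_type_edge: "e \<in> faces Z 1 \<Longrightarrow> face_type e \<in> \<H>"
proof -
  assume e: "e \<in> faces Z 1"
  then obtain g where g: "e = max_face g" using max_face_of_faces by force
  then have "rk (face_type e) = 1" using e by (simp add: rk_face_type faces_def aff_dim_max_face)
  then show ?thesis using rk_1 face_type_in_lattice g by simp
qed

lemma face_module_edge: "e \<in> faces Z 1 \<Longrightarrow> face_module \<H> M e = M (face_type e)"
proof -
  assume "e \<in> faces Z 1"
  then have "{a \<in> \<H>. face_type e \<subseteq> a} = {face_type e}" using face_type_edge atoms_incomparable by blast
  then show ?thesis by (simp add: face_module_def)
qed

text \<open>\<open>[UNIV]\<close> is the only saturated chain descending from an atom, so a family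
  of atomic elements is stored there; atoms not above \<open>x\<close> in the inclusion of sets
  carry 0.\<close>

lemma atomic_chain:
  assumes "\<And>a. m a \<in> (if a \<in> \<H> \<and> x \<subseteq> a then M a else {0})"
  shows "(\<lambda>a l. if l = [UNIV] then m a else 0) \<in> below x 1"
proof -
  let ?c = "\<lambda>a l. if l = [UNIV] then m a else 0"
  have "?c a \<in> minimal_module \<H> M a" if a: "a \<in> \<H>" "x \<subseteq> a" for a
  proof -
    have "minimal_inclusion (?c a) y \<in> minimal_module_rk \<H> M 0 y" if "covered_by \<H> y a" for y
      using covered_by_atom[OF that a(1)] by (auto simp: minimal_inclusion_def)
    moreover have "minimal_inclusion (?c a) y = 0" if "\<not> covered_by \<H> y a" for y
      using that a(1) covered_by_UNIV[of a] by (auto simp: minimal_inclusion_def fun_eq_iff)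
    ultimately show ?thesis using assms[of a] a rk_atom[OF a(1)]
      by (simp add: minimal_module_def direct_sum_def)
  qed
  then have in_N: "?c a \<in> minimal_module \<H> M a" if "a \<in> {y \<in> L. x \<subseteq> y \<and> rk y = 1}" for a
    using that rk_1[of a] by simp
  have zero: "?c a = 0" if "a \<notin> {y \<in> L. x \<subseteq> y \<and> rk y = 1}" for a
  proof -
    have "\<not> (a \<in> \<H> \<and> x \<subseteq> a)" using that rk_atom[of a] atom_in_lattice[of a] by blast
    then have "m a = 0" using assms[of a] unfolding if_not_P[OF \<open>\<not> (a \<in> \<H> \<and> x \<subseteq> a)\<close>] by simp
    then show ?thesis by (simp add: fun_eq_iff)
  qed
  show ?thesis unfolding minimal_complex_below_def direct_sum_def
  proof (intro CollectI conjI ballI allI impI)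
    fix a assume "a \<in> {y \<in> L. x \<subseteq> y \<and> rk y = 1}"
    then show "?c a \<in> minimal_module \<H> M a" by (rule in_N)
  next
    fix a assume "a \<notin> {y \<in> L. x \<subseteq> y \<and> rk y = 1}"
    then show "?c a = 0" by (rule zero)
  qed
qed

text \<open>The module of a face is the image of the degree 1 chains below its type under
  \<open>?ev\<close>. A cocycle is lifted to such chains, \<open>double_complex_step\<close> is
  applied with \<open>i = 1\<close>, and the solution is evaluated again; \<open>?ev\<close> forgets
  precisely the \<open>bnd\<close>-cycles. The bound \<open>k \<ge> 2\<close> is
  \<open>k > i\<close>.\<close>

lemma modified_EP_exact_ge_2:
  assumes exact: "\<And>x i. x \<in> L \<Longrightarrow> i \<ge> 1 \<Longrightarrow>
      exact_at (bnd) (below x (i + 1)) (below x i) (bnd)"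
    and k: "k \<ge> 2"
    and z: "\<And>F. F \<in> faces Z k \<Longrightarrow> z F \<in> face_module \<H> M F"
    and cocycle: "\<And>F. F \<in> faces Z (k + 1) \<Longrightarrow> \<delta> z F = 0"
  shows "\<exists>w. (\<forall>F\<in>faces Z (k - 1). w F \<in> face_module \<H> M F) \<and> (\<forall>F\<in>faces Z k. \<delta> w F = z F)"
proof -
  let ?ev = "\<lambda>c. \<Sum>a\<in>\<H>. c a [UNIV]"
  have ev_diff: "?ev (c - d) = ?ev c - ?ev d" for c d :: "'u dual set \<Rightarrow> 'u dual set list \<Rightarrow> 'm"
    by (simp add: sum_subtractf)
  have ev: "?ev (\<delta> \<eta> F) = \<delta> (\<lambda>F. ?ev (\<eta> F)) F"
    for \<eta> :: "'u set \<Rightarrow> 'u dual set \<Rightarrow> 'u dual set list \<Rightarrow> 'm" and F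
    by (rule EP_differential_additive_map[where \<phi> = ?ev]) (rule ev_diff)
  have "\<exists>c. c \<in> below (face_type F) 1 \<and> ?ev c = z F" if F: "F \<in> faces Z k" for F
  proof -
    obtain m where m: "\<And>a. m a \<in> (if a \<in> \<H> \<and> face_type F \<subseteq> a then M a else {0})" "z F = (\<Sum>a\<in>\<H>. m a)"
      using z[OF F] unfolding face_module_iff by blast
    show ?thesis using atomic_chain[OF m(1)] m(2)
      by (intro exI[of _ "\<lambda>a l. if l = [UNIV] then m a else 0"]) simp
  qed
  then obtain \<zeta> where \<zeta>: "\<And>F. F \<in> faces Z k \<Longrightarrow> \<zeta> F \<in> below (face_type F) 1" "\<And>F. F \<in> faces Z k \<Longrightarrow> ?ev (\<zeta> F) = z F"
    by metis
  have \<zeta>c: "\<zeta> \<in> cochains 1 k" using \<zeta>(1) by (simp add: cochains_def)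
  have "bnd (\<delta> \<zeta> F) = 0" if F: "F \<in> faces Z (k + 1)" for F
  proof -
    have "?ev (\<delta> \<zeta> F) = \<delta> z F"
      unfolding ev using F by (intro EP_differential_cong \<zeta>(2)) (simp add: faces_def)
    then show ?thesis using minimal_boundary_atoms(1)[OF differential_cochains[of \<zeta> 1 "k + 1" F]] \<zeta>c F cocycle[OF F] by simp
  qed
  then obtain w where w: "w \<in> cochains 1 (k - 1)"
    "\<And>F. F \<in> faces Z k \<Longrightarrow> bnd (\<zeta> F - \<delta> w F) = 0"
    using double_complex_step[OF exact \<zeta>c] k by force
  have "\<delta> (\<lambda>F. ?ev (w F)) F = z F" if F: "F \<in> faces Z k" for F
  proof -
    have "\<zeta> F - \<delta> w F \<in> below (face_type F) 1"
      by (intro diff_closed_diff[OF diff_closed_below] \<zeta>(1) F differential_cochains[OF w(1)])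
    then have "?ev (\<zeta> F - \<delta> w F) = 0"
      using w(2)[OF F] minimal_boundary_atoms(1) by blast
    then show ?thesis unfolding ev_diff ev using \<zeta>(2)[OF F] by simp
  qed
  moreover have "?ev (w F) \<in> face_module \<H> M F" if F: "F \<in> faces Z (k - 1)" for F
    unfolding face_module_iff
  proof (intro exI[of _ "\<lambda>a. w F a [UNIV]"] conjI allI refl)
    fix a
    have c: "w F \<in> below (face_type F) 1" using w(1) F by (simp add: cochains_def)
    show "w F a [UNIV] \<in> (if a \<in> \<H> \<and> face_type F \<subseteq> a then M a else {0})"
    proof (cases "a \<in> \<H> \<and> face_type F \<subseteq> a")
      case True
      then have "w F a \<in> minimal_module_rk \<H> M (Suc 0) a"
        using c rk_atom[of a] atom_in_lattice[of a] by (auto simp: minimal_complex_below_def direct_sum_def minimal_module_def)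
      then show ?thesis using True by simp
    next
      case False
      then have "w F a = 0" using c rk_1[of a] by (auto simp: minimal_complex_below_def direct_sum_def)
      then show ?thesis unfolding if_not_P[OF False] by simp
    qed
  qed
  ultimately show ?thesis by (intro exI[of _ "\<lambda>F. ?ev (w F)"]) simp
qed

lemma modified_EP_iff:
  "w \<in> modified_EP \<H> M Z k \<longleftrightarrow> (\<forall>F. F \<notin> faces Z k \<longrightarrow> w F = 0) \<and>
    (k = 0 \<longrightarrow> (\<forall>e\<in>faces Z 1. \<forall>v\<in>faces e 0. \<forall>v'\<in>faces e 0. w v - w v' \<in> M (face_type e))) \<and>
    (k \<ge> 1 \<longrightarrow> (\<forall>F\<in>faces Z k. w F \<in> face_module \<H> M F))"
proof -
  have "faces Z k = {}" if "k < -1" using that by (rule faces_less)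
  moreover have "k < -1 \<or> k = -1 \<or> k = 0 \<or> k \<ge> 1" by linarith
  ultimately show ?thesis
    by (auto simp: modified_EP_def graphical_module_def direct_sum_def)
qed

lemma EP_differential_modified_EP:
  assumes w: "w \<in> modified_EP \<H> M Z (j - 1)"
  shows "\<delta> w \<in> modified_EP \<H> M Z j"
proof -
  have w0: "\<And>F. F \<notin> faces Z (j - 1) \<Longrightarrow> w F = 0" using w by (simp add: modified_EP_iff)
  have supp: "\<delta> w F = 0" if "F \<notin> faces Z j" for F
    by (rule EP_differential_support[OF w0], assumption) (unfold diff_add_cancel, rule that)
  consider "j \<le> -1" | "j = 0" | "j = 1" | "j \<ge> 2" by linarith
  then show ?thesis
  proof cases
    case 1
    then show ?thesis using supp by (auto simp: modified_EP_iff)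
  next
    case 2
    have "\<delta> w v - \<delta> w v' \<in> M (face_type e)"
      if e: "e \<in> faces Z 1" and v: "v \<in> faces e 0" "v' \<in> faces e 0" for e v v'
    proof -
      have "v \<in> faces Z 0" "v' \<in> faces Z 0" using facet_face(1)[of e Z] e v by (auto simp: faces_def[of Z])
      then show ?thesis using diff_closed_zero[OF diff_closed_atom_module[OF face_type_edge[OF e]]]
        by (simp add: EP_differential_vertex)
    qed
    then show ?thesis using supp 2 by (auto simp: modified_EP_iff)
  next
    case 3
    have "\<delta> w e \<in> face_module \<H> M e" if e: "e \<in> faces Z 1" for e
    proof -
      obtain v v' s where v: "faces e 0 = {v, v'}" "\<delta> w e = signed s (w v - w v')"
        using EP_differential_edge[OF e] .
      have "w v - w v' \<in> M (face_type e)" using w 3 e v(1) by (simp add: modified_EP_iff)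
      then show ?thesis unfolding v(2) face_module_edge[OF e]
        by (rule diff_closed_signed[OF diff_closed_atom_module[OF face_type_edge[OF e]]])
    qed
    then show ?thesis using supp 3 by (auto simp: modified_EP_iff)
  next
    case 4
    have "\<delta> w F \<in> face_module \<H> M F" if F: "F \<in> faces Z j" for F
    proof (rule EP_differential_in[OF diff_closed_face_module])
      fix F' assume "F' \<in> faces Z (aff_dim F - 1)" "F' \<subseteq> F"
      then show "w F' \<in> face_module \<H> M F" using w 4 F face_module_mono[of F' F]
        by (auto simp: modified_EP_iff faces_def)
    qed
    then show ?thesis using supp 4 by (auto simp: modified_EP_iff)
  qed
qed

text \<open>Equality is only required on faces of dimension \<open>j\<close>; elsewhere both sides
  vanish by their supports. The witnesses are cut off outside dimension \<open>j - 1\<close> for the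
  same reason.\<close>

lemma cocycle_in_image:
  assumes exact: "\<And>x i. x \<in> L \<Longrightarrow> i \<ge> 1 \<Longrightarrow>
      exact_at (bnd) (below x (i + 1)) (below x i) (bnd)"
    and z: "z \<in> modified_EP \<H> M Z j" and cocycle: "\<delta> z = 0"
  shows "\<exists>w\<in>modified_EP \<H> M Z (j - 1). \<forall>F\<in>faces Z j. \<delta> w F = z F"
proof -
  have c0: "\<delta> z F = 0" for F using cocycle by simp
  \<comment> \<open>A vertex is needed to read off the value at the empty face in the two lowest
    degrees.\<close>
  obtain v0 where v0: "v0 \<in> faces Z 0"
  proof -
    obtain g where "max_face g \<in> all_cells" "flat \<H> u g = cell_span {} (\<lambda>_. 0)"
      by (rule top_cell_exists[of "{}"]) (auto simp: cells_def)
    then show ?thesis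
      by (intro that[of "max_face g"]) (simp add: faces_def max_face_face_of aff_dim_max_face cell_span_empty)
  qed
  consider "j < -1" | "j = -1" | "j = 0" | "j = 1" | "j \<ge> 2" by linarith
  then show ?thesis
  proof cases
    case 1
    then have "faces Z j = {}" by (rule faces_less)
    moreover have "0 \<in> modified_EP \<H> M Z (j - 1)" using 1 by (simp add: modified_EP_iff)
    ultimately show ?thesis by blast
  next
    case 2
    have "z {} = 0" using c0[of v0] EP_differential_vertex[OF v0, of z] by simp
    moreover have "\<delta> 0 F = (0 :: 'm)" for F by (simp add: EP_differential_eq)
    moreover have "0 \<in> modified_EP \<H> M Z (j - 1)" using 2 by (simp add: modified_EP_iff)
    ultimately show ?thesis using 2 by (intro bexI[of _ 0]) (auto simp: faces_minus_1)
  next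
    case 3
    define w where "w F = (if F = {} then z v0 else 0)" for F :: "'u set"
    have "w \<in> modified_EP \<H> M Z (j - 1)" using 3 by (auto simp: modified_EP_iff faces_minus_1 w_def)
    moreover have "\<delta> w F = z F" if F: "F \<in> faces Z j" for F
    proof -
      have "z F = z v0" by (rule vertex_cocycle_constant) (use c0 F v0 3 in auto)
      then show ?thesis using EP_differential_vertex[of F w] F 3 by (simp add: w_def)
    qed
    ultimately show ?thesis by blast
  next
    case 4
    \<comment> \<open>The row of the minimal element: no sign conditions, and all of the
      coefficients allowed. Membership in the graphical module is checked only afterwards.\<close>
    have "\<exists>y. (\<forall>F. y F \<in> (UNIV :: 'm set)) \<and> (\<forall>F\<in>all_cells. aff_dim F = j \<longrightarrow> cell_diff all_cells y F = z F)"
    proof (rule cocycle_is_coboundary)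
      show "cell_diff all_cells z F = 0" if "F \<in> all_cells" "aff_dim F = j + 1" for F
        using EP_differential_eq_cell_diff[of F z] that 4 c0[of F] by (simp add: in_all_cells)
    qed (use 4 in \<open>auto simp: cell_span_empty diff_closed_def\<close>)
    then obtain y where y: "\<And>F. F \<in> all_cells \<Longrightarrow> aff_dim F = j \<Longrightarrow> cell_diff all_cells y F = z F" by blast
    define w where "w F = (if F \<in> faces Z 0 then y F else 0)" for F
    have wz: "\<delta> w F = z F" if F: "F \<in> faces Z j" for F
    proof -
      have "\<delta> w F = \<delta> y F"
        using F 4 by (intro EP_differential_cong) (auto simp: w_def faces_def)
      also have "\<dots> = z F" using EP_differential_eq_cell_diff[of F y] y[of F] F 4
          faces_Z_in_all_cells[OF F] by (auto simp: faces_def)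
      finally show ?thesis .
    qed
    have "w v - w v' \<in> M (face_type e)" if e: "e \<in> faces Z 1" and v: "v \<in> faces e 0" "v' \<in> faces e 0" for e v v'
    proof -
      have M: "diff_closed (M (face_type e))" by (rule diff_closed_atom_module[OF face_type_edge[OF e]])
      obtain v1 v2 s where v12: "faces e 0 = {v1, v2}" "\<delta> w e = signed s (w v1 - w v2)"
        using EP_differential_edge[OF e] .
      \<comment> \<open>Up to sign, the difference along the edge is the given value
        \<open>z e\<close>, which lies in the module of that edge, so any solution is automatically
        graphical.\<close>
      have "signed s (w v1 - w v2) \<in> M (face_type e)"
      proof -
        have "z e \<in> face_module \<H> M e" using z e 4 by (simp add: modified_EP_iff)
        then show ?thesis using wz[of e] e 4 v12(2) face_module_edge[OF e] by simp
      qed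
      then have "signed s (signed s (w v1 - w v2)) \<in> M (face_type e)"
        by (rule diff_closed_signed[OF M])
      then have d: "w v1 - w v2 \<in> M (face_type e)" by simp
      have "0 - (w v1 - w v2) \<in> M (face_type e)" by (rule diff_closed_diff[OF M diff_closed_zero[OF M] d])
      then show ?thesis using d v v12(1) diff_closed_zero[OF M] by auto
    qed
    then have "w \<in> modified_EP \<H> M Z (j - 1)" using 4 by (auto simp: modified_EP_iff w_def)
    then show ?thesis using wz by blast
  next
    case 5
    have "\<exists>y. (\<forall>F\<in>faces Z (j - 1). y F \<in> face_module \<H> M F) \<and> (\<forall>F\<in>faces Z j. \<delta> y F = z F)"
      by (rule modified_EP_exact_ge_2[OF exact 5]) (use z c0 5 in \<open>simp_all add: modified_EP_iff\<close>)
    then obtain y where y: "\<And>F. F \<in> faces Z (j - 1) \<Longrightarrow> y F \<in> face_module \<H> M F"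
      "\<And>F. F \<in> faces Z j \<Longrightarrow> \<delta> y F = z F" by blast
    define w where "w F = (if F \<in> faces Z (j - 1) then y F else 0)" for F
    have "w \<in> modified_EP \<H> M Z (j - 1)" using y(1) 5 by (auto simp: modified_EP_iff w_def)
    moreover have "\<delta> w F = z F" if F: "F \<in> faces Z j" for F
    proof -
      have "\<delta> w F = \<delta> y F"
        using F by (intro EP_differential_cong) (auto simp: w_def faces_def)
      then show ?thesis using y(2)[OF F] by simp
    qed
    ultimately show ?thesis by blast
  qed
qed

lemma modified_EP_exact:
  assumes exact: "\<And>x i. x \<in> L \<Longrightarrow> i \<ge> 1 \<Longrightarrow>
      exact_at (bnd) (below x (i + 1)) (below x i) (bnd)"
  shows "exact_at (\<delta>) (modified_EP \<H> M Z (j - 1)) (modified_EP \<H> M Z j) (\<delta>)"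
  unfolding exact_at_def
proof
  show "\<delta> ` modified_EP \<H> M Z (j - 1) \<subseteq> {b \<in> modified_EP \<H> M Z j. \<delta> b = 0}"
    using EP_differential_modified_EP EP_differential_twice by (auto simp: fun_eq_iff)
  show "{b \<in> modified_EP \<H> M Z j. \<delta> b = 0} \<subseteq> \<delta> ` modified_EP \<H> M Z (j - 1)"
  proof clarify
    fix z assume z: "z \<in> modified_EP \<H> M Z j" "\<delta> z = 0"
    obtain w where w: "w \<in> modified_EP \<H> M Z (j - 1)" "\<And>F. F \<in> faces Z j \<Longrightarrow> \<delta> w F = z F"
      using cocycle_in_image[OF exact z] by blast
    have "\<delta> w F = z F" for F
    proof (cases "F \<in> faces Z j")
      case False
      then show ?thesis using z(1) EP_differential_modified_EP[OF w(1)] by (simp add: modified_EP_iff)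
    qed (rule w(2))
    then have "z = \<delta> w" by (simp add: fun_eq_iff)
    then show "z \<in> \<delta> ` modified_EP \<H> M Z (j - 1)" using w(1) by blast
  qed
qed

end

theorem proposition6p4:
  fixes scale :: "'r::{ring,monoid_mult} \<Rightarrow> 'm::ab_group_add \<Rightarrow> 'm"
    and \<H> :: "'u::euclidean_space dual set set"
    and M :: "'u dual set \<Rightarrow> 'm set"
    and Z :: "'u set"
    and ori :: "'u set \<Rightarrow> 'u list"
  assumes "finite \<H>"
    and "\<And>H. H \<in> \<H> \<Longrightarrow> linear_hyperplane H"
    and "dual_zonotope \<H> Z"
    and "face_orientations Z ori"
    and "atomic_datum scale \<H> M"
    and "\<And>x i. x \<in> intersection_lattice \<H> \<Longrightarrow> i \<ge> 1 \<Longrightarrow>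
           exact_at (minimal_boundary \<H>) (minimal_complex_below \<H> M x (i + 1))
             (minimal_complex_below \<H> M x i) (minimal_boundary \<H>)"
  shows "\<And>j::int. exact_at (EP_differential ori Z) (modified_EP \<H> M Z (j - 1))
           (modified_EP \<H> M Z j) (EP_differential ori Z)"
proof -
  fix j :: int
  obtain u where u: "\<And>H. H \<in> \<H> \<Longrightarrow> u H \<in> annihilator H \<and> u H \<noteq> 0"
    "Z = (\<Sum>H\<in>\<H>. (\<lambda>t. t *\<^sub>R u H) ` {-1..1})"
    using assms(3) unfolding dual_zonotope_def by blast
  interpret atomic_datum scale \<H> M by (rule assms(5))
  interpret arrangement \<H> u Z ori scale M
    by unfold_locales (use assms u in auto)
  show "exact_at (EP_differential ori Z) (modified_EP \<H> M Z (j - 1))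
           (modified_EP \<H> M Z j) (EP_differential ori Z)"
    by (rule modified_EP_exact) (rule assms(6))
qed



end
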